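(* Let $f\in L_p^0(\mathbb{T}^2)$, $1<p<\infty$, $n_1,n_2\in\{0,1,2,\ldots\}$, $\alpha_1,\alpha_2>0$. Then $$Y_{n_1,n_2}(f)_{L_p(\mathbb{T}^2)}\lesssim \omega_{\alpha_1,\alpha_2}\Big(f,\frac{\pi}{n_1+1},\frac{\pi}{n_2+1}\Big)_{L_p(\mathbb{T}^2)}\lesssim \frac{1}{(n_1+1)^{\alpha_1}(n_2+1)^{\alpha_2}}\sum_{\nu_1=1}^{n_1+1}\sum_{\nu_2=1}^{n_2+1}\nu_1^{\alpha_1-1}\nu_2^{\alpha_2-1}\,Y_{\nu_1-1,\nu_2-1}(f)_{L_p(\mathbb{T}^2)}.$$
   Context: $L_p(\mathbb{T}^2)$, $1<p<\infty$, is the space of measurable functions $f(x,y)$ that are $2\pi$-periodic in each variable with $\|f\|_{L_p(\mathbb{T}^2)}=\big(\int_0^{2\pi}\int_0^{2\pi}|f(x,y)|^p\,dx\,dy\big)^{1/p}<\infty$; $L_p^0(\mathbb{T}^2)$ is the set of $f\in L_p(\mathbb{T}^2)$ with $\int_0^{2\pi}f(x,y)\,dy=0$ for a.e. $x$ and $\int_0^{2\pi}f(x,y)\,dx=0$ for a.e. $y$. For $\alpha_1,\alpha_2>0$ the (fractional) differences are $\Delta_{h_1}^{\alpha_1}(f)=\sum_{\nu=0}^\infty(-1)^\nu\binom{\alpha_1}{\nu}f(x+(\alpha_1-\nu)h_1,y)$ and $\Delta_{h_2}^{\alpha_2}(f)=\sum_{\nu=0}^\infty(-1)^\nu\binom{\alpha_2}{\nu}f(x,y+(\alpha_2-\nu)h_2)$,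 where $\binom{\alpha}{0}=1$, $\binom{\alpha}{\nu}=\frac{\alpha(\alpha-1)\cdots(\alpha-\nu+1)}{\nu!}$ for $\nu\ge1$. The mixed modulus of smoothness is $\omega_{\alpha_1,\alpha_2}(f,\delta_1,\delta_2)_{L_p(\mathbb{T}^2)}=\sup_{|h_i|\le\delta_i,\,i=1,2}\|\Delta_{h_1}^{\alpha_1}(\Delta_{h_2}^{\alpha_2}(f))\|_{L_p(\mathbb{T}^2)}$. The best angular approximation is $Y_{m_1,m_2}(f)_{L_p(\mathbb{T}^2)}=\inf\|f-T_{m_1,\infty}-T_{\infty,m_2}\|_{L_p(\mathbb{T}^2)}$, the infimum over all $T_{m_1,\infty},T_{\infty,m_2}\in L_p(\mathbb{T}^2)$ such that $T_{m_1,\infty}$ is a trigonometric polynomial of degree at most $m_1$ in $x$ (with coefficients depending on $y$) and $T_{\infty,m_2}$ is a trigonometric polynomial of degree at most $m_2$ in $y$ (with coefficients depending on $x$). $A\lesssim B$ means $A\le CB$ with a constant $C>0$ independent of $f$ and $n_1,n_2$ ($C$ may depend on $p,\alpha_1,\alpha_2$). *)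

theory Defs
  imports "HOL-Analysis.Analysis"
begin

text \<open>
  Functions on the torus are represented by genuinely periodic functions on the plane, not by
  equivalence classes. They are complex-valued; real-valued functions are a special case: for real
  \<open>f\<close> the best angular approximation is the same with real as with complex approximants, since
  taking real parts does not increase the norm.
\<close>

definition torus_cell :: "(real \<times> real) set" where
  "torus_cell = {0..2*pi} \<times> {0..2*pi}"

definition Lp_torus :: "real \<Rightarrow> (real \<times> real \<Rightarrow> complex) set" where
  "Lp_torus p = {f. f \<in> borel_measurable lebesgue \<and>
     (\<forall>x y. f (x + 2*pi, y) = f (x, y) \<and> f (x, y + 2*pi) = f (x, y)) \<and>
     set_integrable lebesgue torus_cell (\<lambda>z. norm (f z) powr p)}"

text \<open>As the Bochner integral of a non-integrable function is 0, this is meaningful only on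
  \<^const>\<open>Lp_torus\<close>.\<close>

definition Lp_norm :: "real \<Rightarrow> (real \<times> real \<Rightarrow> complex) \<Rightarrow> real" where
  "Lp_norm p f = (LINT z:torus_cell|lebesgue. norm (f z) powr p) powr (1 / p)"

text \<open>For \<open>f\<close> in \<^const>\<open>Lp_torus\<close> and \<open>p > 1\<close> almost all sections of \<open>f\<close> are integrable over
  a period, so the non-integrable sections do not affect the following conditions.\<close>

definition Lp0_torus :: "real \<Rightarrow> (real \<times> real \<Rightarrow> complex) set" where
  "Lp0_torus p = {f \<in> Lp_torus p.
     (AE x in lebesgue. (LINT y:{0..2*pi}|lebesgue. f (x, y)) = 0) \<and>
     (AE y in lebesgue. (LINT x:{0..2*pi}|lebesgue. f (x, y)) = 0)}"

text \<open>The series are pointwise. For \<open>\<alpha> > 0\<close> the coefficients are absolutely summable, hence for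
  \<open>f\<close> in \<^const>\<open>Lp_torus\<close> (\<open>p > 1\<close>) they converge almost everywhere (and in norm); the arbitrary
  value of \<^const>\<open>suminf\<close> at divergence points only concerns a null set.\<close>

definition frac_diff1 ::
  "real \<Rightarrow> real \<Rightarrow> (real \<times> real \<Rightarrow> complex) \<Rightarrow> real \<times> real \<Rightarrow> complex" where
  "frac_diff1 \<alpha> h f = (\<lambda>(x, y).
     \<Sum>\<nu>. (-1) ^ \<nu> * of_real (\<alpha> gchoose \<nu>) * f (x + (\<alpha> - real \<nu>) * h, y))"

definition frac_diff2 ::
  "real \<Rightarrow> real \<Rightarrow> (real \<times> real \<Rightarrow> complex) \<Rightarrow> real \<times> real \<Rightarrow> complex" where
  "frac_diff2 \<alpha> h f = (\<lambda>(x, y).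
     \<Sum>\<nu>. (-1) ^ \<nu> * of_real (\<alpha> gchoose \<nu>) * f (x, y + (\<alpha> - real \<nu>) * h))"

text \<open>The supremum below is over a bounded set when \<open>f\<close> is in \<^const>\<open>Lp_torus\<close>: by Minkowski's
  inequality the norms are at most the norm of \<open>f\<close> times the product of the two sums of the
  \<open>\<bar>\<alpha>\<^sub>i gchoose \<nu>\<bar>\<close>.\<close>

definition mixed_modulus ::
  "real \<Rightarrow> real \<Rightarrow> real \<Rightarrow> (real \<times> real \<Rightarrow> complex) \<Rightarrow> real \<Rightarrow> real \<Rightarrow> real" where
  "mixed_modulus p \<alpha>\<^sub>1 \<alpha>\<^sub>2 f \<delta>\<^sub>1 \<delta>\<^sub>2 =
     (SUP (h\<^sub>1, h\<^sub>2) \<in> {(h\<^sub>1, h\<^sub>2). \<bar>h\<^sub>1\<bar> \<le> \<delta>\<^sub>1 \<and> \<bar>h\<^sub>2\<bar> \<le> \<delta>\<^sub>2}.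
        Lp_norm p (frac_diff1 \<alpha>\<^sub>1 h\<^sub>1 (frac_diff2 \<alpha>\<^sub>2 h\<^sub>2 f)))"

definition trig_poly1 :: "nat \<Rightarrow> (real \<times> real \<Rightarrow> complex) \<Rightarrow> bool" where
  "trig_poly1 m T \<longleftrightarrow> (\<exists>c :: int \<Rightarrow> real \<Rightarrow> complex. \<forall>x y.
     T (x, y) = (\<Sum>k = - int m..int m. c k y * exp (\<i> * of_int k * of_real x)))"

definition trig_poly2 :: "nat \<Rightarrow> (real \<times> real \<Rightarrow> complex) \<Rightarrow> bool" where
  "trig_poly2 m T \<longleftrightarrow> (\<exists>c :: int \<Rightarrow> real \<Rightarrow> complex. \<forall>x y.
     T (x, y) = (\<Sum>k = - int m..int m. c k x * exp (\<i> * of_int k * of_real y)))"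

definition best_angular_approx ::
  "real \<Rightarrow> nat \<Rightarrow> nat \<Rightarrow> (real \<times> real \<Rightarrow> complex) \<Rightarrow> real" where
  "best_angular_approx p m\<^sub>1 m\<^sub>2 f =
     Inf {Lp_norm p (\<lambda>z. f z - T\<^sub>1 z - T\<^sub>2 z) | T\<^sub>1 T\<^sub>2.
            T\<^sub>1 \<in> Lp_torus p \<and> trig_poly1 m\<^sub>1 T\<^sub>1 \<and> T\<^sub>2 \<in> Lp_torus p \<and> trig_poly2 m\<^sub>2 T\<^sub>2}"

end

theory Submission
  imports Defs "HOL-Probability.Probability"
begin

text \<open>
  Both inequalities are reduced to inequalities in one variable, the other variable being a
  parameter. They can be applied one after the other because operators that act in different
  variables commute. Write \<open>\<tau>\<^sub>t\<close> for the translation \<open>f \<mapsto> f(\<cdot> - t)\<close>, so that a fractional difference is, up to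
  a translation, \<open>(1 - \<tau>\<^sub>t)\<^sup>\<alpha> = \<Sum>\<nu>. c\<^sub>\<nu> \<tau>\<^sub>t\<^sup>\<nu>\<close> with absolutely summable coefficients.

  Direct inequality. Let \<open>K\<close> be a high power of a Fejer kernel, normalised to mean one and of degree
  at most \<open>n\<close>. The average of \<open>(1 - \<tau>\<^sub>t)\<^sup>\<alpha> f\<close> against \<open>K(t)\<close> is \<open>f - V f\<close>, where \<open>V f\<close> is a trigonometric
  polynomial of degree at most \<open>n\<close>: averaging \<open>\<tau>\<^sub>t\<^sup>\<nu> f\<close> multiplies the \<open>k\<close>-th Fourier coefficient of \<open>f\<close>
  by the \<open>\<nu>k\<close>-th one of \<open>K\<close> (lemma \<open>average_differences\<close>). Since \<open>(1 - z\<^sup>2)\<^sup>\<alpha> = (1 + z)\<^sup>\<alpha> (1 - z)\<^sup>\<alpha>\<close>, doubling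
  the step multiplies the norm of a difference at most by a constant, so the norm of
  \<open>(1 - \<tau>\<^sub>t)\<^sup>\<alpha> f\<close> grows at most polynomially in \<open>(n + 1) t\<close>, and the moments of \<open>K\<close> absorb this growth
  (lemma \<open>jackson_one_variable\<close>). In two variables \<open>f - V\<^sub>1 f - V\<^sub>2 (f - V\<^sub>1 f) = (1 - V\<^sub>2) (1 - V\<^sub>1) f\<close> is the
  error of an angular approximation.

  Inverse inequality. In each variable the identity is decomposed into the mean value, differences
  of consecutive dyadic de la Vallee Poussin means, and a remainder (lemma \<open>dblock_telescope\<close>).
  Fractional differences annihilate the mean value, and on trigonometric polynomials of degree \<open>N\<close>
  they satisfy \<open>\<parallel>(1 - \<tau>\<^sub>h)\<^sup>\<alpha> g\<parallel> \<le> C (N \<bar>h\<bar>)\<^sup>\<alpha> \<parallel>g\<parallel>\<close> (lemma \<open>bernstein_fractional\<close>). For \<open>\<alpha> \<le> 1\<close> the latter follows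
  from \<open>\<parallel>g - \<tau>\<^sub>h g\<parallel> \<le> C min 1 (N \<bar>h\<bar>) \<parallel>g\<parallel>\<close> and \<open>(1 - \<tau>\<^sub>h)\<^sup>\<alpha> = \<Sum>\<nu>\<ge>1. \<bar>c\<^sub>\<nu>\<bar> (1 - \<tau>\<^sub>h\<^sup>\<nu>)\<close>, as
  \<open>\<Sum>\<nu>\<ge>1. \<bar>c\<^sub>\<nu>\<bar> (1 - (1 - \<epsilon>)\<^sup>\<nu>) = \<epsilon>\<^sup>\<alpha>\<close>; larger \<open>\<alpha>\<close> are reached by additional first differences.
  The product of two blocks, one in each variable, is bounded and annihilates all admissible
  approximants, so its norm is at most a constant times the best angular approximation
  (lemma \<open>nrm_dblock_dblock\<close>). Comparing the dyadic sums with the full sums ends the proof.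

  The estimates are carried out for periodic Borel functions and a seminorm that is a constant
  multiple of the norm of the statement; identities between operators hold almost everywhere.
\<close>

section \<open>The circle and the torus\<close>

text \<open>The uniform probability measure on a period, as a measure on the whole line.\<close>

definition circ :: "real measure" where
  "circ = density lborel (\<lambda>x. ennreal (1 / (2 * pi)) * indicator {0..<2 * pi} x)"

text \<open>The representative in \<open>[0, 2\<pi>)\<close> of a real number modulo \<open>2\<pi>\<close>.\<close>

definition wrap :: "real \<Rightarrow> real" where
  "wrap x = x - 2 * pi * of_int \<lfloor>x / (2 * pi)\<rfloor>"

lemma sets_circ [simp, measurable_cong]: "sets circ = sets borel"
  by (simp add: circ_def)

lemma space_circ [simp]: "space circ = UNIV"
  by (simp add: circ_def)

lemma nn_integral_circ:
  assumes [measurable]: "f \<in> borel_measurable borel"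
  shows "(\<integral>\<^sup>+x. f x \<partial>circ) = ennreal (1 / (2 * pi)) * (\<integral>\<^sup>+x. f x * indicator {0..<2 * pi} x \<partial>lborel)"
proof -
  have "(\<integral>\<^sup>+x. f x \<partial>circ) = (\<integral>\<^sup>+x. ennreal (1 / (2 * pi)) * (f x * indicator {0..<2 * pi} x) \<partial>lborel)"
    unfolding circ_def by (subst nn_integral_density) (auto simp: ac_simps)
  also have "\<dots> = ennreal (1 / (2 * pi)) * (\<integral>\<^sup>+x. f x * indicator {0..<2 * pi} x \<partial>lborel)"
    by (subst nn_integral_cmult) auto
  finally show ?thesis .
qed

interpretation circ: prob_space circ
proof
  have "emeasure circ (space circ) = (\<integral>\<^sup>+x. 1 \<partial>circ)" by simp
  also have "\<dots> = ennreal (1 / (2 * pi)) * (\<integral>\<^sup>+x. indicator {0..<2 * pi} x \<partial>lborel)"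
    by (subst nn_integral_circ) auto
  also have "\<dots> = ennreal (1 / (2 * pi)) * ennreal (2 * pi)"
    by simp
  also have "\<dots> = 1" by (subst ennreal_mult[symmetric]) auto
  finally show "emeasure circ (space circ) = 1" .
qed

interpretation circ2: pair_prob_space circ circ ..

abbreviation torus :: "(real \<times> real) measure" where
  "torus \<equiv> circ \<Otimes>\<^sub>M circ"

lemma sets_torus [simp, measurable_cong]: "sets torus = sets borel"
  by (simp add: borel_prod[symmetric] cong: sets_pair_measure_cong)

lemma space_torus [simp]: "space torus = UNIV"
  by (simp add: space_pair_measure)

lemma wrap_mem: "wrap x \<in> {0..<2 * pi}"
proof -
  define k where "k = (of_int \<lfloor>x / (2 * pi)\<rfloor> :: real)"
  have "k \<le> x / (2 * pi)" "x / (2 * pi) < k + 1"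
    unfolding k_def by linarith+
  then have "k * (2 * pi) \<le> x" "x < (k + 1) * (2 * pi)"
    by (simp_all only: pos_le_divide_eq pos_divide_less_eq pi_gt_zero zero_less_mult_iff zero_less_numeral simp_thms)
  then show ?thesis
    unfolding wrap_def k_def[symmetric] by (simp add: algebra_simps)
qed

lemma wrap_id: "x \<in> {0..<2 * pi} \<Longrightarrow> wrap x = x"
proof -
  assume "x \<in> {0..<2 * pi}"
  then have "\<lfloor>x / (2 * pi)\<rfloor> = 0" by (subst floor_eq_iff) auto
  then show ?thesis by (simp add: wrap_def)
qed

lemma wrap_measurable [measurable]: "wrap \<in> borel_measurable borel"
  unfolding wrap_def by measurable

lemma periodic_int:
  fixes f :: "real \<Rightarrow> 'a"
  assumes per: "\<And>x. f (x + 2 * pi) = f x"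
  shows "f (x + 2 * pi * of_int k) = f x"
proof (induction k rule: int_induct[where k = 0])
  case (step1 i)
  have "f (x + 2 * pi * of_int (i + 1)) = f ((x + 2 * pi * of_int i) + 2 * pi)"
    by (simp add: algebra_simps)
  then show ?case using step1 per by simp
next
  case (step2 i)
  have "f (x + 2 * pi * of_int i) = f ((x + 2 * pi * of_int (i - 1)) + 2 * pi)"
    by (simp add: algebra_simps)
  then show ?case using step2 per by simp
qed simp

lemma periodic_wrap:
  fixes f :: "real \<Rightarrow> 'a"
  assumes "\<And>x. f (x + 2 * pi) = f x"
  shows "f (wrap x) = f x"
  using periodic_int[of f "wrap x" "\<lfloor>x / (2 * pi)\<rfloor>", OF assms] by (simp add: wrap_def)

lemma wrap_periodic: "wrap (x + 2 * pi) = wrap x"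
proof -
  have "(x + 2 * pi) / (2 * pi) = x / (2 * pi) + 1" by (simp add: field_simps)
  then show ?thesis by (simp add: wrap_def algebra_simps)
qed

lemma nn_integral_period:
  fixes f :: "real \<Rightarrow> ennreal"
  assumes [measurable]: "f \<in> borel_measurable borel" and per: "\<And>x. f (x + 2 * pi) = f x"
  shows "(\<integral>\<^sup>+x. f x * indicator {a..<a + 2 * pi} x \<partial>lborel)
    = (\<integral>\<^sup>+x. f x * indicator {0..<2 * pi} x \<partial>lborel)"
proof -
  define m where "m = \<lfloor>a / (2 * pi)\<rfloor>"
  define b where "b = wrap a"
  have ab: "a = b + 2 * pi * of_int m" and b: "0 \<le> b" "b < 2 * pi"
    using wrap_mem[of a] by (auto simp: b_def m_def wrap_def)
  have "(\<integral>\<^sup>+x. f x * indicator {a..<a + 2 * pi} x \<partial>lborel)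
      = (\<integral>\<^sup>+x. f (2 * pi * of_int m + 1 * x) * indicator {a..<a + 2 * pi} (2 * pi * of_int m + 1 * x) \<partial>lborel)"
    by (subst nn_integral_real_affine[where c = 1 and t = "2 * pi * of_int m"]) auto
  also have "\<dots> = (\<integral>\<^sup>+x. f x * indicator {b..<b + 2 * pi} x \<partial>lborel)"
    using periodic_int[of f, OF per]
    by (intro nn_integral_cong) (auto simp: ab indicator_def add.commute)
  also have "\<dots> = (\<integral>\<^sup>+x. (f x * indicator {b..<2 * pi} x + f x * indicator {2 * pi..<b + 2 * pi} x) \<partial>lborel)"
    using b by (intro nn_integral_cong) (auto simp: indicator_def)
  also have "\<dots> = (\<integral>\<^sup>+x. f x * indicator {b..<2 * pi} x \<partial>lborel) + (\<integral>\<^sup>+x. f x * indicator {2 * pi..<b + 2 * pi} x \<partial>lborel)"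
    by (subst nn_integral_add) auto
  also have "(\<integral>\<^sup>+x. f x * indicator {2 * pi..<b + 2 * pi} x \<partial>lborel)
      = (\<integral>\<^sup>+x. f (2 * pi + 1 * x) * indicator {2 * pi..<b + 2 * pi} (2 * pi + 1 * x) \<partial>lborel)"
    by (subst nn_integral_real_affine[where c = 1 and t = "2 * pi"]) auto
  also have "\<dots> = (\<integral>\<^sup>+x. f x * indicator {0..<b} x \<partial>lborel)"
    using per by (intro nn_integral_cong) (auto simp: indicator_def add.commute)
  also have "(\<integral>\<^sup>+x. f x * indicator {b..<2 * pi} x \<partial>lborel) + (\<integral>\<^sup>+x. f x * indicator {0..<b} x \<partial>lborel)
      = (\<integral>\<^sup>+x. (f x * indicator {b..<2 * pi} x + f x * indicator {0..<b} x) \<partial>lborel)"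
    by (subst nn_integral_add) auto
  also have "\<dots> = (\<integral>\<^sup>+x. f x * indicator {0..<2 * pi} x \<partial>lborel)"
    using b by (intro nn_integral_cong) (auto simp: indicator_def)
  finally show ?thesis .
qed

lemma nn_integral_circ_shift:
  fixes f :: "real \<Rightarrow> ennreal"
  assumes [measurable]: "f \<in> borel_measurable borel" and per: "\<And>x. f (x + 2 * pi) = f x"
  shows "(\<integral>\<^sup>+x. f (a + x) \<partial>circ) = (\<integral>\<^sup>+x. f x \<partial>circ)"
proof -
  have "(\<integral>\<^sup>+x. f x * indicator {a..<a + 2 * pi} x \<partial>lborel)
     = (\<integral>\<^sup>+x. f (a + 1 * x) * indicator {a..<a + 2 * pi} (a + 1 * x) \<partial>lborel)"
    by (subst nn_integral_real_affine[where c = 1 and t = a]) auto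
  also have "\<dots> = (\<integral>\<^sup>+x. f (a + x) * indicator {0..<2 * pi} x \<partial>lborel)"
    by (intro nn_integral_cong) (auto simp: indicator_def)
  finally show ?thesis
    using nn_integral_period[of f a, OF _ per] by (simp add: nn_integral_circ)
qed

lemma nn_integral_circ_reflect:
  fixes f :: "real \<Rightarrow> ennreal"
  assumes [measurable]: "f \<in> borel_measurable borel" and per: "\<And>x. f (x + 2 * pi) = f x"
  shows "(\<integral>\<^sup>+x. f (- x) \<partial>circ) = (\<integral>\<^sup>+x. f x \<partial>circ)"
proof -
  have "(\<integral>\<^sup>+x. f x * indicator {-2 * pi..<-2 * pi + 2 * pi} x \<partial>lborel)
     = (\<integral>\<^sup>+x. f (- x) * indicator {-2 * pi..<0} (- x) \<partial>lborel)"
    using nn_integral_real_affine[where c = "-1" and t = 0 and f = "\<lambda>x. f x * indicator {-2 * pi..<0} x"] by simp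
  also have "\<dots> = (\<integral>\<^sup>+x. f (- x) * indicator {0..<2 * pi} x \<partial>lborel)"
  proof (rule nn_integral_cong_AE)
    have "AE x in lborel. x \<noteq> (0::real)" "AE x in lborel. x \<noteq> 2 * pi"
      by (auto intro!: AE_lborel_singleton)
    then show "AE x in lborel. f (- x) * indicator {- 2 * pi..<0} (- x) = f (- x) * indicator {0..<2 * pi} x"
      by eventually_elim (auto simp: indicator_def)
  qed
  finally show ?thesis
    using nn_integral_period[of f "-2 * pi", OF _ per] by (simp add: nn_integral_circ)
qed

lemma nn_integral_circ_dilate:
  fixes f :: "real \<Rightarrow> ennreal"
  assumes [measurable]: "f \<in> borel_measurable borel" and per: "\<And>x. f (x + 2 * pi) = f x"
    and "0 < m"
  shows "(\<integral>\<^sup>+x. f (real m * x) \<partial>circ) = (\<integral>\<^sup>+x. f x \<partial>circ)"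
proof -
  have *: "(\<integral>\<^sup>+x. f x * indicator {0..<2 * pi * real n} x \<partial>lborel)
      = of_nat n * (\<integral>\<^sup>+x. f x * indicator {0..<2 * pi} x \<partial>lborel)" for n
  proof (induction n)
    case (Suc n)
    have "(\<integral>\<^sup>+x. f x * indicator {0..<2 * pi * real (Suc n)} x \<partial>lborel)
       = (\<integral>\<^sup>+x. (f x * indicator {0..<2 * pi * real n} x
            + f x * indicator {2 * pi * real n..<2 * pi * real n + 2 * pi} x) \<partial>lborel)"
    proof (intro nn_integral_cong)
      fix x :: real
      define u where "u = 2 * pi * real n"
      have u: "0 \<le> u" "2 * pi * real (Suc n) = u + 2 * pi"
        by (simp_all add: u_def algebra_simps)
      show "f x * indicator {0..<2 * pi * real (Suc n)} x = f x * indicator {0..<2 * pi * real n} x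
            + f x * indicator {2 * pi * real n..<2 * pi * real n + 2 * pi} x"
        unfolding u(2) u_def[symmetric] using u(1) by (auto simp: indicator_def) (use pi_gt_zero in linarith)
    qed
    also have "\<dots> = (\<integral>\<^sup>+x. f x * indicator {0..<2 * pi * real n} x \<partial>lborel)
        + (\<integral>\<^sup>+x. f x * indicator {0..<2 * pi} x \<partial>lborel)"
      by (subst nn_integral_add) (auto simp: nn_integral_period[of f, OF _ per])
    finally show ?case
      unfolding Suc.IH by (simp only: of_nat_Suc distrib_right mult_1_left add.commute)
  qed simp
  have "(\<integral>\<^sup>+x. f x * indicator {0..<2 * pi * real m} x \<partial>lborel)
     = ennreal (real m) * (\<integral>\<^sup>+x. f (0 + real m * x) * indicator {0..<2 * pi * real m} (0 + real m * x) \<partial>lborel)"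
    using \<open>0 < m\<close> by (subst nn_integral_real_affine[where c = "real m" and t = 0]) auto
  also have "(\<integral>\<^sup>+x. f (0 + real m * x) * indicator {0..<2 * pi * real m} (0 + real m * x) \<partial>lborel)
     = (\<integral>\<^sup>+x. f (real m * x) * indicator {0..<2 * pi} x \<partial>lborel)"
    using \<open>0 < m\<close>
    by (intro nn_integral_cong) (auto simp: indicator_def field_simps zero_le_mult_iff)
  finally have "ennreal (real m) * (\<integral>\<^sup>+x. f (real m * x) * indicator {0..<2 * pi} x \<partial>lborel)
     = ennreal (real m) * (\<integral>\<^sup>+x. f x * indicator {0..<2 * pi} x \<partial>lborel)"
    using *[of m] by (simp add: ennreal_of_nat_eq_real_of_nat)
  then have "(\<integral>\<^sup>+x. f (real m * x) * indicator {0..<2 * pi} x \<partial>lborel)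
     = (\<integral>\<^sup>+x. f x * indicator {0..<2 * pi} x \<partial>lborel)"
    using \<open>0 < m\<close> by (subst (asm) ennreal_mult_cancel_left) auto
  then show ?thesis by (simp add: nn_integral_circ)
qed

text \<open>A translation, possibly composed with a dilation by a nonzero integer, preserves the measure of
  the circle. This transfers to all integrals of periodic functions at once.\<close>

lemma distr_circ_wrap:
  fixes s a :: real
  assumes "\<exists>m>0. s = real m \<or> s = - real m"
  shows "distr circ borel (\<lambda>t. wrap (a + s * t)) = circ"
proof (rule measure_eqI)
  fix A assume "A \<in> sets (distr circ borel (\<lambda>t. wrap (a + s * t)))"
  then have [measurable]: "A \<in> sets borel" by simp
  define g :: "real \<Rightarrow> ennreal" where "g x = indicator A (wrap x)" for x
  have [measurable]: "g \<in> borel_measurable borel" unfolding g_def by measurable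
  have per: "g (x + 2 * pi) = g x" for x by (simp add: g_def wrap_periodic)
  obtain m where m: "m > 0" "s = real m \<or> s = - real m" using assms by blast
  have "emeasure (distr circ borel (\<lambda>t. wrap (a + s * t))) A = (\<integral>\<^sup>+t. g (a + s * t) \<partial>circ)"
    unfolding g_def by (subst nn_integral_indicator[symmetric], simp, subst nn_integral_distr) auto
  also have "\<dots> = (\<integral>\<^sup>+t. g t \<partial>circ)"
    using m(2)
  proof
    assume s: "s = real m"
    have per': "g (a + (x + 2 * pi)) = g (a + x)" for x using per[of "a + x"] by (simp add: add.assoc)
    have "(\<integral>\<^sup>+t. g (a + s * t) \<partial>circ) = (\<integral>\<^sup>+t. g (a + t) \<partial>circ)"
      unfolding s using m(1) per' by (intro nn_integral_circ_dilate[where f = "\<lambda>t. g (a + t)"]) auto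
    also have "\<dots> = (\<integral>\<^sup>+t. g t \<partial>circ)" by (rule nn_integral_circ_shift) (auto simp: per)
    finally show ?thesis .
  next
    assume s: "s = - real m"
    have per': "g (a - (x + 2 * pi)) = g (a - x)" for x
      using per[of "a - (x + 2 * pi)"] by (simp add: algebra_simps)
    have per2: "g (a + (x + 2 * pi)) = g (a + x)" for x using per[of "a + x"] by (simp add: add.assoc)
    have "(\<integral>\<^sup>+t. g (a + s * t) \<partial>circ) = (\<integral>\<^sup>+t. g (a - t) \<partial>circ)"
      unfolding s using m(1) per' nn_integral_circ_dilate[where f = "\<lambda>t. g (a - t)"] by simp
    also have "\<dots> = (\<integral>\<^sup>+t. g (a + t) \<partial>circ)"
      using nn_integral_circ_reflect[where f = "\<lambda>t. g (a + t)"] per2 by simp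
    also have "\<dots> = (\<integral>\<^sup>+t. g t \<partial>circ)" by (rule nn_integral_circ_shift) (auto simp: per)
    finally show ?thesis .
  qed
  also have "\<dots> = (\<integral>\<^sup>+t. indicator A t \<partial>circ)"
  proof -
    have "(\<lambda>x. g x * indicator {0..<2 * pi} x) = (\<lambda>x. indicator A x * indicator {0..<2 * pi} x)"
      by (auto simp: g_def indicator_def wrap_id fun_eq_iff)
    then show ?thesis by (simp only: nn_integral_circ[of g] nn_integral_circ[of "indicator A"]
          borel_measurable_indicator \<open>A \<in> sets borel\<close> \<open>g \<in> borel_measurable borel\<close>)
  qed
  also have "\<dots> = emeasure circ A" by (rule nn_integral_indicator) simp
  finally show "emeasure (distr circ borel (\<lambda>t. wrap (a + s * t))) A = emeasure circ A" .
qed simp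

lemma
  fixes \<phi> :: "real \<Rightarrow> complex"
  assumes [measurable]: "\<phi> \<in> borel_measurable borel" and per: "\<And>x. \<phi> (x + 2 * pi) = \<phi> x"
    and s: "\<exists>m>0. s = real m \<or> s = - real m"
  shows integrable_circ_affine: "integrable circ (\<lambda>t. \<phi> (a + s * t)) \<longleftrightarrow> integrable circ \<phi>"
    and integral_circ_affine: "(\<integral>t. \<phi> (a + s * t) \<partial>circ) = (\<integral>t. \<phi> t \<partial>circ)"
proof -
  have "(\<lambda>t. \<phi> (a + s * t)) = (\<lambda>t. \<phi> (wrap (a + s * t)))"
    using periodic_wrap[of \<phi>, OF per] by simp
  then have "integrable circ (\<lambda>t. \<phi> (a + s * t)) \<longleftrightarrow> integrable (distr circ borel (\<lambda>t. wrap (a + s * t))) \<phi>"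
    "(\<integral>t. \<phi> (a + s * t) \<partial>circ) = (\<integral>t. \<phi> t \<partial>distr circ borel (\<lambda>t. wrap (a + s * t)))"
    by (simp_all add: integrable_distr_eq integral_distr)
  then show "integrable circ (\<lambda>t. \<phi> (a + s * t)) \<longleftrightarrow> integrable circ \<phi>"
    "(\<integral>t. \<phi> (a + s * t) \<partial>circ) = (\<integral>t. \<phi> t \<partial>circ)"
    by (simp_all add: distr_circ_wrap[OF s])
qed

section \<open>The norm on the torus\<close>

text \<open>The tangent inequality for \<open>u \<mapsto> u\<^sup>p\<close>, at the end point \<open>u = 0\<close> as well; it yields Jensen's inequality
  in the next lemma and, after it, the convexity estimate behind Minkowski's inequality.\<close>

lemma powr_above_tangent:
  fixes u a p :: real
  assumes "1 < p" "0 \<le> u" "0 < a"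
  shows "a powr p + p * a powr (p - 1) * (u - a) \<le> u powr p"
proof (cases "u = 0")
  case True
  have "a powr (p - 1) * a = a powr p" using \<open>0 < a\<close> by (simp add: powr_diff)
  then have "a powr p + p * a powr (p - 1) * (u - a) = (1 - p) * a powr p"
    using True by (simp add: algebra_simps)
  also have "\<dots> \<le> 0" using assms by (simp add: mult_le_0_iff)
  finally show ?thesis by (rule order_trans) simp
next
  case False
  have "u powr p - a powr p \<ge> (p * a powr (p - 1)) * (u - a)"
  proof (rule convex_on_imp_above_tangent[where A = "{0<..}"])
    show "convex_on {0<..} (\<lambda>x. x powr p)" using assms by (intro powr_convex) auto
    show "((\<lambda>x. x powr p) has_field_derivative p * a powr (p - 1)) (at a within {0<..})"
      using \<open>0 < a\<close> by (auto intro!: derivative_eq_intros)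
  qed (use assms False in \<open>auto simp: interior_open\<close>)
  then show ?thesis by simp
qed

lemma (in prob_space) jensen_powr:
  fixes h :: "'a \<Rightarrow> complex"
  assumes p: "1 < p" and [measurable]: "h \<in> borel_measurable M"
    and fin: "(\<integral>\<^sup>+x. ennreal (norm (h x) powr p) \<partial>M) < \<infinity>"
  shows "integrable M h"
    and "ennreal (norm (\<integral>x. h x \<partial>M) powr p) \<le> (\<integral>\<^sup>+x. ennreal (norm (h x) powr p) \<partial>M)"
proof -
  have int: "integrable M (\<lambda>x. norm (h x) powr p)"
    using fin by (intro integrableI_bounded) auto
  show 1: "integrable M h"
  proof (rule Bochner_Integration.integrable_bound)
    show "integrable M (\<lambda>x. 1 + norm (h x) powr p)" using int by auto
    show "AE x in M. norm (h x) \<le> norm (1 + norm (h x) powr p)"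
    proof (intro AE_I2)
      fix x
      show "norm (h x) \<le> norm (1 + norm (h x) powr p)"
      proof (cases "norm (h x) \<le> 1")
        case False
        then have "norm (h x) powr 1 \<le> norm (h x) powr p" using p by (intro powr_mono) auto
        then show ?thesis using False by (simp add: abs_if)
      qed (simp add: add_increasing2)
    qed
  qed simp
  define a where "a = (\<integral>x. norm (h x) \<partial>M)"
  have a0: "0 \<le> a" by (simp add: a_def)
  have "a powr p \<le> (\<integral>x. norm (h x) powr p \<partial>M)"
  proof (cases "a = 0")
    case False
    with a0 have "0 < a" by simp
    have "a powr p = (\<integral>x. a powr p + p * a powr (p - 1) * (norm (h x) - a) \<partial>M)"
      using 1 by (simp add: a_def[symmetric] prob_space)
    also have "\<dots> \<le> (\<integral>x. norm (h x) powr p \<partial>M)"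
      using 1 int powr_above_tangent[OF p _ \<open>0 < a\<close>] by (intro integral_mono) auto
    finally show ?thesis .
  qed simp
  moreover have "norm (\<integral>x. h x \<partial>M) powr p \<le> a powr p"
    unfolding a_def using p by (intro powr_mono2 integral_norm_bound) auto
  ultimately have "ennreal (norm (\<integral>x. h x \<partial>M) powr p) \<le> ennreal (\<integral>x. norm (h x) powr p \<partial>M)"
    by (intro ennreal_leI) linarith
  also have "\<dots> = (\<integral>\<^sup>+x. ennreal (norm (h x) powr p) \<partial>M)"
    using int by (intro nn_integral_eq_integral[symmetric]) auto
  finally show "ennreal (norm (\<integral>x. h x \<partial>M) powr p) \<le> (\<integral>\<^sup>+x. ennreal (norm (h x) powr p) \<partial>M)" .
qed

text \<open>Convexity of \<open>u \<mapsto> u\<^sup>p\<close> for the weights \<open>a / (a + b)\<close> and \<open>b / (a + b)\<close>. Integrated with \<open>a\<close> and \<open>b\<close> close to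
  the norms of the two summands, this gives the triangle inequality.\<close>

lemma powr_sum_weighted:
  fixes a b s t p :: real
  assumes "1 < p" "0 < a" "0 < b" "0 \<le> s" "0 \<le> t"
  shows "(s + t) powr p \<le> (a + b) powr (p - 1) * (a powr (1 - p) * s powr p + b powr (1 - p) * t powr p)"
proof -
  define c where "c = (s + t) / (a + b)"
  have c0: "0 \<le> c" using assms by (simp add: c_def)
  show ?thesis
  proof (cases "c = 0")
    case True
    then have "s = 0" "t = 0" using assms by (auto simp: c_def add_nonneg_eq_0_iff)
    then show ?thesis using assms by simp
  next
    case False
    with c0 have "0 < c" by simp
    have ta: "x * c powr p + p * c powr (p - 1) * (u - x * c) \<le> x powr (1 - p) * u powr p"
      if "0 < x" "0 \<le> u" for x u :: real
    proof -
      have "c powr p + p * c powr (p - 1) * (u / x - c) \<le> (u / x) powr p"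
        using that assms \<open>0 < c\<close> by (intro powr_above_tangent) auto
      then have "x * (c powr p + p * c powr (p - 1) * (u / x - c)) \<le> x * (u / x) powr p"
        using that by (intro mult_left_mono) auto
      also have "x * (u / x) powr p = x powr (1 - p) * u powr p"
        using that by (simp add: powr_divide powr_diff)
      also have "x * (c powr p + p * c powr (p - 1) * (u / x - c)) = x * c powr p + p * c powr (p - 1) * (u - x * c)"
        using that by (simp add: field_simps)
      finally show ?thesis .
    qed
    have st: "s + t = (a + b) * c" using assms by (simp add: c_def)
    have "(s + t) powr p = (a + b) powr (p - 1) * ((a + b) * c powr p)"
      using assms c0 unfolding st by (simp add: powr_mult powr_diff)
    also have "(a + b) * c powr p = (a * c powr p + p * c powr (p - 1) * (s - a * c))
        + (b * c powr p + p * c powr (p - 1) * (t - b * c))"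
    proof -
      have "p * c powr (p - 1) * (s - a * c) + p * c powr (p - 1) * (t - b * c)
          = p * c powr (p - 1) * ((s + t) - (a + b) * c)" by (simp add: algebra_simps)
      then show ?thesis by (simp add: st algebra_simps)
    qed
    also have "\<dots> \<le> a powr (1 - p) * s powr p + b powr (1 - p) * t powr p"
      using assms by (intro add_mono ta) auto
    finally show ?thesis by (simp add: mult_left_mono)
  qed
qed

locale torus_Lp =
  fixes p :: real
  assumes p_gt_1: "1 < p"
begin

text \<open>The \<open>p\<close>-th power of the seminorm, possibly infinite.\<close>

definition pint :: "(real \<times> real \<Rightarrow> complex) \<Rightarrow> ennreal" where
  "pint f = (\<integral>\<^sup>+z. ennreal (norm (f z) powr p) \<partial>torus)"

text \<open>The periodic Borel functions with finite seminorm. They are not identified when they agree almost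
  everywhere, and Borel measurability makes all sections and all compositions with affine maps
  measurable.\<close>

definition LpB :: "(real \<times> real \<Rightarrow> complex) set" where
  "LpB = {f \<in> borel_measurable borel.
     (\<forall>x y. f (x + 2 * pi, y) = f (x, y) \<and> f (x, y + 2 * pi) = f (x, y)) \<and> pint f < \<infinity>}"

text \<open>The seminorm with respect to the probability measure on the torus; the value \<open>0\<close> for infinite \<open>pint f\<close> is a default.\<close>

definition nrm :: "(real \<times> real \<Rightarrow> complex) \<Rightarrow> real" where
  "nrm f = enn2real (pint f) powr (1 / p)"

lemma LpB_meas [measurable_dest]: "f \<in> LpB \<Longrightarrow> f \<in> borel_measurable borel"
  and LpB_per1: "f \<in> LpB \<Longrightarrow> f (x + 2 * pi, y) = f (x, y)"
  and LpB_per2: "f \<in> LpB \<Longrightarrow> f (x, y + 2 * pi) = f (x, y)"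
  and LpB_fin: "f \<in> LpB \<Longrightarrow> pint f < \<infinity>"
  by (auto simp: LpB_def)

lemma XI:
  assumes "f \<in> borel_measurable borel" "\<And>x y. f (x + 2 * pi, y) = f (x, y)"
    "\<And>x y. f (x, y + 2 * pi) = f (x, y)" "pint f \<le> ennreal c"
  shows "f \<in> LpB"
  using assms by (auto simp: LpB_def order_le_less_trans)

lemma nrm_nonneg [simp]: "0 \<le> nrm f"
  by (simp add: nrm_def)

lemma pint_eq: "f \<in> LpB \<Longrightarrow> pint f = ennreal (nrm f powr p)"
  using p_gt_1 LpB_fin[of f] by (simp add: nrm_def powr_powr top.not_eq_extremum)

lemma nrm_le: "pint f \<le> ennreal (b powr p) \<Longrightarrow> 0 \<le> b \<Longrightarrow> nrm f \<le> b"
proof -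
  assume *: "pint f \<le> ennreal (b powr p)" "0 \<le> b"
  have "enn2real (pint f) \<le> b powr p"
    using *(1) by (metis enn2real_mono enn2real_ennreal ennreal_less_top powr_ge_zero)
  then have "nrm f \<le> (b powr p) powr (1 / p)"
    unfolding nrm_def using p_gt_1 by (intro powr_mono2) auto
  then show ?thesis using *(2) p_gt_1 by (simp add: powr_powr)
qed

lemma pint_mono:
  assumes "AE z in torus. norm (f z) \<le> norm (g z)"
  shows "pint f \<le> pint g"
  unfolding pint_def
proof (rule nn_integral_mono_AE, use assms in eventually_elim)
  case (elim z)
  then show ?case using p_gt_1 by (intro ennreal_leI powr_mono2) auto
qed

lemma nrm_cong: "AE z in torus. f z = g z \<Longrightarrow> nrm f = nrm g"
  unfolding nrm_def pint_def
  by (rule arg_cong[where f = "\<lambda>u. enn2real u powr (1 / p)"], rule nn_integral_cong_AE) auto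

lemma nrm_zero [simp]: "nrm (\<lambda>_. 0) = 0"
  by (simp add: nrm_def pint_def)

lemma LpB_zero [simp]: "(\<lambda>_. 0) \<in> LpB"
  by (simp add: LpB_def pint_def)

lemma nrm_eq_0_iff:
  assumes "f \<in> LpB"
  shows "nrm f = 0 \<longleftrightarrow> (AE z in torus. f z = 0)"
proof
  assume "nrm f = 0"
  then have "pint f = 0" using pint_eq[OF assms] by simp
  with assms show "AE z in torus. f z = 0"
    unfolding pint_def by (subst (asm) nn_integral_0_iff_AE) auto
next
  assume "AE z in torus. f z = 0"
  then show "nrm f = 0" using nrm_cong[of f "\<lambda>_. 0"] by simp
qed

lemma LpB_scale:
  assumes "f \<in> LpB"
  shows "(\<lambda>z. c * f z) \<in> LpB" and "nrm (\<lambda>z. c * f z) = norm c * nrm f"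
proof -
  have eq: "pint (\<lambda>z. c * f z) = ennreal (norm c powr p) * pint f"
    unfolding pint_def using assms
    by (subst nn_integral_cmult[symmetric]) (auto simp: norm_mult powr_mult ennreal_mult)
  then show "(\<lambda>z. c * f z) \<in> LpB"
    using assms by (auto simp: LpB_def ennreal_mult_less_top)
  show "nrm (\<lambda>z. c * f z) = norm c * nrm f"
    unfolding nrm_def eq using p_gt_1 by (simp add: enn2real_mult powr_mult powr_powr)
qed

lemma LpB_add:
  assumes f: "f \<in> LpB" and g: "g \<in> LpB"
  shows "(\<lambda>z. f z + g z) \<in> LpB" and "nrm (\<lambda>z. f z + g z) \<le> nrm f + nrm g"
proof -
  \<comment> \<open>The parameter \<open>e\<close> keeps the weights positive when a norm vanishes.\<close>
  have bound: "pint (\<lambda>z. f z + g z) \<le> ennreal ((nrm f + nrm g + 2 * e) powr p)" if e: "0 < e" for e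
  proof -
    define a where "a = nrm f + e"
    define b where "b = nrm g + e"
    have a: "0 < a" and b: "0 < b" using e by (simp_all add: a_def b_def add_nonneg_pos)
    define A where "A = (a + b) powr (p - 1) * a powr (1 - p)"
    define B where "B = (a + b) powr (p - 1) * b powr (1 - p)"
    have A: "0 \<le> A" and B: "0 \<le> B" by (simp_all add: A_def B_def)
    have "pint (\<lambda>z. f z + g z)
        \<le> (\<integral>\<^sup>+z. ennreal A * ennreal (norm (f z) powr p) + ennreal B * ennreal (norm (g z) powr p) \<partial>torus)"
      unfolding pint_def
    proof (rule nn_integral_mono)
      fix z
      have "norm (f z + g z) powr p \<le> (norm (f z) + norm (g z)) powr p"
        using p_gt_1 by (intro powr_mono2 norm_triangle_ineq) auto
      also have "\<dots> \<le> A * norm (f z) powr p + B * norm (g z) powr p"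
        using powr_sum_weighted[OF p_gt_1 a b, of "norm (f z)" "norm (g z)"]
        by (simp add: A_def B_def algebra_simps)
      finally show "ennreal (norm (f z + g z) powr p)
          \<le> ennreal A * ennreal (norm (f z) powr p) + ennreal B * ennreal (norm (g z) powr p)"
        using A B by (simp add: ennreal_mult[symmetric] ennreal_plus[symmetric] ennreal_leI del: ennreal_plus)
    qed
    also have "\<dots> = ennreal A * pint f + ennreal B * pint g"
      unfolding pint_def using f g by (subst nn_integral_add) (auto simp: nn_integral_cmult)
    also have "\<dots> \<le> ennreal (A * a powr p + B * b powr p)"
    proof -
      have "nrm f powr p \<le> a powr p" "nrm g powr p \<le> b powr p"
        using e p_gt_1 by (auto simp: a_def b_def intro!: powr_mono2)
      then show ?thesis
        using A B by (simp add: pint_eq f g ennreal_mult[symmetric] ennreal_plus[symmetric] ennreal_leI add_mono mult_left_mono del: ennreal_plus)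
    qed
    also have "A * a powr p + B * b powr p = (a + b) powr (p - 1) * (a + b)"
      unfolding A_def B_def using a b
      by (simp add: mult.assoc powr_add[symmetric] distrib_left)
    also have "\<dots> = (nrm f + nrm g + 2 * e) powr p"
      using a b by (simp add: powr_diff) (simp add: a_def b_def algebra_simps)
    finally show ?thesis .
  qed
  show "(\<lambda>z. f z + g z) \<in> LpB"
    using f g by (intro XI[OF _ _ _ bound[of 1]]) (auto simp: LpB_per1 LpB_per2)
  show "nrm (\<lambda>z. f z + g z) \<le> nrm f + nrm g"
  proof (rule field_le_epsilon)
    fix e :: real assume "0 < e"
    then show "nrm (\<lambda>z. f z + g z) \<le> nrm f + nrm g + e"
      using bound[of "e / 2"] by (intro nrm_le) (auto simp: add_nonneg_nonneg)
  qed
qed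

lemma LpB_diff:
  assumes "f \<in> LpB" "g \<in> LpB"
  shows "(\<lambda>z. f z - g z) \<in> LpB" and "nrm (\<lambda>z. f z - g z) \<le> nrm f + nrm g"
  using LpB_add[OF assms(1) LpB_scale(1)[OF assms(2), of "-1"]] LpB_scale(2)[OF assms(2), of "-1"] by auto

lemma LpB_sum:
  assumes "finite I" "\<And>i. i \<in> I \<Longrightarrow> f i \<in> LpB"
  shows "(\<lambda>z. \<Sum>i\<in>I. f i z) \<in> LpB" and "nrm (\<lambda>z. \<Sum>i\<in>I. f i z) \<le> (\<Sum>i\<in>I. nrm (f i))"
proof -
  have "(\<lambda>z. \<Sum>i\<in>I. f i z) \<in> LpB \<and> nrm (\<lambda>z. \<Sum>i\<in>I. f i z) \<le> (\<Sum>i\<in>I. nrm (f i))"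
    using assms
  proof (induction I rule: finite_induct)
    case (insert i I)
    then have "f i \<in> LpB" and *: "(\<lambda>z. \<Sum>i\<in>I. f i z) \<in> LpB" "nrm (\<lambda>z. \<Sum>i\<in>I. f i z) \<le> (\<Sum>i\<in>I. nrm (f i))"
      by auto
    from LpB_add[OF this(1,2)] *(2) insert(1,2) show ?case by auto
  qed simp
  then show "(\<lambda>z. \<Sum>i\<in>I. f i z) \<in> LpB" and "nrm (\<lambda>z. \<Sum>i\<in>I. f i z) \<le> (\<Sum>i\<in>I. nrm (f i))"
    by auto
qed

lemma LpB_norm: "f \<in> LpB \<Longrightarrow> (\<lambda>z. of_real (norm (f z))) \<in> LpB"
  and nrm_norm: "nrm (\<lambda>z. of_real (norm (f z))) = nrm f"
  by (auto simp: LpB_def pint_def nrm_def)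

text \<open>Minkowski's inequality for series, including the almost everywhere convergence.\<close>

lemma LpB_suminf:
  fixes f :: "nat \<Rightarrow> real \<times> real \<Rightarrow> complex"
  assumes f: "\<And>n. f n \<in> LpB" and b: "\<And>n. nrm (f n) \<le> b n" "summable b"
  shows "AE z in torus. summable (\<lambda>n. norm (f n z))"
    and "(\<lambda>z. \<Sum>n. f n z) \<in> LpB"
    and "nrm (\<lambda>z. \<Sum>n. f n z) \<le> (\<Sum>n. b n)"
proof -
  have b0: "0 \<le> b n" for n using b(1)[of n] nrm_nonneg[of "f n"] by linarith
  define S where "S = (\<Sum>n. b n)"
  have S0: "0 \<le> S" unfolding S_def using b b0 by (intro suminf_nonneg) auto
  define H where "H n z = ennreal ((\<Sum>i<n. norm (f i z)) powr p)" for n z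
  have [measurable]: "f n \<in> borel_measurable borel" for n using f by (rule LpB_meas)
  have Hm [measurable]: "H n \<in> borel_measurable torus" for n unfolding H_def by measurable
  have inc: "incseq H"
    unfolding incseq_Suc_iff le_fun_def H_def using p_gt_1
    by (auto intro!: ennreal_leI powr_mono2 sum_nonneg)
  have "(\<integral>\<^sup>+z. (SUP n. H n z) \<partial>torus) = (SUP n. (\<integral>\<^sup>+z. H n z \<partial>torus))"
    by (rule nn_integral_monotone_convergence_SUP[OF inc]) auto
  also have "\<dots> \<le> ennreal (S powr p)"
  proof (rule SUP_least)
    fix n
    define g where "g = (\<lambda>z. \<Sum>i<n. (of_real (norm (f i z)) :: complex))"
    have g: "g \<in> LpB" "nrm g \<le> (\<Sum>i<n. nrm (\<lambda>z. of_real (norm (f i z))))"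
      unfolding g_def using f LpB_norm by (auto intro!: LpB_sum)
    have "nrm g \<le> (\<Sum>i<n. b i)"
      using g(2) b(1) by (auto simp: nrm_norm intro: order_trans[OF _ sum_mono])
    also have "\<dots> \<le> S" unfolding S_def using b b0 by (intro sum_le_suminf) auto
    finally have "nrm g \<le> S" .
    have ng: "norm (g z) = (\<Sum>i<n. norm (f i z))" for z
      unfolding g_def of_real_sum[symmetric] norm_of_real by (simp add: sum_nonneg)
    have "(\<integral>\<^sup>+z. H n z \<partial>torus) = pint g"
      unfolding pint_def H_def ng ..
    also have "\<dots> \<le> ennreal (S powr p)"
      unfolding pint_eq[OF g(1)] using \<open>nrm g \<le> S\<close> p_gt_1 by (intro ennreal_leI powr_mono2) auto
    finally show "(\<integral>\<^sup>+z. H n z \<partial>torus) \<le> ennreal (S powr p)" .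
  qed
  finally have SUP: "(\<integral>\<^sup>+z. (SUP n. H n z) \<partial>torus) \<le> ennreal (S powr p)" .
  then have "(\<integral>\<^sup>+z. (SUP n. H n z) \<partial>torus) \<noteq> \<infinity>" by (auto simp: top_unique)
  then have AE1: "AE z in torus. (SUP n. H n z) \<noteq> \<infinity>"
    by (intro nn_integral_PInf_AE) auto
  have *: "summable (\<lambda>n. norm (f n z)) \<and> ennreal (norm (\<Sum>n. f n z) powr p) \<le> (SUP n. H n z)"
    if "(SUP n. H n z) \<noteq> \<infinity>" for z
  proof
    define r where "r = enn2real (SUP n. H n z)"
    have r: "(SUP n. H n z) = ennreal r" using that
      by (metis ennreal_enn2real infinity_ennreal_def top.not_eq_extremum r_def)
    have le: "(\<Sum>i<n. norm (f i z)) powr p \<le> r" for n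
    proof -
      have "H n z \<le> ennreal r" unfolding r[symmetric] by (rule SUP_upper) simp
      then show ?thesis unfolding H_def by (subst (asm) ennreal_le_iff) (auto simp: r_def)
    qed
    have le': "(\<Sum>i<n. norm (f i z)) \<le> r powr (1 / p)" for n
    proof -
      have "((\<Sum>i<n. norm (f i z)) powr p) powr (1 / p) \<le> r powr (1 / p)"
        using le p_gt_1 by (intro powr_mono2) auto
      then show ?thesis using p_gt_1 by (simp add: powr_powr sum_nonneg)
    qed
    show summ: "summable (\<lambda>n. norm (f n z))"
      using le' by (intro summableI_nonneg_bounded) auto
    have "norm (\<Sum>n. f n z) \<le> (\<Sum>n. norm (f n z))" by (rule summable_norm[OF summ])
    also have "\<dots> \<le> r powr (1 / p)" using le' summ by (intro suminf_le_const) auto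
    finally have "norm (\<Sum>n. f n z) powr p \<le> (r powr (1 / p)) powr p"
      using p_gt_1 by (intro powr_mono2) auto
    also have "\<dots> = r" using p_gt_1 by (simp add: powr_powr r_def)
    finally show "ennreal (norm (\<Sum>n. f n z) powr p) \<le> (SUP n. H n z)"
      unfolding r by (rule ennreal_leI)
  qed
  show "AE z in torus. summable (\<lambda>n. norm (f n z))"
    using AE1 by eventually_elim (use * in blast)
  have "pint (\<lambda>z. \<Sum>n. f n z) \<le> (\<integral>\<^sup>+z. (SUP n. H n z) \<partial>torus)"
    unfolding pint_def
    by (rule nn_integral_mono_AE, use AE1 in eventually_elim) (use * in blast)
  with SUP have pi: "pint (\<lambda>z. \<Sum>n. f n z) \<le> ennreal (S powr p)" by (rule order_trans[rotated])
  show "(\<lambda>z. \<Sum>n. f n z) \<in> LpB"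
    using f by (intro XI[OF _ _ _ pi]) (auto simp: LpB_per1 LpB_per2)
  show "nrm (\<lambda>z. \<Sum>n. f n z) \<le> (\<Sum>n. b n)"
    using nrm_le[OF pi S0] by (simp add: S_def)
qed

text \<open>Jensen's inequality for an average of functions \<open>g m\<close> over a probability space.\<close>

lemma LpB_integral:
  fixes g :: "'m \<Rightarrow> real \<times> real \<Rightarrow> complex" and W :: "'m \<Rightarrow> ennreal"
  assumes "prob_space M"
    and gm [measurable]: "(\<lambda>(m, z). g m z) \<in> borel_measurable (M \<Otimes>\<^sub>M torus)"
    and W: "\<And>m. m \<in> space M \<Longrightarrow> pint (g m) \<le> W m" "(\<integral>\<^sup>+m. W m \<partial>M) \<le> ennreal c"
  shows "AE z in torus. integrable M (\<lambda>m. g m z)"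
    and "pint (\<lambda>z. \<integral>m. g m z \<partial>M) \<le> ennreal c"
proof -
  interpret M: prob_space M by fact
  interpret T: prob_space torus by (rule circ2.P.prob_space_axioms)
  interpret MT: pair_sigma_finite M torus ..
  define F where "F z = (\<integral>\<^sup>+m. ennreal (norm (g m z) powr p) \<partial>M)" for z
  have gm': "(\<lambda>m. g m z) \<in> borel_measurable M" for z by measurable
  have [measurable]: "F \<in> borel_measurable torus" unfolding F_def by measurable
  have "(\<integral>\<^sup>+z. F z \<partial>torus) = (\<integral>\<^sup>+m. pint (g m) \<partial>M)"
    unfolding F_def pint_def by (rule MT.Fubini') measurable
  also have "\<dots> \<le> (\<integral>\<^sup>+m. W m \<partial>M)" by (rule nn_integral_mono) (rule W)
  finally have F: "(\<integral>\<^sup>+z. F z \<partial>torus) \<le> ennreal c" using W(2) by simp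
  then have "(\<integral>\<^sup>+z. F z \<partial>torus) \<noteq> \<infinity>" by (auto simp: top_unique)
  then have AE1: "AE z in torus. F z \<noteq> \<infinity>" by (intro nn_integral_PInf_AE) auto
  show "AE z in torus. integrable M (\<lambda>m. g m z)"
    using AE1
  proof eventually_elim
    case (elim z)
    then show ?case using gm'[of z]
      by (intro M.jensen_powr(1)[OF p_gt_1]) (auto simp: F_def top.not_eq_extremum)
  qed
  have "pint (\<lambda>z. \<integral>m. g m z \<partial>M) \<le> (\<integral>\<^sup>+z. F z \<partial>torus)"
    unfolding pint_def
  proof (rule nn_integral_mono_AE, use AE1 in eventually_elim)
    case (elim z)
    then show ?case using gm'[of z] unfolding F_def
      by (intro M.jensen_powr(2)[OF p_gt_1]) (auto simp: F_def top.not_eq_extremum)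
  qed
  with F show "pint (\<lambda>z. \<integral>m. g m z \<partial>M) \<le> ennreal c" by (rule order_trans[rotated])
qed

end

section \<open>Binomial coefficients of fractional differences\<close>

text \<open>The coefficient of \<open>z\<^sup>n\<close> in \<open>(1 - z)\<^sup>\<alpha>\<close>.\<close>

definition dcoeff :: "real \<Rightarrow> nat \<Rightarrow> real" where
  "dcoeff \<alpha> n = (-1) ^ n * (\<alpha> gchoose n)"

lemma dcoeff_0 [simp]: "dcoeff \<alpha> 0 = 1"
  by (simp add: dcoeff_def)

lemma dcoeff_rec: "dcoeff \<alpha> (Suc n) * real (Suc n) = dcoeff \<alpha> n * (real n - \<alpha>)"
proof -
  have e: "real (Suc n) * (\<alpha> gchoose Suc n) = (\<alpha> - real n) * (\<alpha> gchoose n)"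
    using gbinomial_mult_1[of \<alpha> n] by (simp add: algebra_simps)
  have "dcoeff \<alpha> (Suc n) * real (Suc n) = - ((-1) ^ n * (real (Suc n) * (\<alpha> gchoose Suc n)))"
    unfolding dcoeff_def power_Suc by (simp del: of_nat_Suc add: mult_ac)
  then show ?thesis unfolding e by (simp add: dcoeff_def algebra_simps)
qed

lemma dcoeff_add_1: "dcoeff (\<alpha> + 1) (Suc n) = dcoeff \<alpha> (Suc n) - dcoeff \<alpha> n"
  unfolding dcoeff_def gbinomial_Suc_Suc by (simp add: algebra_simps)

lemma dcoeff_nonpos:
  assumes "0 < \<alpha>" "\<alpha> \<le> 1"
  shows "dcoeff \<alpha> (Suc n) \<le> 0"
proof (induction n)
  case 0
  then show ?case using assms by (simp add: dcoeff_def)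
next
  case (Suc n)
  have "dcoeff \<alpha> (Suc (Suc n)) * real (Suc (Suc n)) \<le> 0"
    unfolding dcoeff_rec using Suc assms by (intro mult_nonpos_nonneg) auto
  then show ?case by (simp add: mult_le_0_iff)
qed

lemma dcoeff_sums: "\<bar>r\<bar> < 1 \<Longrightarrow> (\<lambda>n. dcoeff \<alpha> n * r ^ n) sums (1 - r) powr \<alpha>"
  using gen_binomial_real[of "-r" \<alpha>] by (simp add: dcoeff_def power_minus[of r] mult_ac)

text \<open>For \<open>\<alpha> \<le> 1\<close> all coefficients but the first are nonpositive, so the binomial series at
  \<open>r = 1 - e\<close> controls their absolute values.\<close>

lemma abs_dcoeff_small:
  assumes "0 < \<alpha>" "\<alpha> \<le> 1"
  shows summable_abs_dcoeff_small: "summable (\<lambda>n. \<bar>dcoeff \<alpha> (Suc n)\<bar>)"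
    and abs_dcoeff_sums_weighted: "0 < e \<Longrightarrow> e \<le> 1 \<Longrightarrow>
      (\<lambda>n. \<bar>dcoeff \<alpha> (Suc n)\<bar> * (1 - (1 - e) ^ Suc n)) sums (e powr \<alpha>)"
    and suminf_abs_dcoeff_small: "(\<Sum>n. \<bar>dcoeff \<alpha> (Suc n)\<bar>) = 1"
proof -
  have abs: "\<bar>dcoeff \<alpha> (Suc n)\<bar> = - dcoeff \<alpha> (Suc n)" for n
    using dcoeff_nonpos[OF assms] by simp
  have s: "(\<lambda>n. \<bar>dcoeff \<alpha> (Suc n)\<bar> * (1 - e) ^ Suc n) sums (1 - e powr \<alpha>)"
    if "0 < e" "e \<le> 1" for e :: real
  proof -
    have "(\<lambda>n. dcoeff \<alpha> (Suc n) * (1 - e) ^ Suc n) sums (e powr \<alpha> - 1)"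
      unfolding sums_Suc_iff[of "\<lambda>n. dcoeff \<alpha> n * (1 - e) ^ n"]
      using dcoeff_sums[of "1 - e" \<alpha>] that by simp
    from sums_minus[OF this] show ?thesis unfolding abs by simp
  qed
  \<comment> \<open>Let the argument of the binomial series increase to one.\<close>
  have part: "(\<Sum>i<n. \<bar>dcoeff \<alpha> (Suc i)\<bar>) \<le> 1" for n
  proof (rule LIMSEQ_le_const2)
    show "(\<lambda>k. \<Sum>i<n. \<bar>dcoeff \<alpha> (Suc i)\<bar> * (1 - 1 / real (Suc k)) ^ Suc i) \<longlonglongrightarrow> (\<Sum>i<n. \<bar>dcoeff \<alpha> (Suc i)\<bar>)"
    proof -
      have "(\<lambda>k. \<Sum>i<n. \<bar>dcoeff \<alpha> (Suc i)\<bar> * (1 - 1 / real (Suc k)) ^ Suc i)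
          \<longlonglongrightarrow> (\<Sum>i<n. \<bar>dcoeff \<alpha> (Suc i)\<bar> * (1 - 0) ^ Suc i)"
        by (intro tendsto_intros LIMSEQ_inverse_real_of_nat[unfolded inverse_eq_divide])
      then show ?thesis by simp
    qed
    show "\<exists>N. \<forall>k\<ge>N. (\<Sum>i<n. \<bar>dcoeff \<alpha> (Suc i)\<bar> * (1 - 1 / real (Suc k)) ^ Suc i) \<le> 1"
    proof (intro exI allI impI)
      fix k :: nat
      have "(\<Sum>i<n. \<bar>dcoeff \<alpha> (Suc i)\<bar> * (1 - 1 / real (Suc k)) ^ Suc i) \<le> 1 - (1 / real (Suc k)) powr \<alpha>"
        using sum_le_suminf[OF sums_summable[OF s[of "1 / real (Suc k)"]], of "{..<n}"]
          sums_unique[OF s[of "1 / real (Suc k)"]] by (simp del: of_nat_Suc power_Suc)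
      then show "(\<Sum>i<n. \<bar>dcoeff \<alpha> (Suc i)\<bar> * (1 - 1 / real (Suc k)) ^ Suc i) \<le> 1"
        by (rule order_trans) simp
    qed
  qed
  show summ: "summable (\<lambda>n. \<bar>dcoeff \<alpha> (Suc n)\<bar>)"
    by (rule summableI_nonneg_bounded[OF _ part]) auto
  show one: "(\<Sum>n. \<bar>dcoeff \<alpha> (Suc n)\<bar>) = 1"
  proof (rule antisym)
    show "(\<Sum>n. \<bar>dcoeff \<alpha> (Suc n)\<bar>) \<le> 1" using part summ by (intro suminf_le_const) auto
    have "1 - (1 / real (Suc k)) powr \<alpha> \<le> (\<Sum>n. \<bar>dcoeff \<alpha> (Suc n)\<bar>)" for k
      using s[of "1 / real (Suc k)"] summ
      by (intro sums_le[OF _ s[of "1 / real (Suc k)"] summable_sums])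
         (auto intro!: mult_left_le power_le_one simp del: power_Suc)
    moreover have "(\<lambda>k. 1 - (1 / real (Suc k)) powr \<alpha>) \<longlonglongrightarrow> 1 - 0 powr \<alpha>"
      using assms by (intro tendsto_intros LIMSEQ_inverse_real_of_nat[unfolded inverse_eq_divide]) auto
    ultimately show "1 \<le> (\<Sum>n. \<bar>dcoeff \<alpha> (Suc n)\<bar>)"
      using LIMSEQ_le_const2[of "\<lambda>k. 1 - (1 / real (Suc k)) powr \<alpha>" 1] by auto
  qed
  show "(\<lambda>n. \<bar>dcoeff \<alpha> (Suc n)\<bar> * (1 - (1 - e) ^ Suc n)) sums (e powr \<alpha>)" if "0 < e" "e \<le> 1"
    using sums_diff[OF summable_sums[OF summ] s[OF that]] by (simp add: one algebra_simps)
qed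

lemma pos_real_decompose:
  fixes \<alpha> :: real
  assumes "0 < \<alpha>"
  obtains \<beta> k where "0 < \<beta>" "\<beta> \<le> 1" "\<alpha> = \<beta> + real k"
proof
  have c: "0 < \<lceil>\<alpha>\<rceil>" "of_int \<lceil>\<alpha>\<rceil> - 1 < \<alpha>" "\<alpha> \<le> of_int \<lceil>\<alpha>\<rceil>" using assms by (simp_all, linarith+)
  then have k: "real (nat (\<lceil>\<alpha>\<rceil> - 1)) = of_int \<lceil>\<alpha>\<rceil> - 1" by simp
  show "\<alpha> = (\<alpha> - real (nat (\<lceil>\<alpha>\<rceil> - 1))) + real (nat (\<lceil>\<alpha>\<rceil> - 1))" by simp
  show "0 < \<alpha> - real (nat (\<lceil>\<alpha>\<rceil> - 1))" "\<alpha> - real (nat (\<lceil>\<alpha>\<rceil> - 1)) \<le> 1"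
    unfolding k using c by linarith+
qed

text \<open>Pascal's rule passes from \<open>\<alpha>\<close> to \<open>\<alpha> + 1\<close>; the sum telescopes in this step.\<close>

lemma summable_abs_dcoeff_and_sums:
  assumes "0 < \<alpha>"
  shows "summable (\<lambda>n. \<bar>dcoeff \<alpha> n\<bar>) \<and> dcoeff \<alpha> sums 0"
proof -
  obtain \<beta> k where b: "0 < \<beta>" "\<beta> \<le> 1" "\<alpha> = \<beta> + real k" using pos_real_decompose[OF assms] .
  have "summable (\<lambda>n. \<bar>dcoeff (\<beta> + real k) n\<bar>) \<and> dcoeff (\<beta> + real k) sums 0"
  proof (induction k)
    case 0
    have 1: "summable (\<lambda>n. \<bar>dcoeff \<beta> n\<bar>)"
      using summable_abs_dcoeff_small[OF b(1,2)] by (subst summable_Suc_iff[symmetric])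
    have "(\<lambda>n. - \<bar>dcoeff \<beta> (Suc n)\<bar>) sums - 1"
      using summable_sums[OF summable_abs_dcoeff_small[OF b(1,2)]] suminf_abs_dcoeff_small[OF b(1,2)]
      by (intro sums_minus) simp
    moreover have "- \<bar>dcoeff \<beta> (Suc n)\<bar> = dcoeff \<beta> (Suc n)" for n
      using dcoeff_nonpos[OF b(1,2)] by simp
    ultimately have "(\<lambda>n. dcoeff \<beta> (Suc n)) sums (0 - dcoeff \<beta> 0)" by simp
    then have "dcoeff \<beta> sums 0" by (subst (asm) sums_Suc_iff) simp
    with 1 show ?case by simp
  next
    case (Suc k)
    define a where "a = \<beta> + real k"
    have IH: "summable (\<lambda>n. \<bar>dcoeff a n\<bar>)" and "dcoeff a sums 0" using Suc by (auto simp: a_def)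
    have a1: "\<beta> + real (Suc k) = a + 1" by (simp add: a_def)
    have "summable (\<lambda>n. \<bar>dcoeff (a + 1) (Suc n)\<bar>)"
    proof (rule summable_comparison_test')
      show "summable (\<lambda>n. \<bar>dcoeff a (Suc n)\<bar> + \<bar>dcoeff a n\<bar>)"
        using IH by (intro summable_add) (simp_all add: summable_Suc_iff[of "\<lambda>n. \<bar>dcoeff a n\<bar>"])
      show "norm \<bar>dcoeff (a + 1) (Suc n)\<bar> \<le> \<bar>dcoeff a (Suc n)\<bar> + \<bar>dcoeff a n\<bar>" for n
        by (simp add: dcoeff_add_1)
    qed
    then have 1: "summable (\<lambda>n. \<bar>dcoeff (a + 1) n\<bar>)" by (subst summable_Suc_iff[symmetric])
    have "(\<lambda>n. dcoeff (a + 1) (Suc n)) sums ((0 - dcoeff a 0) - 0)"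
      unfolding dcoeff_add_1 using \<open>dcoeff a sums 0\<close> by (intro sums_diff) (auto simp: sums_Suc_iff)
    then have "dcoeff (a + 1) sums 0" by (subst (asm) sums_Suc_iff) simp
    with 1 show ?case unfolding a1 by simp
  qed
  with b(3) show ?thesis by simp
qed

lemmas summable_abs_dcoeff = summable_abs_dcoeff_and_sums[THEN conjunct1]
  and dcoeff_sums_0 = summable_abs_dcoeff_and_sums[THEN conjunct2]

text \<open>The identity \<open>(1 + z)\<^sup>\<alpha> (1 - z)\<^sup>\<alpha> = (1 - z\<^sup>2)\<^sup>\<alpha>\<close> for the coefficients of the binomial series. The product
  satisfies a first-order differential equation, which amounts to a two-step recursion.\<close>

lemma gchoose_dcoeff_convolution:
  "(\<Sum>i\<le>n. (\<alpha> gchoose i) * dcoeff \<alpha> (n - i)) = (if even n then dcoeff \<alpha> (n div 2) else 0)"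
proof -
  define A B G :: "real fps" where "A = Abs_fps (\<lambda>n. \<alpha> gchoose n)"
    and "B = Abs_fps (dcoeff \<alpha>)" and "G = A * B"
  define c where "c n = (if even n then dcoeff \<alpha> (n div 2) else 0)" for n :: nat
  have A: "(1 + fps_X) * fps_deriv A = fps_const \<alpha> * A"
  proof (rule fps_ext)
    fix n
    show "fps_nth ((1 + fps_X) * fps_deriv A) n = fps_nth (fps_const \<alpha> * A) n"
      using gbinomial_mult_1[of \<alpha> n] by (cases n) (simp_all add: A_def distrib_right algebra_simps)
  qed
  have B: "(1 - fps_X) * fps_deriv B = - fps_const \<alpha> * B"
  proof (rule fps_ext)
    fix n
    show "fps_nth ((1 - fps_X) * fps_deriv B) n = fps_nth (- fps_const \<alpha> * B) n"
      using dcoeff_rec[of \<alpha> n] by (cases n) (simp_all add: B_def left_diff_distrib algebra_simps)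
  qed
  have alg: "(a * A) * ((1 - X) * B) + ((1 + X) * A) * (- a * B) = - (2 * a) * X * (A * B)"
    for a A B X :: "real fps"
    by (simp add: algebra_simps)
  have "(1 - fps_X ^ 2) * fps_deriv G
      = ((1 + fps_X) * fps_deriv A) * ((1 - fps_X) * B) + ((1 + fps_X) * A) * ((1 - fps_X) * fps_deriv B)"
    by (simp add: G_def algebra_simps power2_eq_square)
  also have "\<dots> = - (2 * fps_const \<alpha>) * fps_X * G"
    unfolding A B G_def by (rule alg)
  also have "2 * fps_const \<alpha> = fps_const (2 * \<alpha>)"
    by (simp only: numeral_fps_const fps_const_mult)
  finally have ode: "(1 - fps_X ^ 2) * fps_deriv G = - fps_const (2 * \<alpha>) * fps_X * G" .
  have rec: "real (Suc (Suc n)) * fps_nth G (Suc (Suc n)) = (real n - 2 * \<alpha>) * fps_nth G n" for n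
  proof -
    have "fps_nth ((1 - fps_X ^ 2) * fps_deriv G) (Suc n) = fps_nth (- fps_const (2 * \<alpha>) * fps_X * G) (Suc n)"
      by (simp only: ode)
    then show ?thesis
      by (cases n) (simp_all add: left_diff_distrib algebra_simps power2_eq_square mult.assoc)
  qed
  have G01: "fps_nth G 0 = 1" "fps_nth G 1 = 0"
    by (simp_all add: G_def A_def B_def fps_mult_nth dcoeff_def)
  have "fps_nth G n = c n" for n
  proof (induction n rule: nat_less_induct)
    case (1 n)
    consider "n = 0" | "n = 1" | m where "n = Suc (Suc m)" by (metis One_nat_def not0_implies_Suc)
    then show ?case
    proof cases
      case (3 m)
      have "real (Suc (Suc m)) * c (Suc (Suc m)) = (real m - 2 * \<alpha>) * c m"
      proof (cases "even m")
        case True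
        then obtain j where "m = 2 * j" by auto
        then show ?thesis using dcoeff_rec[of \<alpha> j] by (simp add: c_def algebra_simps)
      qed (simp add: c_def)
      moreover have "fps_nth G m = c m" using 1 3 by auto
      ultimately have "real (Suc (Suc m)) * c (Suc (Suc m)) = real (Suc (Suc m)) * fps_nth G (Suc (Suc m))"
        using rec[of m] by simp
      then show ?thesis unfolding 3 by simp
    qed (use G01 in \<open>simp_all add: c_def\<close>)
  qed
  from this[of n] show ?thesis
    by (simp add: G_def A_def B_def fps_mult_nth c_def atLeast0AtMost)
qed

section \<open>Bounded operators and series of translations\<close>

text \<open>Translation in the first variable.\<close>

definition shiftx :: "real \<Rightarrow> (real \<times> real \<Rightarrow> complex) \<Rightarrow> real \<times> real \<Rightarrow> complex" where
  "shiftx a f = (\<lambda>(x, y). f (x + a, y))"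

text \<open>Exchange of the variables. Operators in the second variable are obtained from those in the first
  by conjugation with it.\<close>

definition swapxy :: "(real \<times> real \<Rightarrow> complex) \<Rightarrow> real \<times> real \<Rightarrow> complex" where
  "swapxy f = (\<lambda>(x, y). f (y, x))"

text \<open>The series \<open>\<Sum>n. c n \<tau>\<^sub>h\<^sup>n\<close> in the first variable. For \<open>c = dcoeff \<alpha>\<close> it is the fractional difference
  of order \<open>\<alpha>\<close> without the centering translation.\<close>

definition trans_sum :: "(nat \<Rightarrow> real) \<Rightarrow> real \<Rightarrow> (real \<times> real \<Rightarrow> complex) \<Rightarrow> real \<times> real \<Rightarrow> complex" where
  "trans_sum c h f = (\<lambda>z. \<Sum>n. of_real (c n) * shiftx (- (real n * h)) f z)"

lemma shiftx_apply [simp]: "shiftx a f (x, y) = f (x + a, y)"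
  by (simp add: shiftx_def)

lemma swapxy_apply [simp]: "swapxy f (x, y) = f (y, x)"
  by (simp add: swapxy_def)

lemma swapxy_swapxy [simp]: "swapxy (swapxy f) = f"
  by (auto simp: swapxy_def)

lemma shiftx_shiftx: "shiftx a (shiftx b f) = shiftx (a + b) f"
  by (auto simp: shiftx_def add_ac)

lemma shiftx_measurable [measurable (raw)]:
  assumes [measurable]: "f \<in> borel_measurable borel"
  shows "shiftx a f \<in> borel_measurable borel"
  unfolding shiftx_def borel_prod[symmetric] split_beta by measurable

lemma swapxy_measurable [measurable (raw)]:
  assumes [measurable]: "f \<in> borel_measurable borel"
  shows "swapxy f \<in> borel_measurable borel"
  unfolding swapxy_def borel_prod[symmetric] split_beta by measurable

lemma nn_integral_torus_swapxy:
  fixes g :: "real \<times> real \<Rightarrow> ennreal"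
  assumes [measurable]: "g \<in> borel_measurable borel"
  shows "(\<integral>\<^sup>+z. g (case z of (x, y) \<Rightarrow> (y, x)) \<partial>torus) = (\<integral>\<^sup>+z. g z \<partial>torus)"
proof -
  have [measurable]: "g \<in> borel_measurable torus" by simp
  have [measurable]: "(\<lambda>z. g (case z of (x, y) \<Rightarrow> (y, x))) \<in> borel_measurable torus" by measurable
  have "(\<integral>\<^sup>+z. g (case z of (x, y) \<Rightarrow> (y, x)) \<partial>torus) = (\<integral>\<^sup>+x. \<integral>\<^sup>+y. g (y, x) \<partial>circ \<partial>circ)"
    by (subst circ.nn_integral_fst[symmetric]) auto
  also have "\<dots> = (\<integral>\<^sup>+z. g z \<partial>torus)"
    by (rule circ2.nn_integral_snd) simp
  finally show ?thesis .
qed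

lemma AE_swapxy:
  assumes "AE z in torus. P z"
  shows "AE z in torus. P (case z of (x, y) \<Rightarrow> (y, x))"
proof -
  obtain N where N: "N \<in> sets torus" "emeasure torus N = 0" "{z \<in> space torus. \<not> P z} \<subseteq> N"
    using assms by (auto elim!: AE_E)
  have [measurable]: "N \<in> sets borel" using N(1) unfolding sets_torus .
  have swapxy [measurable]: "(\<lambda>z::real \<times> real. case z of (x, y) \<Rightarrow> (y, x)) \<in> borel_measurable borel"
    unfolding borel_prod[symmetric] split_beta by measurable
  have [measurable]: "(\<lambda>z. indicator N (case z of (x, y) \<Rightarrow> (y, x)) :: ennreal) \<in> borel_measurable borel"
    by (rule measurable_compose[OF swapxy borel_measurable_indicator[OF \<open>N \<in> sets borel\<close>]])
  have "(\<integral>\<^sup>+z. indicator N (case z of (x, y) \<Rightarrow> (y, x)) \<partial>torus) = 0"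
    using N by (subst nn_integral_torus_swapxy) auto
  then have "AE z in torus. indicator N (case z of (x, y) \<Rightarrow> (y, x)) = (0::ennreal)"
    by (subst (asm) nn_integral_0_iff_AE) auto
  then show ?thesis
    by eventually_elim (use N(3) in \<open>auto simp: indicator_def split: if_splits\<close>)
qed

context torus_Lp
begin

lemma pint_shiftx:
  assumes [measurable]: "f \<in> borel_measurable borel" and per: "\<And>x y. f (x + 2 * pi, y) = f (x, y)"
  shows "pint (shiftx a f) = pint f"
proof -
  have m: "(\<lambda>z. ennreal (norm (g z) powr p)) \<in> borel_measurable torus"
    if "g \<in> borel_measurable borel" for g :: "real \<times> real \<Rightarrow> complex"
    using that by simp
  have "pint (shiftx a f) = (\<integral>\<^sup>+y. \<integral>\<^sup>+x. ennreal (norm (f (a + x, y)) powr p) \<partial>circ \<partial>circ)"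
    unfolding pint_def by (subst circ2.nn_integral_snd[symmetric], rule m) (auto simp: add.commute)
  also have "\<dots> = (\<integral>\<^sup>+y. \<integral>\<^sup>+x. ennreal (norm (f (x, y)) powr p) \<partial>circ \<partial>circ)"
    by (intro nn_integral_cong nn_integral_circ_shift[where f = "\<lambda>x. ennreal (norm (f (x, y)) powr p)" for y])
       (auto simp: per)
  also have "\<dots> = pint f"
    unfolding pint_def by (rule circ2.nn_integral_snd, rule m) auto
  finally show ?thesis .
qed

lemma LpB_shiftx [simp, intro]: "f \<in> LpB \<Longrightarrow> shiftx a f \<in> LpB"
  and nrm_shiftx [simp]: "f \<in> LpB \<Longrightarrow> nrm (shiftx a f) = nrm f"
proof -
  assume f: "f \<in> LpB"
  have eq: "pint (shiftx a f) = pint f" using f by (intro pint_shiftx) (auto simp: LpB_per1)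
  show "shiftx a f \<in> LpB"
    using f LpB_per1[OF f, of "x + a" for x] by (auto simp: LpB_def eq add_ac)
  show "nrm (shiftx a f) = nrm f" by (simp add: nrm_def eq)
qed

lemma LpB_swapxy [simp, intro]: "f \<in> LpB \<Longrightarrow> swapxy f \<in> LpB"
  and nrm_swapxy [simp]: "f \<in> LpB \<Longrightarrow> nrm (swapxy f) = nrm f"
proof -
  assume f: "f \<in> LpB"
  have "pint (swapxy f) = (\<integral>\<^sup>+z. (\<lambda>z. ennreal (norm (f z) powr p)) (case z of (x, y) \<Rightarrow> (y, x)) \<partial>torus)"
    unfolding pint_def by (intro nn_integral_cong) (auto simp: swapxy_def)
  also have "\<dots> = pint f" using f unfolding pint_def by (intro nn_integral_torus_swapxy) auto
  finally have eq: "pint (swapxy f) = pint f" .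
  show "swapxy f \<in> LpB" using f by (auto simp: LpB_def eq)
  show "nrm (swapxy f) = nrm f" by (simp add: nrm_def eq)
qed

lemma AE_eq_iff_nrm:
  assumes "f \<in> LpB" "g \<in> LpB"
  shows "(AE z in torus. f z = g z) \<longleftrightarrow> nrm (\<lambda>z. f z - g z) = 0"
  using nrm_eq_0_iff[OF LpB_diff(1)[OF assms]] by simp

text \<open>Bounded linear operators on \<open>LpB\<close> with bound \<open>C\<close>; linearity is required only almost everywhere, as
  defining series and integrals may diverge on null sets.\<close>

definition bounded_op :: "real \<Rightarrow> ((real \<times> real \<Rightarrow> complex) \<Rightarrow> real \<times> real \<Rightarrow> complex) \<Rightarrow> bool" where
  "bounded_op C A \<longleftrightarrow> 0 \<le> C \<and> (\<forall>f\<in>LpB. A f \<in> LpB \<and> nrm (A f) \<le> C * nrm f) \<and>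
     (\<forall>f\<in>LpB. \<forall>g\<in>LpB. AE z in torus. A (\<lambda>z. f z + g z) z = A f z + A g z) \<and>
     (\<forall>f\<in>LpB. \<forall>c. AE z in torus. A (\<lambda>z. c * f z) z = c * A f z)"

lemma bounded_op_nonneg: "bounded_op C A \<Longrightarrow> 0 \<le> C"
  and bounded_op_LpB: "bounded_op C A \<Longrightarrow> f \<in> LpB \<Longrightarrow> A f \<in> LpB"
  and bounded_op_nrm: "bounded_op C A \<Longrightarrow> f \<in> LpB \<Longrightarrow> nrm (A f) \<le> C * nrm f"
  and bounded_op_add: "bounded_op C A \<Longrightarrow> f \<in> LpB \<Longrightarrow> g \<in> LpB \<Longrightarrow> AE z in torus. A (\<lambda>z. f z + g z) z = A f z + A g z"
  and bounded_op_scale: "bounded_op C A \<Longrightarrow> f \<in> LpB \<Longrightarrow> AE z in torus. A (\<lambda>z. c * f z) z = c * A f z"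
  by (auto simp: bounded_op_def)

lemma bounded_op_diff:
  assumes "bounded_op C A" "f \<in> LpB" "g \<in> LpB"
  shows "AE z in torus. A (\<lambda>z. f z - g z) z = A f z - A g z"
  using bounded_op_add[OF assms(1,2) LpB_scale(1)[OF assms(3)], of "-1"] bounded_op_scale[OF assms(1,3), of "-1"]
  by eventually_elim simp

lemma bounded_op_cong:
  assumes "bounded_op C A" "f \<in> LpB" "g \<in> LpB" "AE z in torus. f z = g z"
  shows "AE z in torus. A f z = A g z"
proof -
  have fg: "(\<lambda>z. f z - g z) \<in> LpB" using assms LpB_diff by auto
  have "nrm (A (\<lambda>z. f z - g z)) \<le> C * nrm (\<lambda>z. f z - g z)" using bounded_op_nrm[OF assms(1) fg] .
  also have "nrm (\<lambda>z. f z - g z) = 0" using assms by (simp add: AE_eq_iff_nrm)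
  finally have "nrm (A (\<lambda>z. f z - g z)) = 0" by (simp add: antisym)
  then have "AE z in torus. A (\<lambda>z. f z - g z) z = 0"
    using bounded_op_LpB[OF assms(1) fg] by (simp add: nrm_eq_0_iff)
  with bounded_op_diff[OF assms(1-3)] show ?thesis by eventually_elim simp
qed

lemma bounded_op_zero:
  assumes "bounded_op C A" "f \<in> LpB" "AE z in torus. f z = 0"
  shows "AE z in torus. A f z = 0"
proof -
  have "nrm (A f) \<le> C * nrm f" using assms bounded_op_nrm by auto
  also have "nrm f = 0" using assms by (simp add: nrm_eq_0_iff)
  finally have "nrm (A f) = 0" by (simp add: antisym)
  then show ?thesis using bounded_op_LpB[OF assms(1,2)] by (simp add: nrm_eq_0_iff)
qed

lemma bounded_op_sum:
  assumes A: "bounded_op C A" and "finite I" and f: "\<And>i. i \<in> I \<Longrightarrow> f i \<in> LpB"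
  shows "AE z in torus. A (\<lambda>z. \<Sum>i\<in>I. f i z) z = (\<Sum>i\<in>I. A (f i) z)"
  using \<open>finite I\<close> f
proof (induction I rule: finite_induct)
  case empty
  then show ?case using bounded_op_zero[OF A LpB_zero] by simp
next
  case (insert i I)
  have "AE z in torus. A (\<lambda>z. f i z + (\<Sum>i\<in>I. f i z)) z = A (f i) z + A (\<lambda>z. \<Sum>i\<in>I. f i z) z"
    using insert by (intro bounded_op_add[OF A] LpB_sum(1)) auto
  moreover have "AE z in torus. A (\<lambda>z. \<Sum>i\<in>I. f i z) z = (\<Sum>i\<in>I. A (f i) z)"
    using insert by auto
  ultimately show ?case by eventually_elim (use insert(1,2) in simp)
qed

lemma bounded_op_comp:
  assumes A: "bounded_op C A" and B: "bounded_op D B"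
  shows "bounded_op (C * D) (\<lambda>f. A (B f))"
  unfolding bounded_op_def
proof (intro conjI ballI allI)
  show "0 \<le> C * D" using assms bounded_op_nonneg by auto
next
  fix f assume f: "f \<in> LpB"
  show "A (B f) \<in> LpB" using f A B bounded_op_LpB by blast
  have "nrm (A (B f)) \<le> C * nrm (B f)" using f A B bounded_op_LpB bounded_op_nrm by blast
  also have "\<dots> \<le> C * (D * nrm f)" using f A B bounded_op_nrm bounded_op_nonneg by (intro mult_left_mono) auto
  finally show "nrm (A (B f)) \<le> C * D * nrm f" by simp
  fix c
  have "AE z in torus. A (B (\<lambda>z. c * f z)) z = A (\<lambda>z. c * B f z) z"
    using f A B bounded_op_LpB LpB_scale(1) by (intro bounded_op_cong[OF A] bounded_op_scale[OF B]) auto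
  moreover have "AE z in torus. A (\<lambda>z. c * B f z) z = c * A (B f) z"
    using f B bounded_op_LpB by (intro bounded_op_scale[OF A]) auto
  ultimately show "AE z in torus. A (B (\<lambda>z. c * f z)) z = c * A (B f) z"
    by eventually_elim simp
next
  fix f g assume f: "f \<in> LpB" and g: "g \<in> LpB"
  have "AE z in torus. A (B (\<lambda>z. f z + g z)) z = A (\<lambda>z. B f z + B g z) z"
    using f g A B bounded_op_LpB LpB_add(1) by (intro bounded_op_cong[OF A] bounded_op_add[OF B]) auto
  moreover have "AE z in torus. A (\<lambda>z. B f z + B g z) z = A (B f) z + A (B g) z"
    using f g B bounded_op_LpB by (intro bounded_op_add[OF A]) auto
  ultimately show "AE z in torus. A (B (\<lambda>z. f z + g z)) z = A (B f) z + A (B g) z"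
    by eventually_elim simp
qed

lemma bounded_op_swapxy: "bounded_op 1 swapxy"
  by (auto simp: bounded_op_def)

lemma bounded_op_conj_swapxy: "bounded_op C A \<Longrightarrow> bounded_op C (\<lambda>f. swapxy (A (swapxy f)))"
  using bounded_op_comp[OF bounded_op_swapxy bounded_op_comp[OF _ bounded_op_swapxy]] by force

lemma bounded_op_lincomb:
  assumes A: "bounded_op C A" and B: "bounded_op D B"
  shows "bounded_op (norm a * C + norm b * D) (\<lambda>f z. a * A f z + b * B f z)"
  unfolding bounded_op_def
proof (intro conjI ballI allI)
  show "0 \<le> norm a * C + norm b * D" using assms bounded_op_nonneg by auto
next
  fix f assume f: "f \<in> LpB"
  have 1: "(\<lambda>z. a * A f z) \<in> LpB" "(\<lambda>z. b * B f z) \<in> LpB"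
    using f A B bounded_op_LpB LpB_scale(1) by auto
  show "(\<lambda>z. a * A f z + b * B f z) \<in> LpB" using 1 LpB_add(1) by auto
  have "nrm (\<lambda>z. a * A f z + b * B f z) \<le> norm a * nrm (A f) + norm b * nrm (B f)"
    using LpB_add(2)[OF 1] f A B bounded_op_LpB by (simp add: LpB_scale(2))
  also have "\<dots> \<le> norm a * (C * nrm f) + norm b * (D * nrm f)"
    using f A B bounded_op_nrm by (intro add_mono mult_left_mono) auto
  finally show "nrm (\<lambda>z. a * A f z + b * B f z) \<le> (norm a * C + norm b * D) * nrm f"
    by (simp add: algebra_simps)
  fix c
  show "AE z in torus. a * A (\<lambda>z. c * f z) z + b * B (\<lambda>z. c * f z) z = c * (a * A f z + b * B f z)"
    using bounded_op_scale[OF A f, of c] bounded_op_scale[OF B f, of c]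
    by eventually_elim (simp add: algebra_simps)
next
  fix f g assume f: "f \<in> LpB" and g: "g \<in> LpB"
  show "AE z in torus. a * A (\<lambda>z. f z + g z) z + b * B (\<lambda>z. f z + g z) z
      = a * A f z + b * B f z + (a * A g z + b * B g z)"
    using bounded_op_add[OF A f g] bounded_op_add[OF B f g]
    by eventually_elim (simp add: algebra_simps)
qed

lemma bounded_op_id: "bounded_op 1 (\<lambda>f. f)"
  by (auto simp: bounded_op_def)

lemma trans_sum_facts:
  assumes c: "summable (\<lambda>n. \<bar>c n\<bar>)" and f: "f \<in> LpB"
  shows trans_sum_AE_summable: "AE z in torus. summable (\<lambda>n. norm (of_real (c n) * shiftx (- (real n * h)) f z))"
    and trans_sum_LpB: "trans_sum c h f \<in> LpB"
    and trans_sum_nrm: "nrm (trans_sum c h f) \<le> (\<Sum>n. \<bar>c n\<bar>) * nrm f"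
proof -
  have 1: "(\<lambda>z. of_real (c n) * shiftx (- (real n * h)) f z) \<in> LpB"
    "nrm (\<lambda>z. of_real (c n) * shiftx (- (real n * h)) f z) \<le> \<bar>c n\<bar> * nrm f" for n
    using f by (auto simp: LpB_scale)
  have 2: "summable (\<lambda>n. \<bar>c n\<bar> * nrm f)" using c by (rule summable_mult2)
  show "AE z in torus. summable (\<lambda>n. norm (of_real (c n) * shiftx (- (real n * h)) f z))"
    by (rule LpB_suminf(1)[OF 1 2])
  show "trans_sum c h f \<in> LpB" unfolding trans_sum_def by (rule LpB_suminf(2)[OF 1 2])
  show "nrm (trans_sum c h f) \<le> (\<Sum>n. \<bar>c n\<bar>) * nrm f"
    unfolding trans_sum_def using LpB_suminf(3)[OF 1 2] suminf_mult2[OF c] by simp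
qed

lemma bounded_op_trans_sum:
  assumes c: "summable (\<lambda>n. \<bar>c n\<bar>)"
  shows "bounded_op (\<Sum>n. \<bar>c n\<bar>) (trans_sum c h)"
  unfolding bounded_op_def
proof (intro conjI ballI allI)
  show "0 \<le> (\<Sum>n. \<bar>c n\<bar>)" using c by (intro suminf_nonneg) auto
next
  fix f assume f: "f \<in> LpB"
  show "trans_sum c h f \<in> LpB" "nrm (trans_sum c h f) \<le> (\<Sum>n. \<bar>c n\<bar>) * nrm f"
    by (rule trans_sum_LpB[OF c f], rule trans_sum_nrm[OF c f])
  fix a
  show "AE z in torus. trans_sum c h (\<lambda>z. a * f z) z = a * trans_sum c h f z"
    using trans_sum_AE_summable[OF c f, of h]
  proof eventually_elim
    case (elim z)
    have "shiftx b (\<lambda>z. a * f z) z = a * shiftx b f z" for b by (cases z) simp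
    then show ?case using summable_norm_cancel[OF elim]
      by (simp add: trans_sum_def suminf_mult[symmetric] mult.left_commute)
  qed
next
  fix f g assume f: "f \<in> LpB" and g: "g \<in> LpB"
  show "AE z in torus. trans_sum c h (\<lambda>z. f z + g z) z = trans_sum c h f z + trans_sum c h g z"
    using trans_sum_AE_summable[OF c f, of h] trans_sum_AE_summable[OF c g, of h]
  proof eventually_elim
    case (elim z)
    have "shiftx b (\<lambda>z. f z + g z) z = shiftx b f z + shiftx b g z" for b by (cases z) simp
    then show ?case
      using summable_norm_cancel[OF elim(1)] summable_norm_cancel[OF elim(2)]
      by (simp add: trans_sum_def suminf_add distrib_left)
  qed
qed

text \<open>The partial sums of a series of translations converge in operator norm.\<close>

lemma trans_sum_tail:
  assumes c: "summable (\<lambda>n. \<bar>c n\<bar>)" and f: "f \<in> LpB"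
  shows "nrm (\<lambda>z. trans_sum c h f z - (\<Sum>n<N. of_real (c n) * shiftx (- (real n * h)) f z))
    \<le> ((\<Sum>n. \<bar>c n\<bar>) - (\<Sum>n<N. \<bar>c n\<bar>)) * nrm f"
proof -
  define d where "d n = (if n < N then 0 else c n)" for n
  have split: "(\<lambda>n. \<bar>d n\<bar> + (if n \<in> {..<N} then \<bar>c n\<bar> else 0)) = (\<lambda>n. \<bar>c n\<bar>)" by (auto simp: d_def)
  have fin: "(\<lambda>n. if n \<in> {..<N} then \<bar>c n\<bar> else 0) sums (\<Sum>n<N. \<bar>c n\<bar>)"
    by (rule sums_If_finite_set) simp
  have d: "summable (\<lambda>n. \<bar>d n\<bar>)"
    by (rule summable_comparison_test'[OF c, of 0]) (auto simp: d_def)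
  have "(\<Sum>n. \<bar>c n\<bar>) = (\<Sum>n. \<bar>d n\<bar>) + (\<Sum>n<N. \<bar>c n\<bar>)"
    using suminf_add[OF d sums_summable[OF fin]] sums_unique[OF fin] unfolding split by linarith
  then have eq: "(\<Sum>n. \<bar>d n\<bar>) = (\<Sum>n. \<bar>c n\<bar>) - (\<Sum>n<N. \<bar>c n\<bar>)" by simp
  have "AE z in torus. trans_sum c h f z - (\<Sum>n<N. of_real (c n) * shiftx (- (real n * h)) f z) = trans_sum d h f z"
    using trans_sum_AE_summable[OF c f, of h]
  proof eventually_elim
    case (elim z)
    let ?t = "\<lambda>n. of_real (c n) * shiftx (- (real n * h)) f z"
    have "?t sums (trans_sum c h f z)"
      unfolding trans_sum_def using summable_norm_cancel[OF elim] by (rule summable_sums)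
    moreover have "(\<lambda>n. if n \<in> {..<N} then ?t n else 0) sums (\<Sum>n<N. ?t n)"
      by (rule sums_If_finite_set) simp
    ultimately have "(\<lambda>n. ?t n - (if n \<in> {..<N} then ?t n else 0)) sums (trans_sum c h f z - (\<Sum>n<N. ?t n))"
      by (rule sums_diff)
    moreover have "?t n - (if n \<in> {..<N} then ?t n else 0) = of_real (d n) * shiftx (- (real n * h)) f z" for n
      by (simp add: d_def)
    ultimately show ?case by (simp add: trans_sum_def sums_iff)
  qed
  then show ?thesis using trans_sum_nrm[OF d f] nrm_cong by (simp add: eq)
qed

text \<open>A bounded operator that commutes with translations commutes with their absolutely convergent
  combinations, by approximation with partial sums.\<close>

lemma bounded_op_commute_trans_sum:
  assumes A: "bounded_op C A" and com: "\<And>f a. f \<in> LpB \<Longrightarrow> AE z in torus. A (shiftx a f) z = shiftx a (A f) z"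
    and c: "summable (\<lambda>n. \<bar>c n\<bar>)" and f: "f \<in> LpB"
  shows "AE z in torus. A (trans_sum c h f) z = trans_sum c h (A f) z"
proof -
  define r where "r N = (\<Sum>n. \<bar>c n\<bar>) - (\<Sum>n<N. \<bar>c n\<bar>)" for N
  define P where "P N g z = (\<Sum>n<N. of_real (c n) * shiftx (- (real n * h)) g z)" for N g z
  have PX: "P N g \<in> LpB" if "g \<in> LpB" for N g
    unfolding P_def using that by (intro LpB_sum(1) LpB_scale(1)) auto
  have Af: "A f \<in> LpB" using bounded_op_LpB[OF A f] .
  have T: "trans_sum c h f \<in> LpB" "trans_sum c h (A f) \<in> LpB" using trans_sum_LpB[OF c] f Af by auto
  have AP: "AE z in torus. A (P N f) z = P N (A f) z" for N
  proof -
    have "AE z in torus. \<forall>n\<in>{..<N}. A (\<lambda>z. of_real (c n) * shiftx (- (real n * h)) f z) z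
        = of_real (c n) * shiftx (- (real n * h)) (A f) z"
    proof (intro AE_finite_allI ballI)
      fix n
      show "AE z in torus. A (\<lambda>z. of_real (c n) * shiftx (- (real n * h)) f z) z
        = of_real (c n) * shiftx (- (real n * h)) (A f) z"
        using bounded_op_scale[OF A LpB_shiftx[OF f], of "of_real (c n)" "- (real n * h)"] com[OF f, of "- (real n * h)"]
        by eventually_elim simp
    qed simp
    moreover have "AE z in torus. A (P N f) z = (\<Sum>n<N. A (\<lambda>z. of_real (c n) * shiftx (- (real n * h)) f z) z)"
      unfolding P_def using f by (intro bounded_op_sum[OF A] LpB_scale(1)) auto
    ultimately show ?thesis by eventually_elim (simp add: P_def)
  qed
  have bound: "nrm (\<lambda>z. A (trans_sum c h f) z - trans_sum c h (A f) z) \<le> r N * (2 * (C * nrm f))" for N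
  proof -
    have 1: "nrm (\<lambda>z. trans_sum c h g z - P N g z) \<le> r N * nrm g" if "g \<in> LpB" for g
      unfolding r_def P_def by (rule trans_sum_tail[OF c that])
    have D: "(\<lambda>z. trans_sum c h f z - P N f z) \<in> LpB" "(\<lambda>z. trans_sum c h (A f) z - P N (A f) z) \<in> LpB"
      using T PX f Af by (auto intro: LpB_diff(1))
    have "AE z in torus. A (trans_sum c h f) z - trans_sum c h (A f) z
        = A (\<lambda>z. trans_sum c h f z - P N f z) z - (trans_sum c h (A f) z - P N (A f) z)"
      using bounded_op_diff[OF A T(1) PX[OF f, of N]] AP[of N] by eventually_elim simp
    then have "nrm (\<lambda>z. A (trans_sum c h f) z - trans_sum c h (A f) z)
        = nrm (\<lambda>z. A (\<lambda>z. trans_sum c h f z - P N f z) z - (trans_sum c h (A f) z - P N (A f) z))"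
      by (rule nrm_cong)
    also have "\<dots> \<le> nrm (A (\<lambda>z. trans_sum c h f z - P N f z)) + nrm (\<lambda>z. trans_sum c h (A f) z - P N (A f) z)"
      using bounded_op_LpB[OF A D(1)] D(2) by (rule LpB_diff(2))
    also have "\<dots> \<le> C * (r N * nrm f) + r N * (C * nrm f)"
    proof (rule add_mono)
      show "nrm (A (\<lambda>z. trans_sum c h f z - P N f z)) \<le> C * (r N * nrm f)"
        using bounded_op_nrm[OF A D(1)] mult_left_mono[OF 1[OF f] bounded_op_nonneg[OF A]] by linarith
      have "0 \<le> r N" unfolding r_def using sum_le_suminf[OF c, of "{..<N}"] by simp
      then show "nrm (\<lambda>z. trans_sum c h (A f) z - P N (A f) z) \<le> r N * (C * nrm f)"
        using 1[OF Af] mult_left_mono[OF bounded_op_nrm[OF A f], of "r N"] by linarith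
    qed
    finally show ?thesis by (simp add: algebra_simps)
  qed
  have "(\<lambda>N. r N * (2 * (C * nrm f))) \<longlonglongrightarrow> ((\<Sum>n. \<bar>c n\<bar>) - (\<Sum>n. \<bar>c n\<bar>)) * (2 * (C * nrm f))"
    unfolding r_def by (intro tendsto_intros summable_LIMSEQ c)
  then have "nrm (\<lambda>z. A (trans_sum c h f) z - trans_sum c h (A f) z) \<le> 0"
    using bound by (intro LIMSEQ_le_const[where X = "\<lambda>N. r N * (2 * (C * nrm f))"]) auto
  then have "nrm (\<lambda>z. A (trans_sum c h f) z - trans_sum c h (A f) z) = 0"
    by (simp add: antisym)
  then show ?thesis using T bounded_op_LpB[OF A] by (simp add: AE_eq_iff_nrm)
qed

text \<open>Composition corresponds to convolution of the coefficients. Almost everywhere the double series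
  converges absolutely and can be summed along the diagonals.\<close>

lemma trans_sum_trans_sum:
  assumes a: "summable (\<lambda>n. \<bar>a n\<bar>)" and b: "summable (\<lambda>n. \<bar>b n\<bar>)" and f: "f \<in> LpB"
  shows "AE z in torus. trans_sum a h (trans_sum b h f) z = trans_sum (\<lambda>n. \<Sum>i\<le>n. a i * b (n - i)) h f z"
proof -
  define g where "g = (\<lambda>z. complex_of_real (norm (f z)))"
  have g: "g \<in> LpB" unfolding g_def by (rule LpB_norm[OF f])
  define b' where "b' = (\<lambda>n. \<bar>b n\<bar>)"
  have b': "summable (\<lambda>n. \<bar>b' n\<bar>)" using b by (simp add: b'_def)
  have 1: "AE z in torus. \<forall>i. summable (\<lambda>j. norm (of_real (b j) * shiftx (- (real j * h)) (shiftx (- (real i * h)) f) z))"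
    using f by (subst AE_all_countable) (auto intro!: trans_sum_AE_summable b)
  have 2: "AE z in torus. summable (\<lambda>i. norm (of_real (a i) * shiftx (- (real i * h)) (trans_sum b' h g) z))"
    using trans_sum_LpB[OF b' g] by (intro trans_sum_AE_summable a)
  show ?thesis
    using 1 2
  proof eventually_elim
    case (elim z)
    define F where "F = (\<lambda>(i, j). of_real (a i * b j) * shiftx (- (real (i + j) * h)) f z)"
    have tt: "shiftx (- (real j * h)) (shiftx (- (real i * h)) k) z = shiftx (- (real (i + j) * h)) k z"
      for i j and k :: "real \<times> real \<Rightarrow> complex"
      by (simp add: shiftx_shiftx algebra_simps)
    have summ1: "summable (\<lambda>j. norm (F (i, j)))" for i
    proof -
      have "summable (\<lambda>j. \<bar>a i\<bar> * norm (of_real (b j) * shiftx (- (real j * h)) (shiftx (- (real i * h)) f) z))"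
        using elim(1) by (intro summable_mult) auto
      then show ?thesis unfolding tt by (simp add: F_def norm_mult mult.assoc)
    qed
    have tb: "shiftx (- (real i * h)) (trans_sum b' h g) z = of_real (\<Sum>j. \<bar>b j\<bar> * norm (shiftx (- (real (i + j) * h)) f z))" for i
    proof -
      have s: "summable (\<lambda>j. \<bar>b j\<bar> * norm (shiftx (- (real (i + j) * h)) f z))"
        using elim(1)[rule_format, of i] unfolding tt by (simp add: norm_mult)
      have "shiftx (- (real i * h)) (trans_sum b' h g) z = trans_sum b' h (shiftx (- (real i * h)) g) z"
        by (cases z) (simp add: trans_sum_def algebra_simps)
      also have "\<dots> = (\<Sum>j. of_real (\<bar>b j\<bar> * norm (shiftx (- (real (i + j) * h)) f z)))"
        unfolding trans_sum_def tt by (cases z) (simp add: b'_def g_def)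
      finally show ?thesis using suminf_of_real[OF s, where 'a = complex] by simp
    qed
    have inf: "infsum (\<lambda>j. norm (F (i, j))) UNIV = norm (of_real (a i) * shiftx (- (real i * h)) (trans_sum b' h g) z)" for i
    proof -
      have s: "summable (\<lambda>j. \<bar>b j\<bar> * norm (shiftx (- (real (i + j) * h)) f z))"
        using elim(1)[rule_format, of i] unfolding tt by (simp add: norm_mult)
      have "infsum (\<lambda>j. norm (F (i, j))) UNIV = (\<Sum>j. norm (F (i, j)))"
        by (rule infsumI, rule norm_summable_imp_has_sum) (use summ1[of i] in \<open>auto intro: summable_sums\<close>)
      also have "\<dots> = \<bar>a i\<bar> * (\<Sum>j. \<bar>b j\<bar> * norm (shiftx (- (real (i + j) * h)) f z))"
        using suminf_mult[OF s, of "\<bar>a i\<bar>"] by (simp add: F_def norm_mult abs_mult mult.assoc)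
      also have "\<dots> = norm (of_real (a i) * shiftx (- (real i * h)) (trans_sum b' h g) z)"
        unfolding tb norm_mult norm_of_real using suminf_nonneg[OF s] by simp
      finally show ?thesis .
    qed
    have abs: "(\<lambda>x. norm (F x)) summable_on UNIV \<times> UNIV"
    proof (rule Infinite_Sum.abs_summable_on_Sigma_iff[THEN iffD2], intro conjI ballI)
      show "(\<lambda>j. norm (F (i, j))) summable_on UNIV" for i
        using summ1[of i] by (intro norm_summable_imp_summable_on) auto
      show "(\<lambda>i. norm (infsum (\<lambda>j. norm (F (i, j))) UNIV)) summable_on UNIV"
        unfolding inf using elim(2) by (intro norm_summable_imp_summable_on) auto
    qed
    then have summF: "F summable_on UNIV \<times> UNIV" by (rule abs_summable_summable)
    have row: "infsum (\<lambda>j. F (i, j)) UNIV = of_real (a i) * shiftx (- (real i * h)) (trans_sum b h f) z" for i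
    proof -
      have s: "summable (\<lambda>j. of_real (b j) * shiftx (- (real (i + j) * h)) f z)"
        using summable_norm_cancel[OF elim(1)[rule_format, of i]] unfolding tt .
      have "infsum (\<lambda>j. F (i, j)) UNIV = (\<Sum>j. F (i, j))"
        by (rule infsumI, rule norm_summable_imp_has_sum[OF summ1])
           (use summable_norm_cancel[OF summ1[of i]] in \<open>auto intro: summable_sums\<close>)
      also have "\<dots> = of_real (a i) * (\<Sum>j. of_real (b j) * shiftx (- (real (i + j) * h)) f z)"
        using suminf_mult[OF s, of "of_real (a i)"] by (simp add: F_def mult.assoc)
      also have "(\<Sum>j. of_real (b j) * shiftx (- (real (i + j) * h)) f z) = shiftx (- (real i * h)) (trans_sum b h f) z"
        by (cases z) (simp add: trans_sum_def algebra_simps)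
      finally show ?thesis .
    qed
    have "trans_sum a h (trans_sum b h f) z = (\<Sum>i. infsum (\<lambda>j. F (i, j)) UNIV)"
      unfolding row trans_sum_def[of a] ..
    also have "\<dots> = infsum (\<lambda>i. infsum (\<lambda>j. F (i, j)) UNIV) UNIV"
    proof (rule infsumI[symmetric], rule norm_summable_imp_has_sum)
      show *: "summable (\<lambda>i. norm (infsum (\<lambda>j. F (i, j)) UNIV))"
      proof (rule summable_comparison_test'[OF elim(2)])
        fix i
        have "norm (infsum (\<lambda>j. F (i, j)) UNIV) \<le> infsum (\<lambda>j. norm (F (i, j))) UNIV"
          using summ1[of i] by (intro norm_infsum_bound norm_summable_imp_summable_on) auto
        then show "norm (norm (infsum (\<lambda>j. F (i, j)) UNIV))
            \<le> norm (of_real (a i) * shiftx (- (real i * h)) (trans_sum b' h g) z)"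
          unfolding inf by simp
      qed
      show "(\<lambda>i. infsum (\<lambda>j. F (i, j)) UNIV) sums (\<Sum>i. infsum (\<lambda>j. F (i, j)) UNIV)"
        using summable_norm_cancel[OF *] by (rule summable_sums)
    qed
    also have "\<dots> = infsum F (UNIV \<times> UNIV)"
      using infsum_Sigma_banach[OF summF] .
    finally have L: "trans_sum a h (trans_sum b h f) z = infsum F (UNIV \<times> UNIV)" .
    define \<phi> where "\<phi> = (\<lambda>(n::nat, i::nat). (i, n - i))"
    have bij: "bij_betw \<phi> (Sigma UNIV (\<lambda>n. {..n})) (UNIV \<times> UNIV)"
      by (rule bij_betw_byWitness[where f' = "\<lambda>(i, j). (i + j, i)"]) (auto simp: \<phi>_def)
    have summG: "(\<lambda>x. F (\<phi> x)) summable_on Sigma UNIV (\<lambda>n. {..n})"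
      using summF by (subst summable_on_reindex_bij_betw[OF bij])
    have absG: "(\<lambda>x. norm (F (\<phi> x))) summable_on Sigma UNIV (\<lambda>n. {..n})"
      using abs by (subst summable_on_reindex_bij_betw[OF bij, of "\<lambda>x. norm (F x)"])
    have diag: "infsum (\<lambda>i. F (\<phi> (n, i))) {..n} = of_real (\<Sum>i\<le>n. a i * b (n - i)) * shiftx (- (real n * h)) f z" for n
      by (simp add: \<phi>_def F_def sum_distrib_right)
    have sn: "summable (\<lambda>n. norm (infsum (\<lambda>i. F (\<phi> (n, i))) {..n}))"
    proof (rule summable_on_imp_summable, rule Infinite_Sum.abs_summable_on_comparison_test)
      show "(\<lambda>n. norm (infsum (\<lambda>i. norm (F (\<phi> (n, i)))) {..n})) summable_on UNIV"
        using absG Infinite_Sum.abs_summable_on_Sigma_iff[of "\<lambda>x. F (\<phi> x)"] by auto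
      show "norm (infsum (\<lambda>i. F (\<phi> (n, i))) {..n}) \<le> norm (infsum (\<lambda>i. norm (F (\<phi> (n, i)))) {..n})" for n
        by (auto intro!: order_trans[OF norm_sum] simp: abs_if sum_nonneg)
    qed
    have "infsum F (UNIV \<times> UNIV) = infsum (\<lambda>x. F (\<phi> x)) (Sigma UNIV (\<lambda>n. {..n}))"
      by (rule infsum_reindex_bij_betw[OF bij, symmetric])
    also have "\<dots> = infsum (\<lambda>n. infsum (\<lambda>i. F (\<phi> (n, i))) {..n}) UNIV"
      by (rule infsum_Sigma_banach[OF summG, symmetric])
    also have "\<dots> = (\<Sum>n. infsum (\<lambda>i. F (\<phi> (n, i))) {..n})"
      by (rule infsumI, rule norm_summable_imp_has_sum[OF sn])
         (use summable_norm_cancel[OF sn] in \<open>auto intro: summable_sums\<close>)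
    also have "\<dots> = trans_sum (\<lambda>n. \<Sum>i\<le>n. a i * b (n - i)) h f z"
      unfolding diag trans_sum_def ..
    finally show ?case unfolding L .
  qed
qed

end

section \<open>Fourier multipliers in one variable\<close>

lemma cis_2pi_int: "cis (of_int k * (x + 2 * pi)) = cis (of_int k * x)"
proof -
  have "of_int k * (x + 2 * pi) = of_int k * x + 2 * pi * of_int k" by (simp add: algebra_simps)
  then show ?thesis by (simp add: cis_mult[symmetric] cis_multiple_2pi)
qed

lemma cis_measurable [measurable]: "(\<lambda>t. cis (r * t)) \<in> borel_measurable borel"
  by (intro borel_measurable_continuous_onI continuous_intros)

lemma integrable_cis_mult:
  fixes \<phi> :: "real \<Rightarrow> complex"
  assumes "integrable circ \<phi>"
  shows "integrable circ (\<lambda>t. cis (r * t) * \<phi> t)"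
proof (rule Bochner_Integration.integrable_bound[OF assms])
  have [measurable]: "\<phi> \<in> borel_measurable borel" using borel_measurable_integrable[OF assms] by simp
  show "(\<lambda>t. cis (r * t) * \<phi> t) \<in> borel_measurable circ" by measurable
qed (simp add: norm_mult)

lemma integral_cis: "(\<integral>t. cis (of_int k * t) \<partial>circ) = (if k = 0 then 1 else 0)"
proof (cases "k = 0")
  case True
  then show ?thesis using circ.prob_space by simp
next
  case False
  let ?I = "\<integral>t. cis (of_int k * t) \<partial>circ"
  have "?I = (\<integral>t. cis (of_int k * (pi / of_int k + 1 * t)) \<partial>circ)"
    by (rule integral_circ_affine[symmetric]) (auto simp: cis_2pi_int intro: exI[of _ 1])
  also have "\<dots> = (\<integral>t. - cis (of_int k * t) \<partial>circ)"
    using False by (intro Bochner_Integration.integral_cong refl)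
      (simp add: distrib_left cis_mult[symmetric])
  also have "\<dots> = - ?I" by simp
  finally have "?I = 0" by simp
  then show ?thesis using False by simp
qed

text \<open>Averaging \<open>\<phi>(x - m t)\<close> against a character in \<open>t\<close>: for \<open>m\<close> not dividing \<open>j\<close>, shifting \<open>t\<close> by \<open>2\<pi> / m\<close>
  multiplies the integral by a number different from one.\<close>

lemma integral_cis_dilate:
  fixes \<phi> :: "real \<Rightarrow> complex"
  assumes int: "integrable circ \<phi>" and per: "\<And>x. \<phi> (x + 2 * pi) = \<phi> x" and "0 < m"
  shows "(\<integral>t. cis (of_int j * t) * \<phi> (x - real m * t) \<partial>circ)
    = (if int m dvd j then cis (of_int (j div int m) * x)
        * (\<integral>t. cis (- (of_int (j div int m) * t)) * \<phi> t \<partial>circ) else 0)"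
proof -
  have [measurable]: "\<phi> \<in> borel_measurable borel" using borel_measurable_integrable[OF int] by simp
  have per_minus: "\<phi> (x - 2 * pi) = \<phi> x" for x using per[of "x - 2 * pi"] by simp
  show ?thesis
  proof (cases "int m dvd j")
    case True
    then obtain k where j: "j = int m * k" by auto
    define \<psi> where "\<psi> s = cis (- (of_int k * s)) * \<phi> s" for s
    have [measurable]: "\<psi> \<in> borel_measurable borel"
      unfolding \<psi>_def using cis_measurable[of "- of_int k"] by simp
    have per\<psi>: "\<psi> (s + 2 * pi) = \<psi> s" for s
      using cis_2pi_int[of "-k" s] by (simp only: \<psi>_def per of_int_minus mult_minus_left)
    have "(\<integral>t. cis (of_int j * t) * \<phi> (x - real m * t) \<partial>circ)
        = (\<integral>t. cis (of_int k * x) * \<psi> (x + (- real m) * t) \<partial>circ)"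
    proof (intro Bochner_Integration.integral_cong refl)
      fix t
      have "cis (of_int k * x) * cis (- (of_int k * (x + (- real m) * t))) = cis (of_int j * t)"
        by (simp add: cis_mult j algebra_simps)
      then show "cis (of_int j * t) * \<phi> (x - real m * t) = cis (of_int k * x) * \<psi> (x + (- real m) * t)"
        by (simp only: \<psi>_def mult.assoc[symmetric]) simp
    qed
    also have "\<dots> = cis (of_int k * x) * (\<integral>t. \<psi> (x + (- real m) * t) \<partial>circ)"
      by (rule integral_mult_right_zero)
    also have "(\<integral>t. \<psi> (x + (- real m) * t) \<partial>circ) = (\<integral>t. \<psi> t \<partial>circ)"
      by (rule integral_circ_affine) (use \<open>0 < m\<close> per\<psi> in auto)
    finally show ?thesis using True \<open>0 < m\<close> by (simp add: j \<psi>_def)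
  next
    case False
    let ?I = "\<integral>t. cis (of_int j * t) * \<phi> (x - real m * t) \<partial>circ"
    let ?c = "cis (of_int j * (2 * pi / real m))"
    have cm: "(\<lambda>t. cis (of_int j * t)) \<in> borel_measurable borel" by (rule cis_measurable)
    have perm: "\<phi> (x - real m * (t + 2 * pi)) = \<phi> (x - real m * t)" for t
      using periodic_int[of \<phi> "x - real m * t" "- int m", OF per] by (simp add: algebra_simps)
    have "?I = (\<integral>t. cis (of_int j * (2 * pi / real m + 1 * t)) * \<phi> (x - real m * (2 * pi / real m + 1 * t)) \<partial>circ)"
      using cm by (intro integral_circ_affine[where s = 1, symmetric])
        (auto simp: cis_2pi_int perm intro: exI[of _ 1])
    also have "\<dots> = (\<integral>t. ?c * (cis (of_int j * t) * \<phi> (x - real m * t)) \<partial>circ)"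
    proof (intro Bochner_Integration.integral_cong refl)
      fix t
      have "x - real m * (2 * pi / real m + 1 * t) = (x - real m * t) - 2 * pi"
        using \<open>0 < m\<close> by (simp add: field_simps)
      then show "cis (of_int j * (2 * pi / real m + 1 * t)) * \<phi> (x - real m * (2 * pi / real m + 1 * t))
          = ?c * (cis (of_int j * t) * \<phi> (x - real m * t))"
        by (simp only: per_minus) (simp add: distrib_left cis_mult[symmetric])
    qed
    also have "\<dots> = ?c * ?I" by (rule integral_mult_right_zero)
    finally have "(?c - 1) * ?I = 0" by (simp add: algebra_simps)
    moreover have "?c \<noteq> 1"
    proof
      assume "?c = 1"
      then obtain n :: int where "of_int j * (2 * pi / real m) = of_int (2 * n) * pi"
        unfolding cis_conv_exp exp_eq_1 by auto
      then have "real_of_int j = of_int (n * int m)"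
        using \<open>0 < m\<close> by (simp add: field_simps)
      then have "j = n * int m" by (simp only: of_int_eq_iff)
      then show False using False by simp
    qed
    ultimately show ?thesis using False by simp
  qed
qed

text \<open>The \<open>k\<close>-th Fourier coefficient in the first variable, as a function of the second one. For a
  section that is not integrable it is zero by the convention for the integral.\<close>

definition fcoeff :: "(real \<times> real \<Rightarrow> complex) \<Rightarrow> int \<Rightarrow> real \<Rightarrow> complex" where
  "fcoeff f k y = (\<integral>t. cis (- (of_int k * t)) * f (t, y) \<partial>circ)"

text \<open>The Fourier multiplier in the first variable with multiplier \<open>a\<close> cut off outside \<open>[-n, n]\<close>.\<close>

definition mult_op :: "nat \<Rightarrow> (int \<Rightarrow> complex) \<Rightarrow> (real \<times> real \<Rightarrow> complex) \<Rightarrow> real \<times> real \<Rightarrow> complex" where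
  "mult_op n a f = (\<lambda>(x, y). \<Sum>k = - int n..int n. a k * fcoeff f k y * cis (of_int k * x))"

text \<open>A multiple of the identity plus a multiplier of finite support: the form of the errors of the
  approximation processes and of the dyadic blocks used below.\<close>

definition id_mult_op :: "complex \<Rightarrow> nat \<Rightarrow> (int \<Rightarrow> complex) \<Rightarrow> (real \<times> real \<Rightarrow> complex) \<Rightarrow> real \<times> real \<Rightarrow> complex" where
  "id_mult_op e n a f = (\<lambda>z. e * f z + mult_op n a f z)"

lemma fcoeff_trig_poly:
  assumes T: "\<And>x. T (x, y) = (\<Sum>l = - int m..int m. c l * cis (of_int l * x))"
  shows "fcoeff T k y = (if \<bar>k\<bar> \<le> int m then c k else 0)"
proof -
  have int: "integrable circ (\<lambda>t. c l * cis (of_int (l - k) * t))" for l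
    using integrable_cis_mult[of "\<lambda>_. c l" "of_int (l - k)"] by (simp add: mult.commute)
  have "fcoeff T k y = (\<integral>t. (\<Sum>l = - int m..int m. c l * cis (of_int (l - k) * t)) \<partial>circ)"
    unfolding fcoeff_def T sum_distrib_left
    by (intro Bochner_Integration.integral_cong sum.cong refl)
       (simp add: cis_mult algebra_simps)
  also have "\<dots> = (\<Sum>l = - int m..int m. (\<integral>t. c l * cis (of_int (l - k) * t) \<partial>circ))"
    using int by (intro Bochner_Integration.integral_sum) auto
  also have "\<dots> = (\<Sum>l = - int m..int m. if l = k then c l else 0)"
    unfolding integral_mult_right_zero integral_cis by (intro sum.cong) auto
  also have "\<dots> = (if \<bar>k\<bar> \<le> int m then c k else 0)"
    by (subst sum.delta) auto
  finally show ?thesis .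
qed

lemma trig_poly1_cis:
  "trig_poly1 m T \<longleftrightarrow> (\<exists>c :: int \<Rightarrow> real \<Rightarrow> complex. \<forall>x y.
     T (x, y) = (\<Sum>k = - int m..int m. c k y * cis (of_int k * x)))"
  by (simp add: trig_poly1_def cis_conv_exp mult.assoc)

text \<open>The coefficients of a trigonometric polynomial are recovered pointwise, without any assumption on
  measurability in the second variable.\<close>

lemma trig_poly1_fcoeff:
  assumes "trig_poly1 m T"
  shows "T (x, y) = (\<Sum>k = - int m..int m. fcoeff T k y * cis (of_int k * x))"
    and "\<bar>k\<bar> > int m \<Longrightarrow> fcoeff T k y = 0"
proof -
  obtain c where c: "\<And>x y. T (x, y) = (\<Sum>k = - int m..int m. c k y * cis (of_int k * x))"
    using assms unfolding trig_poly1_cis by blast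
  have *: "fcoeff T k y = (if \<bar>k\<bar> \<le> int m then c k y else 0)" for k
    by (rule fcoeff_trig_poly) (rule c)
  show "T (x, y) = (\<Sum>k = - int m..int m. fcoeff T k y * cis (of_int k * x))"
    unfolding c by (intro sum.cong) (auto simp: *)
  show "\<bar>k\<bar> > int m \<Longrightarrow> fcoeff T k y = 0" by (simp add: *)
qed

lemma trig_poly1_mult_op: "trig_poly1 n (mult_op n a f)"
  unfolding trig_poly1_cis mult_op_def by (intro exI[of _ "\<lambda>k y. a k * fcoeff f k y"]) simp

lemma fcoeff_mult_op: "fcoeff (mult_op n a f) k y = (if \<bar>k\<bar> \<le> int n then a k * fcoeff f k y else 0)"
  by (rule fcoeff_trig_poly) (simp add: mult_op_def)

lemma trig_poly1_mono:
  assumes "trig_poly1 m T" "m \<le> n"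
  shows "trig_poly1 n T"
  unfolding trig_poly1_cis
proof (intro exI[of _ "\<lambda>k y. fcoeff T k y"] allI)
  fix x y
  show "T (x, y) = (\<Sum>k = - int n..int n. fcoeff T k y * cis (of_int k * x))"
    unfolding trig_poly1_fcoeff(1)[OF assms(1), of x y] using assms(2)
    by (intro sum.mono_neutral_left) (auto simp: trig_poly1_fcoeff(2)[OF assms(1)])
qed

lemma mult_op_trig_poly:
  assumes T: "trig_poly1 m T"
  shows "mult_op n a T (x, y) = (\<Sum>k = - int m..int m. (if \<bar>k\<bar> \<le> int n then a k else 0) * fcoeff T k y * cis (of_int k * x))"
proof -
  have "mult_op n a T (x, y) = (\<Sum>k\<in>{- int (max m n)..int (max m n)}. (if \<bar>k\<bar> \<le> int n then a k else 0) * fcoeff T k y * cis (of_int k * x))"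
    unfolding mult_op_def prod.case by (rule sum.mono_neutral_cong_left) auto
  also have "\<dots> = (\<Sum>k = - int m..int m. (if \<bar>k\<bar> \<le> int n then a k else 0) * fcoeff T k y * cis (of_int k * x))"
    by (rule sum.mono_neutral_right) (auto simp: trig_poly1_fcoeff(2)[OF T])
  finally show ?thesis .
qed

lemma fcoeff_measurable [measurable]:
  assumes [measurable]: "f \<in> borel_measurable borel"
  shows "fcoeff f k \<in> borel_measurable borel"
proof -
  have [measurable]: "f \<in> borel_measurable (borel \<Otimes>\<^sub>M borel)" by (simp add: borel_prod)
  have [measurable]: "(\<lambda>t. cis (- (of_int k * t))) \<in> borel_measurable borel"
    using cis_measurable[of "- of_int k"] by simp
  show ?thesis unfolding fcoeff_def by measurable
qed

lemma mult_op_measurable: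
  assumes [measurable]: "f \<in> borel_measurable borel"
  shows "mult_op n a f \<in> borel_measurable borel"
  unfolding mult_op_def split_beta borel_prod[symmetric] by measurable

lemma fcoeff_add:
  assumes "integrable circ (\<lambda>t. f (t, y))" "integrable circ (\<lambda>t. g (t, y))"
  shows "fcoeff (\<lambda>z. f z + g z) k y = fcoeff f k y + fcoeff g k y"
  using integrable_cis_mult[OF assms(1), of "- of_int k"] integrable_cis_mult[OF assms(2), of "- of_int k"]
  unfolding fcoeff_def by (subst Bochner_Integration.integral_add[symmetric]) (auto simp: distrib_left)

lemma fcoeff_scale: "fcoeff (\<lambda>z. c * f z) k y = c * fcoeff f k y"
  unfolding fcoeff_def by (subst integral_mult_right_zero[symmetric]) (simp add: mult.left_commute)

lemma fcoeff_shift2: "fcoeff (swapxy (shiftx a (swapxy f))) k y = fcoeff f k (y + a)"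
  by (simp add: fcoeff_def)

lemma id_mult_op_shift2: "id_mult_op e n b (swapxy (shiftx a (swapxy f))) = swapxy (shiftx a (swapxy (id_mult_op e n b f)))"
  by (auto simp: id_mult_op_def mult_op_def fcoeff_shift2)

lemma measurable_torus: "measurable torus N = measurable (borel \<Otimes>\<^sub>M borel) N"
  by (rule measurable_cong_sets) (simp_all add: borel_prod)

lemma AE_torus_snd:
  assumes "AE y in circ. P y"
  shows "AE z in torus. P (snd z)"
proof -
  obtain N where N: "N \<in> sets circ" "emeasure circ N = 0" "{y \<in> space circ. \<not> P y} \<subseteq> N"
    using assms by (auto elim!: AE_E)
  have e: "emeasure torus (UNIV \<times> N) = 0"
    using N circ.emeasure_pair_measure_Times[of UNIV circ N] by simp
  show ?thesis
  proof (rule AE_I[OF _ e])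
    have "UNIV \<in> sets circ" by simp
    then show "UNIV \<times> N \<in> sets torus" using N(1) by (rule pair_measureI)
    show "{z \<in> space torus. \<not> P (snd z)} \<subseteq> UNIV \<times> N" using N(3) by auto
  qed
qed

lemma
  fixes g :: "nat \<Rightarrow> 'a \<Rightarrow> complex"
  assumes int: "\<And>i. integrable M (g i)" and summ: "summable (\<lambda>i. \<integral>x. norm (g i x) \<partial>M)"
  shows AE_summable_of_abs: "AE x in M. summable (\<lambda>i. norm (g i x))"
    and integral_suminf_of_abs: "(\<integral>x. (\<Sum>i. g i x) \<partial>M) = (\<Sum>i. \<integral>x. g i x \<partial>M)"
proof -
  have [measurable]: "g i \<in> borel_measurable M" for i using int by auto
  have "(\<integral>\<^sup>+x. (\<Sum>i. ennreal (norm (g i x))) \<partial>M) = (\<Sum>i. \<integral>\<^sup>+x. ennreal (norm (g i x)) \<partial>M)"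
    by (rule nn_integral_suminf) auto
  also have "\<dots> = (\<Sum>i. ennreal (\<integral>x. norm (g i x) \<partial>M))"
    using int by (intro suminf_cong nn_integral_eq_integral) auto
  also have "\<dots> = ennreal (\<Sum>i. \<integral>x. norm (g i x) \<partial>M)"
    using summ by (intro suminf_ennreal2) auto
  finally have "AE x in M. (\<Sum>i. ennreal (norm (g i x))) \<noteq> \<infinity>"
    by (intro nn_integral_PInf_AE) auto
  then show AE: "AE x in M. summable (\<lambda>i. norm (g i x))"
    by eventually_elim (auto intro: summable_suminf_not_top)
  show "(\<integral>x. (\<Sum>i. g i x) \<partial>M) = (\<Sum>i. \<integral>x. g i x \<partial>M)"
    by (rule integral_suminf[OF int AE summ])
qed

context torus_Lp
begin

lemma LpB_integrable: "f \<in> LpB \<Longrightarrow> integrable torus f"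
  using circ2.P.jensen_powr(1)[OF p_gt_1, of f] LpB_fin[of f] by (auto simp: pint_def)

lemma AE_section:
  assumes "f \<in> LpB"
  shows "AE z in torus. integrable circ (\<lambda>t. f (t, snd z))"
proof (rule AE_torus_snd)
  have "integrable torus (swapxy f)" using assms by (intro LpB_integrable) auto
  then have "AE x in circ. integrable circ (\<lambda>y. swapxy f (x, y))" by (rule circ2.AE_integrable_fst')
  then show "AE y in circ. integrable circ (\<lambda>t. f (t, y))" by simp
qed

lemma section_measurable [measurable_dest]: "f \<in> LpB \<Longrightarrow> (\<lambda>t. f (t, y)) \<in> borel_measurable borel"
proof -
  assume "f \<in> LpB"
  then have [measurable]: "f \<in> borel_measurable (borel \<Otimes>\<^sub>M borel)" by (simp add: borel_prod LpB_meas)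
  show "(\<lambda>t. f (t, y)) \<in> borel_measurable borel" by measurable
qed

text \<open>Convolution in the first variable against the complex density \<open>u w\<close>, where \<open>w\<close> is a probability
  density and \<open>\<bar>u\<bar> \<le> 1\<close>, does not increase the norm.\<close>

lemma convolution_bound:
  assumes f: "f \<in> LpB" and [measurable]: "u \<in> borel_measurable borel" "w \<in> borel_measurable borel"
    and u: "\<And>t. norm (u t :: complex) \<le> 1" and w: "\<And>t. 0 \<le> w t" "(\<integral>\<^sup>+t. ennreal (w t) \<partial>circ) = 1"
    and G: "AE z in torus. G z = (\<integral>t. of_real (w t) * (u t * f (fst z - t, snd z)) \<partial>circ)"
    and GX: "G \<in> borel_measurable borel" "\<And>x y. G (x + 2 * pi, y) = G (x, y)" "\<And>x y. G (x, y + 2 * pi) = G (x, y)"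
  shows "G \<in> LpB" and "nrm G \<le> nrm f"
proof -
  have [measurable]: "f \<in> borel_measurable (borel \<Otimes>\<^sub>M borel)" using f by (simp add: borel_prod LpB_meas)
  define M where "M = density circ (\<lambda>t. ennreal (w t))"
  have M: "prob_space M"
    unfolding M_def using w by (intro prob_spaceI) (simp add: emeasure_density)
  have sets [measurable_cong]: "sets M = sets borel" by (simp add: M_def)
  have "(\<lambda>(t, z). u t * f (fst z - t, snd z)) \<in> borel_measurable (borel \<Otimes>\<^sub>M (borel \<Otimes>\<^sub>M borel))"
    unfolding split_beta by measurable
  also have "borel_measurable (borel \<Otimes>\<^sub>M (borel \<Otimes>\<^sub>M borel)) = borel_measurable (M \<Otimes>\<^sub>M torus)"
    by (intro measurable_cong_sets sets_pair_measure_cong) (simp_all add: sets borel_prod)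
  finally have [measurable]: "(\<lambda>(t, z). u t * f (fst z - t, snd z)) \<in> borel_measurable (M \<Otimes>\<^sub>M torus)" .
  have eq: "(\<integral>t. u t * f (fst z - t, snd z) \<partial>M) = (\<integral>t. of_real (w t) * (u t * f (fst z - t, snd z)) \<partial>circ)" for z
    unfolding M_def using w by (subst integral_density) (auto simp: scaleR_conv_of_real)
  have "pint (\<lambda>z. \<integral>t. u t * f (fst z - t, snd z) \<partial>M) \<le> ennreal (nrm f powr p)"
  proof (rule LpB_integral(2)[where W = "\<lambda>_. ennreal (nrm f powr p)", OF M])
    fix t
    have "(\<lambda>z. u t * f (fst z - t, snd z)) = (\<lambda>z. u t * shiftx (- t) f z)" by (auto simp: shiftx_def)
    then have "pint (\<lambda>z. u t * f (fst z - t, snd z)) = pint (\<lambda>z. u t * shiftx (- t) f z)" by simp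
    also have "\<dots> \<le> pint (shiftx (- t) f)"
      using u by (intro pint_mono) (auto simp: norm_mult intro!: mult_left_le_one_le)
    also have "\<dots> = ennreal (nrm f powr p)" using f by (simp add: pint_eq)
    finally show "pint (\<lambda>z. u t * f (fst z - t, snd z)) \<le> ennreal (nrm f powr p)" .
  next
    show "(\<integral>\<^sup>+m. ennreal (nrm f powr p) \<partial>M) \<le> ennreal (nrm f powr p)"
      using M by (simp add: prob_space.emeasure_space_1)
  qed simp
  moreover have "pint G \<le> pint (\<lambda>z. \<integral>t. u t * f (fst z - t, snd z) \<partial>M)"
    using G by (intro pint_mono) (auto simp: eq elim!: eventually_mono)
  ultimately have 1: "pint G \<le> ennreal (nrm f powr p)" by simp
  show "G \<in> LpB" using XI[OF GX 1] .
  show "nrm G \<le> nrm f" using nrm_le[OF 1] by simp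
qed

lemma mult_op_per:
  assumes "f \<in> LpB"
  shows "mult_op n a f (x + 2 * pi, y) = mult_op n a f (x, y)" "mult_op n a f (x, y + 2 * pi) = mult_op n a f (x, y)"
  using assms unfolding mult_op_def prod.case fcoeff_def cis_2pi_int by (simp_all add: LpB_per2)

lemma convolution_mult_op:
  assumes f: "f \<in> LpB" and int: "integrable circ (\<lambda>t. f (t, y))" and "0 < m"
  shows "(\<integral>t. (\<Sum>k = - int n..int n. a k * cis (of_int k * t)) * f (x - real m * t, y) \<partial>circ)
    = mult_op n (\<lambda>k. if \<bar>int m * k\<bar> \<le> int n then a (int m * k) else 0) f (x, y)"
proof -
  have per: "f (t + 2 * pi, y) = f (t, y)" for t using f by (rule LpB_per1)
  have int': "integrable circ (\<lambda>t. f (x - real m * t, y))"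
    using integrable_circ_affine[of "\<lambda>t. f (t, y)" "- real m" x] int per f \<open>0 < m\<close>
    by (auto intro: section_measurable)
  have "(\<integral>t. (\<Sum>k = - int n..int n. a k * cis (of_int k * t)) * f (x - real m * t, y) \<partial>circ)
      = (\<integral>t. (\<Sum>k = - int n..int n. a k * (cis (of_int k * t) * f (x - real m * t, y))) \<partial>circ)"
    by (simp add: sum_distrib_right mult.assoc)
  also have "\<dots> = (\<Sum>k = - int n..int n. \<integral>t. a k * (cis (of_int k * t) * f (x - real m * t, y)) \<partial>circ)"
    using integrable_cis_mult[OF int'] by (intro Bochner_Integration.integral_sum) auto
  also have "\<dots> = (\<Sum>k = - int n..int n. a k * (if int m dvd k then cis (of_int (k div int m) * x) * fcoeff f (k div int m) y else 0))"
    unfolding integral_mult_right_zero integral_cis_dilate[OF int per \<open>0 < m\<close>] fcoeff_def ..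
  also have "\<dots> = (\<Sum>k\<in>{k \<in> {- int n..int n}. int m dvd k}. a k * (cis (of_int (k div int m) * x) * fcoeff f (k div int m) y))"
    by (rule sum.mono_neutral_cong_right) auto
  also have "\<dots> = (\<Sum>k\<in>{k. \<bar>int m * k\<bar> \<le> int n}. a (int m * k) * fcoeff f k y * cis (of_int k * x))"
    using \<open>0 < m\<close>
    by (intro sum.reindex_bij_witness[where i = "\<lambda>k. int m * k" and j = "\<lambda>k. k div int m"]) auto
  also have "\<dots> = (\<Sum>k = - int n..int n. (if \<bar>int m * k\<bar> \<le> int n then a (int m * k) else 0) * fcoeff f k y * cis (of_int k * x))"
  proof (rule sum.mono_neutral_cong_left)
    have le: "\<bar>k\<bar> \<le> \<bar>int m * k\<bar>" for k
      using \<open>0 < m\<close> mult_right_mono[of 1 "int m" "\<bar>k\<bar>"] by (simp add: abs_mult)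
    show "{k. \<bar>int m * k\<bar> \<le> int n} \<subseteq> {- int n..int n}"
    proof
      fix k assume "k \<in> {k. \<bar>int m * k\<bar> \<le> int n}"
      then have "\<bar>k\<bar> \<le> int n" using le[of k] by simp
      then show "k \<in> {- int n..int n}" by auto
    qed
  qed auto
  finally show ?thesis by (simp add: mult_op_def)
qed

lemma mult_op_add_AE:
  assumes "f \<in> LpB" "g \<in> LpB"
  shows "AE z in torus. mult_op n a (\<lambda>z. f z + g z) z = mult_op n a f z + mult_op n a g z"
  using AE_section[OF assms(1)] AE_section[OF assms(2)]
proof eventually_elim
  case (elim z)
  then show ?case
    by (cases z) (simp add: mult_op_def fcoeff_add sum.distrib distrib_left distrib_right)
qed

lemma mult_op_scale: "mult_op n a (\<lambda>z. c * f z) = (\<lambda>z. c * mult_op n a f z)"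
  by (auto simp: mult_op_def fcoeff_scale sum_distrib_left algebra_simps)

lemma bounded_op_mult_op: "\<exists>C. bounded_op C (mult_op n a)"
proof
  have *: "(\<lambda>z. cis (of_int k * fst z) * fcoeff f k (snd z)) \<in> LpB
      \<and> nrm (\<lambda>z. cis (of_int k * fst z) * fcoeff f k (snd z)) \<le> nrm f" (is "?G k \<in> LpB \<and> _")
    if f: "f \<in> LpB" for f k
  proof -
    have m: "?G k \<in> borel_measurable borel"
      using f unfolding borel_prod[symmetric] by measurable
    have G: "AE z in torus. ?G k z = (\<integral>t. of_real 1 * (cis (of_int k * t) * f (fst z - t, snd z)) \<partial>circ)"
      using AE_section[OF f]
    proof eventually_elim
      case (elim z)
      have "(\<integral>t. cis (of_int k * t) * f (fst z - real 1 * t, snd z) \<partial>circ)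
          = cis (of_int k * fst z) * fcoeff f k (snd z)"
        by (subst integral_cis_dilate[OF elim]) (auto simp: LpB_per1[OF f] fcoeff_def)
      then show ?case by simp
    qed
    show ?thesis
      using convolution_bound[OF f _ _ _ _ _ G m] f cis_2pi_int[of k]
      by (auto simp: fcoeff_def LpB_per2 circ.emeasure_space_1[simplified])
  qed
  show "bounded_op (\<Sum>k = - int n..int n. norm (a k)) (mult_op n a)"
    unfolding bounded_op_def
  proof (intro conjI ballI allI)
    fix f assume f: "f \<in> LpB"
    have eq: "mult_op n a f = (\<lambda>z. \<Sum>k = - int n..int n. a k * (cis (of_int k * fst z) * fcoeff f k (snd z)))"
      by (auto simp: mult_op_def intro!: sum.cong)
    have 1: "(\<lambda>z. a k * (cis (of_int k * fst z) * fcoeff f k (snd z))) \<in> LpB" for k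
      using *[OF f] by (intro LpB_scale(1)) auto
    show "mult_op n a f \<in> LpB" unfolding eq using 1 by (intro LpB_sum(1)) auto
    have "nrm (mult_op n a f) \<le> (\<Sum>k = - int n..int n. nrm (\<lambda>z. a k * (cis (of_int k * fst z) * fcoeff f k (snd z))))"
      unfolding eq using 1 by (intro LpB_sum(2)) auto
    also have "\<dots> \<le> (\<Sum>k = - int n..int n. norm (a k) * nrm f)"
      using *[OF f] by (intro sum_mono) (auto simp: LpB_scale(2) intro!: mult_left_mono)
    finally show "nrm (mult_op n a f) \<le> (\<Sum>k = - int n..int n. norm (a k)) * nrm f"
      by (simp add: sum_distrib_right)
    show "AE z in torus. mult_op n a (\<lambda>z. c * f z) z = c * mult_op n a f z" for c
      by (simp add: mult_op_scale)
  qed (auto intro: mult_op_add_AE sum_nonneg)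
qed

lemma bounded_op_id_mult_op: "\<exists>C. bounded_op C (id_mult_op e n a)"
proof -
  obtain C where "bounded_op C (mult_op n a)" using bounded_op_mult_op by blast
  from bounded_op_lincomb[OF bounded_op_id this, of e 1] show ?thesis
    unfolding id_mult_op_def by auto
qed

lemma id_mult_op_LpB: "f \<in> LpB \<Longrightarrow> id_mult_op e n a f \<in> LpB"
  using bounded_op_id_mult_op[of e n a] bounded_op_LpB by blast

lemma mult_op_LpB: "f \<in> LpB \<Longrightarrow> mult_op n a f \<in> LpB"
  using bounded_op_mult_op[of n a] bounded_op_LpB by blast

lemma id_mult_op_commute_trans_sum:
  assumes c: "summable (\<lambda>n. \<bar>c n\<bar>)" and f: "f \<in> LpB"
  shows "AE z in torus. id_mult_op e n a (swapxy (trans_sum c h (swapxy f))) z = swapxy (trans_sum c h (swapxy (id_mult_op e n a f))) z"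
proof -
  obtain C where C: "bounded_op C (id_mult_op e n a)" using bounded_op_id_mult_op by blast
  have "AE z in torus. swapxy (id_mult_op e n a (swapxy (trans_sum c h (swapxy f)))) z = trans_sum c h (swapxy (id_mult_op e n a (swapxy (swapxy f)))) z"
  proof (rule bounded_op_commute_trans_sum[OF bounded_op_conj_swapxy[OF C] _ c])
    fix g a'
    show "AE z in torus. swapxy (id_mult_op e n a (swapxy (shiftx a' g))) z = shiftx a' (swapxy (id_mult_op e n a (swapxy g))) z"
      using id_mult_op_shift2[of e n a a' "swapxy g"] by simp
  qed (use f in auto)
  from AE_swapxy[OF this] show ?thesis
    by eventually_elim (auto simp: split_beta)
qed

lemma fcoeff_sum_cis:
  assumes f: "f \<in> LpB"
  shows "fcoeff (swapxy (mult_op m b (swapxy f))) k y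
    = (\<Sum>l = - int m..int m. b l * cis (of_int l * y) * fcoeff (\<lambda>(x, _). fcoeff (swapxy f) l x) k 0)"
proof -
  have int: "integrable circ (\<lambda>t. fcoeff (swapxy f) l t)" for l
  proof -
    have "integrable torus (\<lambda>z. cis (- (of_int l * snd z)) * f z)"
    proof (rule Bochner_Integration.integrable_bound[OF LpB_integrable[OF f]])
      have [measurable]: "f \<in> borel_measurable (borel \<Otimes>\<^sub>M borel)" using f by (simp add: borel_prod LpB_meas)
      have [measurable]: "(\<lambda>t. cis (- (of_int l * t))) \<in> borel_measurable borel"
        using cis_measurable[of "- of_int l"] by simp
      show "(\<lambda>z. cis (- (of_int l * snd z)) * f z) \<in> borel_measurable torus"
        unfolding measurable_torus by measurable
    qed (simp add: norm_mult)
    then show ?thesis using circ2.integrable_fst' unfolding fcoeff_def by fastforce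
  qed
  have "fcoeff (swapxy (mult_op m b (swapxy f))) k y
      = (\<integral>t. (\<Sum>l = - int m..int m. (b l * cis (of_int l * y)) * (cis (- (of_int k * t)) * fcoeff (swapxy f) l t)) \<partial>circ)"
    unfolding fcoeff_def[of "swapxy (mult_op m b (swapxy f))"]
    by (intro Bochner_Integration.integral_cong refl)
       (simp add: mult_op_def sum_distrib_left sum_distrib_right mult_ac)
  also have "\<dots> = (\<Sum>l = - int m..int m. \<integral>t. (b l * cis (of_int l * y)) * (cis (- (of_int k * t)) * fcoeff (swapxy f) l t) \<partial>circ)"
    using integrable_cis_mult[OF int, of "- of_int k"] by (intro Bochner_Integration.integral_sum) auto
  finally show ?thesis by (simp add: fcoeff_def[of _ k 0])
qed

text \<open>Fubini's theorem for the double Fourier coefficients. The inner coefficient is regarded as a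
  function of two variables that does not depend on the second one, whence the argument \<open>0\<close>.\<close>

lemma fcoeff_fcoeff:
  assumes f: "f \<in> LpB"
  shows "fcoeff (\<lambda>(x, _). fcoeff (swapxy f) l x) k 0 = fcoeff (\<lambda>(y, _). fcoeff f k y) l 0"
proof -
  let ?F = "\<lambda>x y. cis (- (of_int k * x)) * (cis (- (of_int l * y)) * f (x, y))"
  have "integrable torus (case_prod ?F)"
  proof (rule Bochner_Integration.integrable_bound[OF LpB_integrable[OF f]])
    have [measurable]: "f \<in> borel_measurable (borel \<Otimes>\<^sub>M borel)" using f by (simp add: borel_prod LpB_meas)
    have [measurable]: "(\<lambda>t. cis (- (of_int l * t))) \<in> borel_measurable borel" for l :: int
      using cis_measurable[of "- of_int l"] by simp
    show "case_prod ?F \<in> borel_measurable torus"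
      unfolding measurable_torus by measurable
  qed (simp add: norm_mult split_beta)
  then have "(\<integral>y. (\<integral>x. ?F x y \<partial>circ) \<partial>circ) = (\<integral>x. (\<integral>y. ?F x y \<partial>circ) \<partial>circ)"
    by (rule circ2.Fubini_integral)
  moreover have "(\<integral>x. ?F x y \<partial>circ) = cis (- (of_int l * y)) * fcoeff f k y" for y
    unfolding fcoeff_def by (subst integral_mult_right_zero[symmetric]) (simp add: mult.left_commute)
  moreover have "(\<integral>y. ?F x y \<partial>circ) = cis (- (of_int k * x)) * fcoeff (swapxy f) l x" for x
    unfolding fcoeff_def by simp
  ultimately show ?thesis
    unfolding fcoeff_def[of "\<lambda>(x, _). fcoeff (swapxy f) l x"] fcoeff_def[of "\<lambda>(y, _). fcoeff f k y"] by simp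
qed

lemma mult_op_mult_op_commute:
  assumes f: "f \<in> LpB"
  shows "mult_op n a (swapxy (mult_op m b (swapxy f))) = swapxy (mult_op m b (swapxy (mult_op n a f)))"
proof
  fix z :: "real \<times> real"
  obtain x y where z: "z = (x, y)" by (cases z)
  let ?c = "\<lambda>k l. fcoeff (\<lambda>(y, _). fcoeff f k y) l 0"
  have "mult_op n a (swapxy (mult_op m b (swapxy f))) z
      = (\<Sum>k = - int n..int n. \<Sum>l = - int m..int m. a k * cis (of_int k * x) * (b l * cis (of_int l * y)) * ?c k l)"
    unfolding z mult_op_def[of n] prod.case fcoeff_sum_cis[OF f] fcoeff_fcoeff[OF f]
    by (simp add: sum_distrib_left sum_distrib_right algebra_simps)
  also have "\<dots> = (\<Sum>l = - int m..int m. \<Sum>k = - int n..int n. a k * cis (of_int k * x) * (b l * cis (of_int l * y)) * ?c k l)"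
    by (rule sum.swap)
  also have "\<dots> = swapxy (mult_op m b (swapxy (mult_op n a f))) z"
    unfolding z swapxy_apply mult_op_def[of m] prod.case
    using fcoeff_sum_cis[OF LpB_swapxy[OF f], of n a]
    by (simp add: sum_distrib_left sum_distrib_right algebra_simps)
  finally show "mult_op n a (swapxy (mult_op m b (swapxy f))) z = swapxy (mult_op m b (swapxy (mult_op n a f))) z" .
qed

lemma id_mult_op_id_mult_op_commute:
  assumes f: "f \<in> LpB"
  shows "AE z in torus. id_mult_op e n a (swapxy (id_mult_op e' m b (swapxy f))) z = swapxy (id_mult_op e' m b (swapxy (id_mult_op e n a f))) z"
proof -
  have sf: "swapxy f \<in> LpB" using f by simp
  have eq1: "swapxy (id_mult_op e' m b (swapxy f)) = (\<lambda>z. e' * f z + swapxy (mult_op m b (swapxy f)) z)"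
    by (auto simp: id_mult_op_def)
  have "AE z in torus. mult_op n a (\<lambda>z. e' * f z + swapxy (mult_op m b (swapxy f)) z) z
      = mult_op n a (\<lambda>z. e' * f z) z + mult_op n a (swapxy (mult_op m b (swapxy f))) z"
    using f by (intro mult_op_add_AE LpB_scale(1) LpB_swapxy mult_op_LpB)
  then have A: "AE z in torus. id_mult_op e n a (swapxy (id_mult_op e' m b (swapxy f))) z
      = e * (e' * f z + swapxy (mult_op m b (swapxy f)) z) + (e' * mult_op n a f z + mult_op n a (swapxy (mult_op m b (swapxy f))) z)"
    unfolding eq1 by eventually_elim (simp add: id_mult_op_def mult_op_scale)
  have eq2: "swapxy (id_mult_op e n a f) = (\<lambda>z. e * swapxy f z + swapxy (mult_op n a f) z)"
    by (auto simp: id_mult_op_def)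
  have "AE z in torus. mult_op m b (\<lambda>z. e * swapxy f z + swapxy (mult_op n a f) z) z
      = mult_op m b (\<lambda>z. e * swapxy f z) z + mult_op m b (swapxy (mult_op n a f)) z"
    using f by (intro mult_op_add_AE LpB_scale(1) LpB_swapxy mult_op_LpB)
  from AE_swapxy[OF this] have B: "AE z in torus. swapxy (id_mult_op e' m b (swapxy (id_mult_op e n a f))) z
      = e' * (e * f z + mult_op n a f z) + (e * swapxy (mult_op m b (swapxy f)) z + swapxy (mult_op m b (swapxy (mult_op n a f))) z)"
    unfolding eq2 by eventually_elim (auto simp: id_mult_op_def mult_op_scale swapxy_def)
  show ?thesis
    using A B by eventually_elim (simp add: mult_op_mult_op_commute[OF f] algebra_simps)
qed

end

section \<open>The Fejer kernel and its powers\<close>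

lemma sin_ge_quarter:
  fixes u :: real
  assumes "0 \<le> u" "u \<le> pi / 2"
  shows "u / 4 \<le> sin u"
proof (cases "u \<le> 1")
  case True
  have "(\<lambda>v. sin v - v / 2) 0 \<le> (\<lambda>v. sin v - v / 2) u"
  proof (rule DERIV_nonneg_imp_nondecreasing[OF assms(1)])
    fix v assume v: "0 \<le> v" "v \<le> u"
    have "cos (pi / 3) \<le> cos v" using v True pi_gt3 by (intro cos_monotone_0_pi_le) auto
    then have "0 \<le> cos v - 1 / 2" by (simp add: cos_60)
    moreover have "((\<lambda>v. sin v - v / 2) has_real_derivative (cos v - 1 / 2)) (at v)"
      by (auto intro!: derivative_eq_intros)
    ultimately show "\<exists>y. ((\<lambda>v. sin v - v / 2) has_real_derivative y) (at v) \<and> 0 \<le> y" by blast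
  qed
  then show ?thesis using assms by simp
next
  case False
  have "sin (pi / 6) \<le> sin u"
    using assms False pi_less_4 by (intro sin_monotone_2pi_le) auto
  then show ?thesis using assms pi_less_4 by (simp add: sin_30)
qed

text \<open>The one-sided Dirichlet kernel.\<close>

definition dirichlet :: "nat \<Rightarrow> real \<Rightarrow> complex" where
  "dirichlet m t = (\<Sum>j<m. cis (real j * t))"

text \<open>The Fejer kernel of degree \<open>m - 1\<close> in the form that exhibits its positivity.\<close>

definition fejer :: "nat \<Rightarrow> real \<Rightarrow> real" where
  "fejer m t = (norm (dirichlet m t))\<^sup>2 / real m"

lemma fejer_nonneg [simp]: "0 \<le> fejer m t"
  by (simp add: fejer_def)

lemma fejer_measurable [measurable]: "fejer m \<in> borel_measurable borel"
  unfolding fejer_def dirichlet_def by measurable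

lemma fejer_le: "0 < m \<Longrightarrow> fejer m t \<le> real m"
proof -
  assume "0 < m"
  have "norm (dirichlet m t) \<le> real m"
    unfolding dirichlet_def by (rule order_trans[OF norm_sum]) simp
  then have "(norm (dirichlet m t))\<^sup>2 \<le> (real m)\<^sup>2" by (intro power_mono) auto
  then show ?thesis using \<open>0 < m\<close> by (simp add: fejer_def field_simps power2_eq_square)
qed

lemma norm_1_minus_cis: "(norm (1 - cis t))\<^sup>2 = 4 * (sin (t / 2))\<^sup>2"
proof -
  have "(norm (1 - cis t))\<^sup>2 = (1 - cos t)\<^sup>2 + (sin t)\<^sup>2"
    by (simp add: cmod_def)
  also have "\<dots> = 2 - 2 * cos t"
    using sin_cos_squared_add[of t] by (simp add: power2_eq_square algebra_simps)
  also have "cos t = 1 - 2 * (sin (t / 2))\<^sup>2"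
    using cos_double_sin[of "t / 2"] by simp
  finally show ?thesis by simp
qed

lemma fejer_sin: "0 < m \<Longrightarrow> (sin (t / 2))\<^sup>2 * fejer m t \<le> 1 / real m"
proof -
  assume "0 < m"
  have "(1 - cis t) * dirichlet m t = 1 - cis (real m * t)"
  proof -
    have "dirichlet m t = (\<Sum>j<m. cis t ^ j)" by (simp add: dirichlet_def Complex.DeMoivre)
    then show ?thesis using one_diff_power_eq[of "cis t" m] by (simp add: Complex.DeMoivre)
  qed
  then have "norm (1 - cis t) * norm (dirichlet m t) \<le> 2"
    using norm_triangle_ineq4[of 1 "cis (real m * t)"] by (simp add: norm_mult[symmetric])
  then have "(norm (1 - cis t) * norm (dirichlet m t))\<^sup>2 \<le> 2\<^sup>2" by (intro power_mono) auto
  then have "4 * ((sin (t / 2))\<^sup>2 * (norm (dirichlet m t))\<^sup>2) \<le> 4"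
    by (simp add: power_mult_distrib norm_1_minus_cis)
  then show ?thesis using \<open>0 < m\<close> by (simp add: fejer_def field_simps)
qed

lemma fejer_lower:
  assumes "0 < m" "0 \<le> t" "t \<le> 1 / real m"
  shows "real m * (cos 1)\<^sup>2 \<le> fejer m t"
proof -
  have c1: "0 < cos (1::real)" using pi_gt3 by (intro cos_gt_zero) auto
  have "real m * cos 1 \<le> (\<Sum>j<m. cos (real j * t))"
  proof -
    have "(\<Sum>j<m. cos 1) \<le> (\<Sum>j<m. cos (real j * t))"
    proof (rule sum_mono)
      fix j assume "j \<in> {..<m}"
      then have "real j * t \<le> real m * (1 / real m)" using assms by (intro mult_mono) auto
      then show "cos 1 \<le> cos (real j * t)"
        using assms pi_gt3 by (intro cos_monotone_0_pi_le) auto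
    qed
    then show ?thesis by simp
  qed
  also have "\<dots> = Re (dirichlet m t)" by (simp add: dirichlet_def)
  also have "\<dots> \<le> norm (dirichlet m t)" by (rule complex_Re_le_cmod)
  finally have "(real m * cos 1)\<^sup>2 \<le> (norm (dirichlet m t))\<^sup>2" using c1 by (intro power_mono) auto
  then show ?thesis using assms(1) by (simp add: fejer_def field_simps power2_eq_square)
qed

lemma sum_int_symmetric:
  fixes g :: "int \<Rightarrow> 'a::comm_monoid_add"
  shows "(\<Sum>k = - int (Suc m)..int (Suc m). g k) = (\<Sum>k = - int m..int m. g k) + (g (int (Suc m)) + g (- int (Suc m)))"
proof -
  have "{- int (Suc m)..int (Suc m)} = insert (int (Suc m)) (insert (- int (Suc m)) {- int m..int m})"
    by auto
  then show ?thesis by (simp add: ac_simps)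
qed

lemma dirichlet_cnj_dirichlet:
  "dirichlet m t * cnj (dirichlet m t) = (\<Sum>k = - int m..int m. of_int (int m - \<bar>k\<bar>) * cis (of_int k * t))"
proof (induction m)
  case 0
  then show ?case by (simp add: dirichlet_def)
next
  case (Suc m)
  have dk: "(\<Sum>k = - int n..int n. cis (of_int k * t)) = 1 + (\<Sum>j<n. cis (real (Suc j) * t) + cis (- (real (Suc j) * t)))" for n
  proof (induction n)
    case (Suc n)
    show ?case unfolding sum_int_symmetric Suc.IH sum.lessThan_Suc by (simp add: add_ac del: of_nat_Suc)
  qed simp
  have c: "cis (real m * t) * cnj (dirichlet m t) = (\<Sum>j<m. cis (real (Suc j) * t))"
  proof -
    have "cis (real m * t) * cnj (dirichlet m t) = (\<Sum>j<m. cis (real (m - j) * t))"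
      unfolding dirichlet_def cnj_sum sum_distrib_left
      by (intro sum.cong refl) (simp add: cis_cnj cis_mult of_nat_diff algebra_simps)
    also have "\<dots> = (\<Sum>j<m. cis (real (Suc j) * t))"
      by (rule sum.reindex_bij_witness[where i = "\<lambda>j. m - Suc j" and j = "\<lambda>j. m - Suc j"]) auto
    finally show ?thesis .
  qed
  have c': "dirichlet m t * cnj (cis (real m * t)) = (\<Sum>j<m. cis (- (real (Suc j) * t)))"
    using arg_cong[OF c, of cnj] by (simp add: cis_cnj mult.commute)
  have "dirichlet (Suc m) t * cnj (dirichlet (Suc m) t)
      = dirichlet m t * cnj (dirichlet m t) + (cis (real m * t) * cnj (dirichlet m t) + dirichlet m t * cnj (cis (real m * t)) + 1)"
    by (simp add: dirichlet_def distrib_left distrib_right cis_cnj cis_mult add_ac)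
  also have "\<dots> = dirichlet m t * cnj (dirichlet m t) + (\<Sum>k = - int m..int m. cis (of_int k * t))"
    unfolding c c' dk by (simp add: sum.distrib add_ac)
  also have "\<dots> = (\<Sum>k = - int m..int m. of_int (int (Suc m) - \<bar>k\<bar>) * cis (of_int k * t))"
    unfolding Suc.IH sum.distrib[symmetric] by (intro sum.cong refl) (simp add: algebra_simps)
  also have "\<dots> = (\<Sum>k = - int (Suc m)..int (Suc m). of_int (int (Suc m) - \<bar>k\<bar>) * cis (of_int k * t))"
    unfolding sum_int_symmetric by simp
  finally show ?case .
qed

lemma fejer_cis:
  assumes "0 < m"
  shows "of_real (fejer m t) = (\<Sum>k = - int m..int m. of_real (1 - \<bar>of_int k\<bar> / real m) * cis (of_int k * t))"
proof -
  have "complex_of_real (fejer m t) = dirichlet m t * cnj (dirichlet m t) / of_nat m"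
    unfolding fejer_def of_real_divide complex_norm_square by simp
  also have "\<dots> = (\<Sum>k = - int m..int m. (of_int (int m - \<bar>k\<bar>) / of_nat m) * cis (of_int k * t))"
    unfolding dirichlet_cnj_dirichlet sum_divide_distrib by (intro sum.cong refl) simp
  also have "\<dots> = (\<Sum>k = - int m..int m. of_real (1 - \<bar>of_int k\<bar> / real m) * cis (of_int k * t))"
  proof (intro sum.cong refl arg_cong2[where f = "(*)"])
    fix k :: int
    have "complex_of_real \<bar>real_of_int k\<bar> = of_int \<bar>k\<bar>"
      by (metis of_int_abs of_real_of_int_eq)
    then show "of_int (int m - \<bar>k\<bar>) / of_nat m = complex_of_real (1 - \<bar>of_int k\<bar> / real m)"
      using assms by (simp add: field_simps)
  qed
  finally show ?thesis .
qed

lemma integral_trig_poly: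
  "(\<integral>t. (\<Sum>k = - int m..int m. a k * cis (of_int k * t)) \<partial>circ) = a 0"
proof -
  have int: "integrable circ (\<lambda>t. a k * cis (of_int k * t))" for k
    using integrable_cis_mult[of "\<lambda>_. a k" "of_int k"] by (simp add: mult.commute)
  have "(\<integral>t. (\<Sum>k = - int m..int m. a k * cis (of_int k * t)) \<partial>circ)
      = (\<Sum>k = - int m..int m. \<integral>t. a k * cis (of_int k * t) \<partial>circ)"
    using int by (intro Bochner_Integration.integral_sum) auto
  also have "\<dots> = (\<Sum>k = - int m..int m. if k = 0 then a k else 0)"
    unfolding integral_mult_right_zero integral_cis by (intro sum.cong) auto
  also have "\<dots> = a 0" by (subst sum.delta) auto
  finally show ?thesis .
qed

lemma integrable_circ_bounded:
  fixes g :: "real \<Rightarrow> 'a::{banach, second_countable_topology}"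
  assumes "g \<in> borel_measurable borel" "\<And>t. norm (g t) \<le> B"
  shows "integrable circ g"
  using assms by (intro circ.integrable_const_bound[where B = B]) auto

lemma integrable_fejer: "0 < m \<Longrightarrow> integrable circ (fejer m)"
  by (rule integrable_circ_bounded[where B = "real m"]) (auto simp: fejer_le)

lemma integral_fejer: "0 < m \<Longrightarrow> (\<integral>t. fejer m t \<partial>circ) = 1"
proof -
  assume m: "0 < m"
  have "complex_of_real (\<integral>t. fejer m t \<partial>circ) = (\<integral>t. of_real (fejer m t) \<partial>circ)"
    by simp
  also have "\<dots> = 1"
    unfolding fejer_cis[OF m] integral_trig_poly by simp
  finally show ?thesis using of_real_eq_1_iff by blast
qed

lemma nn_integral_fejer: "0 < m \<Longrightarrow> (\<integral>\<^sup>+t. ennreal (fejer m t) \<partial>circ) = 1"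
  using nn_integral_eq_integral[OF integrable_fejer] by (simp add: integral_fejer)

text \<open>As the complex conjugate of the Dirichlet kernel is its product with a character, a power of the
  Fejer kernel is a character times an algebraic polynomial in \<open>cis t\<close>.\<close>

lemma fejer_power_cis:
  assumes "0 < m" "Suc q * (m - 1) \<le> n"
  shows "\<exists>a. \<forall>t. of_real (fejer m t ^ Suc q) = (\<Sum>k = - int n..int n. a k * cis (of_int k * t))"
proof -
  define N where "N = Suc q * (m - 1)"
  define R :: "complex poly" where "R = (\<Sum>j<m. monom 1 j)"
  define S where "S = smult (1 / of_nat m ^ Suc q) (R ^ (2 * Suc q))"
  have R: "poly R (cis t) = dirichlet m t" for t
    by (simp add: R_def dirichlet_def poly_sum poly_monom Complex.DeMoivre)
  have "degree R \<le> m - 1"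
    unfolding R_def by (intro degree_sum_le) (auto intro: order_trans[OF degree_monom_le])
  then have "degree (R ^ (2 * Suc q)) \<le> (m - 1) * (2 * Suc q)"
    using degree_power_le[of R "2 * Suc q"] mult_le_mono1 order_trans by blast
  also have "(m - 1) * (2 * Suc q) = 2 * N" by (simp only: N_def mult_ac)
  finally have degS: "degree S \<le> 2 * N"
    unfolding S_def using degree_smult_le order_trans by blast
  have cnj: "cnj (dirichlet m t) = cis (- (real (m - 1) * t)) * dirichlet m t" for t
  proof -
    have "cis (- (real (m - 1) * t)) * dirichlet m t = (\<Sum>j<m. cis (- (real (m - 1 - j) * t)))"
      unfolding dirichlet_def sum_distrib_left
      by (intro sum.cong refl) (simp add: cis_mult of_nat_diff algebra_simps)
    also have "\<dots> = (\<Sum>j<m. cis (- (real j * t)))"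
      by (rule sum.reindex_bij_witness[where i = "\<lambda>j. m - 1 - j" and j = "\<lambda>j. m - 1 - j"]) auto
    also have "\<dots> = cnj (dirichlet m t)" by (simp add: dirichlet_def cis_cnj)
    finally show ?thesis ..
  qed
  define a where "a k = (if \<bar>k\<bar> \<le> int N then coeff S (nat (k + int N)) else 0)" for k
  have "of_real (fejer m t ^ Suc q) = (\<Sum>k = - int n..int n. a k * cis (of_int k * t))" for t
  proof -
    have "complex_of_real (fejer m t) = dirichlet m t * cnj (dirichlet m t) / of_nat m"
      unfolding fejer_def of_real_divide complex_norm_square by simp
    also have "\<dots> = cis (- (real (m - 1) * t)) * ((dirichlet m t) ^ 2 / of_nat m)"
      unfolding cnj by (simp add: power2_eq_square)
    finally have "complex_of_real (fejer m t) ^ Suc q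
        = cis (- (real (m - 1) * t)) ^ Suc q * ((dirichlet m t) ^ 2 / of_nat m) ^ Suc q"
      by (simp only: power_mult_distrib)
    also have "cis (- (real (m - 1) * t)) ^ Suc q = cis (- (real N * t))"
      unfolding Complex.DeMoivre N_def of_nat_mult by (simp only: mult_minus_right mult.assoc)
    also have "((dirichlet m t) ^ 2 / of_nat m) ^ Suc q = poly S (cis t)"
      by (simp add: S_def R power_divide power_mult[symmetric] del: power_Suc)
    also have "poly S (cis t) = (\<Sum>i\<le>2 * N. coeff S i * cis (real i * t))"
    proof -
      have "poly S (cis t) = poly (\<Sum>i\<le>2 * N. monom (coeff S i) i) (cis t)"
        by (simp only: poly_as_sum_of_monoms'[OF degS])
      then show ?thesis by (simp add: poly_sum poly_monom Complex.DeMoivre)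
    qed
    also have "cis (- (real N * t)) * (\<Sum>i\<le>2 * N. coeff S i * cis (real i * t))
        = (\<Sum>i\<le>2 * N. coeff S i * cis (of_int (int i - int N) * t))"
      unfolding sum_distrib_left
    proof (intro sum.cong refl)
      fix i
      have "cis (- (real N * t)) * cis (real i * t) = cis (of_int (int i - int N) * t)"
        by (simp add: cis_mult algebra_simps)
      then show "cis (- (real N * t)) * (coeff S i * cis (real i * t)) = coeff S i * cis (of_int (int i - int N) * t)"
        by (simp only: mult.left_commute)
    qed
    also have "\<dots> = (\<Sum>k = - int N..int N. coeff S (nat (k + int N)) * cis (of_int k * t))"
      by (rule sum.reindex_bij_witness[where i = "\<lambda>k. nat (k + int N)" and j = "\<lambda>i. int i - int N"]) auto
    also have "\<dots> = (\<Sum>k = - int n..int n. a k * cis (of_int k * t))"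
    proof -
      have "N \<le> n" using assms(2) by (simp only: N_def)
      then show ?thesis by (intro sum.mono_neutral_cong_left) (auto simp: a_def)
    qed
    finally show ?thesis by simp
  qed
  then show ?thesis by blast
qed

lemma integral_fejer_power_lower:
  assumes "0 < m"
  shows "(cos 1) ^ (2 * Suc q) / (2 * pi) * real m ^ q \<le> (\<integral>t. fejer m t ^ Suc q \<partial>circ)"
proof -
  have c1: "0 < cos (1::real)" using pi_gt3 by (intro cos_gt_zero) auto
  define A where "A = {0..1 / real m}"
  have A: "A \<in> sets borel" by (simp add: A_def)
  have "1 / real m \<le> 1" using assms by simp
  then have sub: "A \<inter> {0..<2 * pi} = A" using pi_gt3 by (auto simp: A_def)
  have "emeasure circ A = (\<integral>\<^sup>+t. indicator A t \<partial>circ)" using A by simp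
  also have "\<dots> = ennreal (1 / (2 * pi)) * (\<integral>\<^sup>+t. indicator A t * indicator {0..<2 * pi} t \<partial>lborel)"
    using A by (intro nn_integral_circ) auto
  also have "(\<lambda>t::real. indicator A t * indicator {0..<2 * pi} t :: ennreal) = indicator A"
    using sub by (simp add: indicator_inter_arith[symmetric])
  also have "(\<integral>\<^sup>+t. indicator A t \<partial>lborel) = ennreal (1 / real m)" by (simp add: A_def)
  finally have mA: "measure circ A = 1 / (2 * pi) * (1 / real m)"
    unfolding measure_def by (simp add: enn2real_mult)
  have "(cos 1) ^ (2 * Suc q) / (2 * pi) * real m ^ q = (real m * (cos 1)\<^sup>2) ^ Suc q * measure circ A"
  proof -
    have "(real m * (cos 1)\<^sup>2) ^ Suc q = (cos 1) ^ (2 * Suc q) * real m ^ q * real m"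
      unfolding power_mult_distrib power_mult by (simp add: mult_ac)
    then show ?thesis unfolding mA using assms by simp
  qed
  also have "\<dots> = (\<integral>t. (real m * (cos 1)\<^sup>2) ^ Suc q * indicator A t \<partial>circ)"
    using A by simp
  also have "\<dots> \<le> (\<integral>t. fejer m t ^ Suc q \<partial>circ)"
  proof (rule integral_mono)
    show "integrable circ (\<lambda>t. (real m * (cos 1)\<^sup>2) ^ Suc q * indicator A t)"
      using A by (intro integrable_mult_right integrable_real_indicator) (auto simp: circ.emeasure_finite less_top[symmetric])
    show "integrable circ (\<lambda>t. fejer m t ^ Suc q)"
      using assms by (intro integrable_circ_bounded[where B = "real m ^ Suc q"])
        (auto simp del: power_Suc intro!: power_mono fejer_le)
    show "(real m * (cos 1)\<^sup>2) ^ Suc q * indicator A t \<le> fejer m t ^ Suc q" for t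
      using assms fejer_lower[OF assms, of t]
      by (cases "t \<in> A") (auto simp: A_def simp del: power_Suc intro!: power_mono)
  qed
  finally show ?thesis .
qed

text \<open>In the moments of the kernel \<open>fejer m t ^ Suc q\<close> the factor \<open>(sin (t / 2))\<^sup>2 * fejer m t \<le> 1 / m\<close> is used
  \<open>q\<close> times, which leaves one Fejer kernel, of mean one.\<close>

lemma fejer_moment:
  assumes "0 < m"
  shows "fejer m t ^ Suc q * (real m ^ 2 * (sin (t / 2))\<^sup>2) ^ q \<le> real m ^ q * fejer m t"
proof -
  have "((sin (t / 2))\<^sup>2 * fejer m t) ^ q \<le> (1 / real m) ^ q"
    using fejer_sin[OF assms] by (intro power_mono) auto
  then have "fejer m t * (real m ^ 2) ^ q * ((sin (t / 2))\<^sup>2 * fejer m t) ^ q \<le> fejer m t * (real m ^ 2) ^ q * (1 / real m) ^ q"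
    by (intro mult_left_mono) auto
  also have "\<dots> = real m ^ q * fejer m t"
  proof -
    have "(real m ^ 2) ^ q * (1 / real m) ^ q = real m ^ q"
      using assms by (simp add: power_mult_distrib[symmetric] power2_eq_square)
    then show ?thesis by (simp add: mult.assoc)
  qed
  finally show ?thesis by (simp add: power_mult_distrib algebra_simps)
qed

lemma fejer_power_le:
  assumes "0 < m"
  shows "fejer m t ^ Suc q \<le> real m ^ q * fejer m t"
  using mult_right_mono[OF power_mono[OF fejer_le[OF assms, of t] fejer_nonneg, of q] fejer_nonneg[of m t]]
  by (simp add: mult.commute)

section \<open>Jackson's inequality in one variable\<close>

context torus_Lp
begin

text \<open>The bound for the operator norm of a fractional difference of order \<open>\<alpha>\<close>.\<close>

abbreviation dcoeff_norm :: "real \<Rightarrow> real" where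
  "dcoeff_norm \<alpha> \<equiv> (\<Sum>n. \<bar>dcoeff \<alpha> n\<bar>)"

lemma dcoeff_norm_ge_1: "0 < \<alpha> \<Longrightarrow> 1 \<le> dcoeff_norm \<alpha>"
  using sum_le_suminf[OF summable_abs_dcoeff, of \<alpha> "{0}"] by simp

text \<open>Doubling the step: \<open>(1 - \<tau>\<^sub>h\<^sup>2)\<^sup>\<alpha> = (1 + \<tau>\<^sub>h)\<^sup>\<alpha> (1 - \<tau>\<^sub>h)\<^sup>\<alpha>\<close>, and the coefficients of \<open>(1 + z)\<^sup>\<alpha>\<close> have the
  absolute values of those of \<open>(1 - z)\<^sup>\<alpha>\<close>.\<close>

lemma trans_sum_dcoeff_double:
  assumes \<alpha>: "0 < \<alpha>" and f: "f \<in> LpB"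
  shows "nrm (trans_sum (dcoeff \<alpha>) (2 * h) f) \<le> dcoeff_norm \<alpha> * nrm (trans_sum (dcoeff \<alpha>) h f)"
proof -
  have a: "\<bar>\<alpha> gchoose n\<bar> = \<bar>dcoeff \<alpha> n\<bar>" for n by (simp add: dcoeff_def abs_mult power_abs)
  have s: "summable (\<lambda>n. \<bar>\<alpha> gchoose n\<bar>)" unfolding a by (rule summable_abs_dcoeff[OF \<alpha>])
  have c: "trans_sum (dcoeff \<alpha>) (2 * h) f z = trans_sum (\<lambda>n. \<Sum>i\<le>n. (\<alpha> gchoose i) * dcoeff \<alpha> (n - i)) h f z" for z
  proof -
    let ?g = "\<lambda>n. of_real (if even n then dcoeff \<alpha> (n div 2) else 0) * shiftx (- (real n * h)) f z"
    have "(\<Sum>n. ?g (2 * n)) = (\<Sum>n. ?g n)"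
      by (rule suminf_mono_reindex) (auto intro!: strict_monoI simp: image_iff elim!: evenE)
    then show ?thesis
      unfolding trans_sum_def gchoose_dcoeff_convolution by (simp add: mult.assoc mult.left_commute)
  qed
  have "nrm (trans_sum (dcoeff \<alpha>) (2 * h) f) = nrm (trans_sum (\<lambda>n. \<alpha> gchoose n) h (trans_sum (dcoeff \<alpha>) h f))"
    by (rule nrm_cong, use trans_sum_trans_sum[OF s summable_abs_dcoeff[OF \<alpha>] f, of h] in eventually_elim) (simp add: c)
  also have "\<dots> \<le> (\<Sum>n. \<bar>\<alpha> gchoose n\<bar>) * nrm (trans_sum (dcoeff \<alpha>) h f)"
    by (intro trans_sum_nrm s trans_sum_LpB summable_abs_dcoeff \<alpha> f)
  finally show ?thesis unfolding a .
qed

lemma trans_sum_dcoeff_double_iter: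
  assumes \<alpha>: "0 < \<alpha>" and f: "f \<in> LpB"
  shows "nrm (trans_sum (dcoeff \<alpha>) (2 ^ i * h) f) \<le> dcoeff_norm \<alpha> ^ i * nrm (trans_sum (dcoeff \<alpha>) h f)"
proof (induction i)
  case (Suc i)
  have "nrm (trans_sum (dcoeff \<alpha>) (2 ^ Suc i * h) f) \<le> dcoeff_norm \<alpha> * nrm (trans_sum (dcoeff \<alpha>) (2 ^ i * h) f)"
    using trans_sum_dcoeff_double[OF \<alpha> f, of "2 ^ i * h"] by (simp add: mult.assoc)
  also have "\<dots> \<le> dcoeff_norm \<alpha> * (dcoeff_norm \<alpha> ^ i * nrm (trans_sum (dcoeff \<alpha>) h f))"
    using dcoeff_norm_ge_1[OF \<alpha>] by (intro mult_left_mono Suc.IH) auto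
  finally show ?case by (simp add: mult.assoc)
qed simp

lemma trans_sum_periodic:
  assumes "f \<in> LpB"
  shows "trans_sum c (h + 2 * pi * of_int k) f = trans_sum c h f"
proof -
  have "shiftx (- (real n * (h + 2 * pi * of_int k))) f z = shiftx (- (real n * h)) f z" for n z
  proof (cases z)
    case (Pair x y)
    have "f ((x - real n * h) + 2 * pi * of_int (- (int n * k)), y) = f (x - real n * h, y)"
      by (rule periodic_int) (rule LpB_per1[OF assms])
    then show ?thesis unfolding Pair by (simp add: algebra_simps)
  qed
  then show ?thesis unfolding trans_sum_def by simp
qed

text \<open>The norm of a difference with an arbitrary step \<open>t\<close>, given a bound for steps up to \<open>\<pi> / (n + 1)\<close>. The
  growth in \<open>t\<close> is expressed by the \<open>2\<pi>\<close>-periodic quantity \<open>(sin (t / 2))\<^sup>2\<close>.\<close>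

lemma trans_sum_dcoeff_growth:
  assumes \<alpha>: "0 < \<alpha>" and q: "dcoeff_norm \<alpha> powr p \<le> 4 ^ q" and f: "f \<in> LpB"
    and b: "\<And>s. \<bar>s\<bar> \<le> pi / real (n + 1) \<Longrightarrow> nrm (trans_sum (dcoeff \<alpha>) s f) \<le> b"
  shows "nrm (trans_sum (dcoeff \<alpha>) t f) powr p \<le> (1 + (256 * (real (n + 1))\<^sup>2 * (sin (t / 2))\<^sup>2) ^ q) * b powr p"
proof -
  \<comment> \<open>Reduce the step modulo \<open>2\<pi>\<close> to \<open>[-\<pi>, \<pi>]\<close>.\<close>
  define t' where "t' = wrap (t + pi) - pi"
  define j where "j = \<lfloor>(t + pi) / (2 * pi)\<rfloor>"
  have t: "t = t' + 2 * pi * of_int j" by (simp add: t'_def wrap_def j_def)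
  have t': "- pi \<le> t'" "t' \<le> pi" using wrap_mem[of "t + pi"] by (auto simp: t'_def)
  have b0: "0 \<le> b" using order_trans[OF nrm_nonneg b[of 0]] by simp
  define \<delta> where "\<delta> = pi / real (n + 1)"
  have \<delta>: "0 < \<delta>" by (simp add: \<delta>_def)
  have sin2: "(sin (t / 2))\<^sup>2 = (sin (\<bar>t'\<bar> / 2))\<^sup>2"
  proof -
    have h: "t / 2 = t' / 2 + pi * of_int j" by (simp add: t algebra_simps add_divide_distrib)
    have "sin (t / 2) = sin (t' / 2) * cos (of_int j * pi)"
      unfolding h by (simp add: sin_add mult.commute)
    moreover have "(cos (of_int j * pi))\<^sup>2 = (1::real)"
    proof -
      have "sin (of_int j * pi) = (0::real)" by (auto simp: sin_zero_iff_int2)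
      then show ?thesis using sin_cos_squared_add[of "of_int j * pi"] by simp
    qed
    ultimately show ?thesis by (simp add: power_mult_distrib abs_if)
  qed
  have low: "t'\<^sup>2 / 64 \<le> (sin (t / 2))\<^sup>2"
  proof -
    have "\<bar>t'\<bar> / 2 / 4 \<le> sin (\<bar>t'\<bar> / 2)" using t' by (intro sin_ge_quarter) auto
    then have "(\<bar>t'\<bar> / 8)\<^sup>2 \<le> (sin (\<bar>t'\<bar> / 2))\<^sup>2" by (intro power_mono) auto
    then show ?thesis unfolding sin2 by (simp add: power_divide)
  qed
  have eq: "trans_sum (dcoeff \<alpha>) t f = trans_sum (dcoeff \<alpha>) t' f" unfolding t by (rule trans_sum_periodic[OF f])
  show ?thesis
  proof (cases "\<bar>t'\<bar> \<le> \<delta>")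
    case True
    then have "nrm (trans_sum (dcoeff \<alpha>) t' f) powr p \<le> b powr p"
      using p_gt_1 by (intro powr_mono2 b) (auto simp: \<delta>_def)
    also have "\<dots> \<le> (1 + (256 * (real (n + 1))\<^sup>2 * (sin (t / 2))\<^sup>2) ^ q) * b powr p"
      by (simp add: distrib_right)
    finally show ?thesis unfolding eq .
  next
    case False
    have "\<exists>i. \<bar>t'\<bar> / \<delta> \<le> 2 ^ i"
      using real_arch_pow[of 2 "\<bar>t'\<bar> / \<delta>"] by (auto intro: less_imp_le)
    \<comment> \<open>Halve the step \<open>i\<close> times, until it is at most \<open>\<delta>\<close>.\<close>
    define i where "i = (LEAST i. \<bar>t'\<bar> / \<delta> \<le> 2 ^ i)"
    have i: "\<bar>t'\<bar> / \<delta> \<le> 2 ^ i" unfolding i_def by (rule LeastI_ex) fact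
    have "i \<noteq> 0"
    proof
      assume "i = 0"
      then show False using i False \<delta> by simp
    qed
    then obtain k where k: "i = Suc k" by (cases i) auto
    have "\<not> \<bar>t'\<bar> / \<delta> \<le> 2 ^ k" using not_less_Least[of k "\<lambda>i. \<bar>t'\<bar> / \<delta> \<le> 2 ^ i"] by (simp add: i_def[symmetric] k)
    then have "(2 ^ k)\<^sup>2 \<le> (\<bar>t'\<bar> / \<delta>)\<^sup>2" by (intro power_mono) auto
    also have "\<dots> = t'\<^sup>2 * (real (n + 1))\<^sup>2 / pi\<^sup>2" by (simp add: \<delta>_def power_divide power_mult_distrib)
    also have "\<dots> \<le> t'\<^sup>2 * (real (n + 1))\<^sup>2 / 1"
      using pi_gt3 by (intro divide_left_mono) (auto intro: one_le_power)
    also have "\<dots> \<le> 64 * (sin (t / 2))\<^sup>2 * (real (n + 1))\<^sup>2"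
      using mult_right_mono[OF low, of "64 * (real (n + 1))\<^sup>2"] by (simp add: mult_ac)
    finally have "4 * (2 ^ k)\<^sup>2 \<le> 256 * (real (n + 1))\<^sup>2 * (sin (t / 2))\<^sup>2" by (simp add: mult_ac)
    moreover have "(4::real) * (2 ^ k)\<^sup>2 = 4 ^ i"
      by (simp add: k power_mult[symmetric] mult.commute[of _ 2] power_mult)
    ultimately have i4: "4 ^ i \<le> 256 * (real (n + 1))\<^sup>2 * (sin (t / 2))\<^sup>2" by simp
    have "nrm (trans_sum (dcoeff \<alpha>) t' f) \<le> dcoeff_norm \<alpha> ^ i * nrm (trans_sum (dcoeff \<alpha>) (t' / 2 ^ i) f)"
      using trans_sum_dcoeff_double_iter[OF \<alpha> f, of i "t' / 2 ^ i"] by simp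
    also have "\<dots> \<le> dcoeff_norm \<alpha> ^ i * b"
    proof (intro mult_left_mono b)
      show "\<bar>t' / 2 ^ i\<bar> \<le> pi / real (n + 1)"
        using i \<delta> unfolding \<delta>_def[symmetric] by (simp add: abs_divide field_simps)
      show "0 \<le> dcoeff_norm \<alpha> ^ i" using dcoeff_norm_ge_1[OF \<alpha>] by simp
    qed
    finally have "nrm (trans_sum (dcoeff \<alpha>) t' f) powr p \<le> (dcoeff_norm \<alpha> ^ i * b) powr p"
      using p_gt_1 by (intro powr_mono2) auto
    also have "\<dots> = (dcoeff_norm \<alpha> powr p) ^ i * b powr p"
      using dcoeff_norm_ge_1[OF \<alpha>] b0 by (simp add: powr_mult powr_power powr_powr powr_realpow[symmetric] mult.commute)
    also have "\<dots> \<le> (4 ^ q) ^ i * b powr p"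
      using q by (intro mult_right_mono power_mono) auto
    also have "(4 ^ q :: real) ^ i = (4 ^ i) ^ q" by (simp add: power_mult[symmetric] mult.commute)
    also have "(4 ^ i) ^ q * b powr p \<le> (256 * (real (n + 1))\<^sup>2 * (sin (t / 2))\<^sup>2) ^ q * b powr p"
      using i4 by (intro mult_right_mono power_mono) auto
    also have "\<dots> \<le> (1 + (256 * (real (n + 1))\<^sup>2 * (sin (t / 2))\<^sup>2) ^ q) * b powr p"
      by (simp add: distrib_right)
    finally show ?thesis unfolding eq .
  qed
qed

text \<open>Averaging the differences of \<open>f\<close> against a trigonometric polynomial \<open>w\<close> of degree at most \<open>n\<close> and of mean
  one: the term \<open>\<nu> = 0\<close> gives \<open>f\<close>, and the other terms only see the frequencies \<open>k\<close> with \<open>\<bar>\<nu> k\<bar> \<le> n\<close>.\<close>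

lemma average_differences:
  assumes \<alpha>: "0 < \<alpha>" and f: "f \<in> LpB" and int: "integrable circ (\<lambda>t. f (t, y))"
    and w [measurable]: "w \<in> borel_measurable borel" and wB: "\<And>t. norm (w t) \<le> B"
    and wc: "\<And>t. w t = (\<Sum>k = - int n..int n. a k * cis (of_int k * t))" and a0: "a 0 = 1"
  shows "(\<integral>t. w t * trans_sum (dcoeff \<alpha>) t f (x, y) \<partial>circ)
    = id_mult_op 1 n (\<lambda>k. \<Sum>\<nu>. of_real (dcoeff \<alpha> (Suc \<nu>)) * (if \<bar>int (Suc \<nu>) * k\<bar> \<le> int n then a (int (Suc \<nu>) * k) else 0)) f (x, y)"
proof -
  define \<phi> where "\<phi> t = f (t, y)" for t
  have [measurable]: "\<phi> \<in> borel_measurable borel" unfolding \<phi>_def using f by measurable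
  have per: "\<phi> (t + 2 * pi) = \<phi> t" for t using LpB_per1[OF f] by (simp add: \<phi>_def)
  have int\<phi>: "integrable circ \<phi>" using int unfolding \<phi>_def .
  define I where "I = (\<integral>t. norm (\<phi> t) \<partial>circ)"
  have I0: "0 \<le> I" by (simp add: I_def)
  have B0: "0 \<le> B" using wB[of 0] norm_ge_zero order_trans by blast
  define g where "g \<nu> t = w t * (of_real (dcoeff \<alpha> \<nu>) * \<phi> (x - real \<nu> * t))" for \<nu> t
  have int1: "integrable circ (\<lambda>t. \<phi> (x - real \<nu> * t))" for \<nu>
  proof (cases "\<nu> = 0")
    case False
    then show ?thesis
      using integrable_circ_affine[of \<phi> "- real \<nu>" x] int\<phi> per by auto
  qed simp
  have In: "(\<integral>t. norm (\<phi> (x - real \<nu> * t)) \<partial>circ) \<le> I + norm (\<phi> x)" for \<nu>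
  proof (cases "\<nu> = 0")
    case True
    then show ?thesis using I0 circ.prob_space by simp
  next
    case False
    have "complex_of_real (\<integral>t. norm (\<phi> (x - real \<nu> * t)) \<partial>circ)
        = (\<integral>t. (\<lambda>s. complex_of_real (norm (\<phi> s))) (x + (- real \<nu>) * t) \<partial>circ)"
      by simp
    also have "\<dots> = (\<integral>s. complex_of_real (norm (\<phi> s)) \<partial>circ)"
      using False by (intro integral_circ_affine) (auto simp: per)
    also have "\<dots> = complex_of_real I" by (simp add: I_def)
    finally show ?thesis by (simp only: of_real_eq_iff) simp
  qed
  have intg: "integrable circ (g \<nu>)" for \<nu>
  proof (rule Bochner_Integration.integrable_bound)
    show "integrable circ (\<lambda>t. of_real (B * \<bar>dcoeff \<alpha> \<nu>\<bar>) * \<phi> (x - real \<nu> * t))"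
      by (intro integrable_mult_right int1)
    show "AE t in circ. norm (g \<nu> t) \<le> norm (of_real (B * \<bar>dcoeff \<alpha> \<nu>\<bar>) * \<phi> (x - real \<nu> * t))"
      using wB B0 by (intro AE_I2) (auto simp: g_def norm_mult mult.assoc intro!: mult_right_mono)
    show "g \<nu> \<in> borel_measurable circ" unfolding g_def by measurable
  qed
  have summ: "summable (\<lambda>\<nu>. \<integral>t. norm (g \<nu> t) \<partial>circ)"
  proof (rule summable_comparison_test')
    show "summable (\<lambda>\<nu>. \<bar>dcoeff \<alpha> \<nu>\<bar> * (B * (I + norm (\<phi> x))))"
      by (intro summable_mult2 summable_abs_dcoeff \<alpha>)
    fix \<nu>
    have "(\<integral>t. norm (g \<nu> t) \<partial>circ) \<le> (\<integral>t. (B * \<bar>dcoeff \<alpha> \<nu>\<bar>) * norm (\<phi> (x - real \<nu> * t)) \<partial>circ)"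
    proof (rule integral_mono)
      show "integrable circ (\<lambda>t. norm (g \<nu> t))" using intg by (rule integrable_norm)
      show "integrable circ (\<lambda>t. (B * \<bar>dcoeff \<alpha> \<nu>\<bar>) * norm (\<phi> (x - real \<nu> * t)))"
        by (intro integrable_mult_right integrable_norm int1)
      show "norm (g \<nu> t) \<le> (B * \<bar>dcoeff \<alpha> \<nu>\<bar>) * norm (\<phi> (x - real \<nu> * t))" for t
        using wB by (auto simp: g_def norm_mult mult.assoc intro!: mult_right_mono)
    qed
    also have "\<dots> = (B * \<bar>dcoeff \<alpha> \<nu>\<bar>) * (\<integral>t. norm (\<phi> (x - real \<nu> * t)) \<partial>circ)" by simp
    also have "\<dots> \<le> (B * \<bar>dcoeff \<alpha> \<nu>\<bar>) * (I + norm (\<phi> x))"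
      using B0 by (intro mult_left_mono In) auto
    finally show "norm (\<integral>t. norm (g \<nu> t) \<partial>circ) \<le> \<bar>dcoeff \<alpha> \<nu>\<bar> * (B * (I + norm (\<phi> x)))"
      by (simp add: mult_ac)
  qed
  define A where "A \<nu> k = (if \<bar>int \<nu> * k\<bar> \<le> int n then a (int \<nu> * k) else 0)" for \<nu> k
  define S where "S = Max ((\<lambda>k. norm (a k)) ` {- int n..int n})"
  have aS: "norm (a k) \<le> S" if "\<bar>k\<bar> \<le> int n" for k
    unfolding S_def using that by (intro Max_ge) (auto simp: abs_le_iff)
  have S0: "0 \<le> S" using aS[of 0] norm_ge_zero order_trans by (metis abs_zero of_nat_0_le_iff)
  have AS: "norm (A \<nu> k) \<le> S" for \<nu> k using aS S0 by (simp add: A_def)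
  have summA: "summable (\<lambda>\<nu>. of_real (dcoeff \<alpha> (Suc \<nu>)) * A (Suc \<nu>) k)" for k
  proof (rule summable_comparison_test')
    show "summable (\<lambda>\<nu>. \<bar>dcoeff \<alpha> (Suc \<nu>)\<bar> * S)"
      using summable_abs_dcoeff[OF \<alpha>] by (intro summable_mult2) (simp add: summable_Suc_iff[of "\<lambda>\<nu>. \<bar>dcoeff \<alpha> \<nu>\<bar>"])
    show "norm (of_real (dcoeff \<alpha> (Suc \<nu>)) * A (Suc \<nu>) k) \<le> \<bar>dcoeff \<alpha> (Suc \<nu>)\<bar> * S" for \<nu>
      using AS by (auto simp: norm_mult intro!: mult_left_mono)
  qed
  have g0: "(\<integral>t. g 0 t \<partial>circ) = f (x, y)"
  proof -
    have "(\<integral>t. g 0 t \<partial>circ) = (\<integral>t. w t * f (x, y) \<partial>circ)"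
      by (simp add: g_def \<phi>_def)
    also have "\<dots> = (\<integral>t. w t \<partial>circ) * f (x, y)" by (rule integral_mult_left_zero)
    also have "(\<integral>t. w t \<partial>circ) = 1" unfolding wc integral_trig_poly by (rule a0)
    finally show ?thesis by simp
  qed
  have gS: "(\<integral>t. g (Suc \<nu>) t \<partial>circ) = of_real (dcoeff \<alpha> (Suc \<nu>)) * mult_op n (A (Suc \<nu>)) f (x, y)" for \<nu>
  proof -
    have "(\<integral>t. g (Suc \<nu>) t \<partial>circ)
        = of_real (dcoeff \<alpha> (Suc \<nu>)) * (\<integral>t. w t * f (x - real (Suc \<nu>) * t, y) \<partial>circ)"
      by (subst integral_mult_right_zero[symmetric], intro Bochner_Integration.integral_cong refl)
         (simp add: g_def \<phi>_def mult.left_commute)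
    also have "(\<integral>t. w t * f (x - real (Suc \<nu>) * t, y) \<partial>circ) = mult_op n (A (Suc \<nu>)) f (x, y)"
      unfolding wc A_def by (rule convolution_mult_op[OF f int]) simp
    finally show ?thesis .
  qed
  have "(\<integral>t. w t * trans_sum (dcoeff \<alpha>) t f (x, y) \<partial>circ) = (\<integral>t. (\<Sum>\<nu>. g \<nu> t) \<partial>circ)"
  proof (rule integral_cong_AE)
    show "(\<lambda>t. \<Sum>\<nu>. g \<nu> t) \<in> borel_measurable circ" unfolding g_def by measurable
    show "(\<lambda>t. w t * trans_sum (dcoeff \<alpha>) t f (x, y)) \<in> borel_measurable circ"
    proof -
      have "(\<lambda>t. w t * trans_sum (dcoeff \<alpha>) t f (x, y)) = (\<lambda>t. w t * (\<Sum>\<nu>. of_real (dcoeff \<alpha> \<nu>) * \<phi> (x - real \<nu> * t)))"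
        by (simp add: trans_sum_def \<phi>_def)
      then show ?thesis by simp
    qed
    show "AE t in circ. w t * trans_sum (dcoeff \<alpha>) t f (x, y) = (\<Sum>\<nu>. g \<nu> t)"
      using AE_summable_of_abs[OF intg summ]
    proof eventually_elim
      case (elim t)
      have summable: "summable (\<lambda>\<nu>. g \<nu> t)" using elim by (rule summable_norm_cancel)
      show ?case
      proof (cases "w t = 0")
        case False
        then have "summable (\<lambda>\<nu>. of_real (dcoeff \<alpha> \<nu>) * \<phi> (x - real \<nu> * t))"
          using summable unfolding g_def by (subst (asm) summable_cmult_iff) simp
        from suminf_mult[OF this, of "w t"] show ?thesis
          by (simp add: trans_sum_def g_def \<phi>_def)
      qed (simp add: g_def)
    qed
  qed
  also have "\<dots> = (\<Sum>\<nu>. \<integral>t. g \<nu> t \<partial>circ)" by (rule integral_suminf_of_abs[OF intg summ])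
  also have "\<dots> = (\<Sum>\<nu>. \<integral>t. g (Suc \<nu>) t \<partial>circ) + (\<integral>t. g 0 t \<partial>circ)"
  proof (subst suminf_split_head)
    show "summable (\<lambda>\<nu>. \<integral>t. g \<nu> t \<partial>circ)"
      by (rule summable_comparison_test'[OF summ]) (rule integral_norm_bound)
  qed simp
  also have "(\<Sum>\<nu>. \<integral>t. g (Suc \<nu>) t \<partial>circ)
      = (\<Sum>\<nu>. \<Sum>k = - int n..int n. (of_real (dcoeff \<alpha> (Suc \<nu>)) * A (Suc \<nu>) k) * (fcoeff f k y * cis (of_int k * x)))"
    unfolding gS by (simp add: mult_op_def sum_distrib_left mult.assoc)
  also have "\<dots> = (\<Sum>k = - int n..int n. \<Sum>\<nu>. (of_real (dcoeff \<alpha> (Suc \<nu>)) * A (Suc \<nu>) k) * (fcoeff f k y * cis (of_int k * x)))"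
    by (intro suminf_sum summable_mult2 summA)
  also have "\<dots> = mult_op n (\<lambda>k. \<Sum>\<nu>. of_real (dcoeff \<alpha> (Suc \<nu>)) * A (Suc \<nu>) k) f (x, y)"
    unfolding mult_op_def prod.case mult.assoc
    by (intro sum.cong refl) (simp only: suminf_mult2[OF summA] mult.assoc)
  finally show ?thesis
    unfolding g0 by (simp add: id_mult_op_def A_def)
qed

text \<open>The operators \<open>id_mult_op 1 n a\<close> are of the form \<open>1 - V\<close> with \<open>V f\<close> a trigonometric polynomial of degree at
  most \<open>n\<close>; they depend only on \<open>\<alpha>\<close>, \<open>n\<close> and \<open>p\<close>.\<close>

lemma jackson_one_variable:
  assumes \<alpha>: "0 < \<alpha>"
  shows "\<exists>C>0. \<forall>n. \<exists>a. \<forall>f\<in>LpB. \<forall>b.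
    (\<forall>s. \<bar>s\<bar> \<le> pi / real (n + 1) \<longrightarrow> nrm (trans_sum (dcoeff \<alpha>) s f) \<le> b) \<longrightarrow> nrm (id_mult_op 1 n a f) \<le> C * b"
proof -
  \<comment> \<open>The exponent of the kernel is adapted to the constant in the doubling of the step.\<close>
  obtain q where q: "dcoeff_norm \<alpha> powr p \<le> 4 ^ q"
    using real_arch_pow[of 4 "dcoeff_norm \<alpha> powr p"] by (auto intro: less_imp_le)
  define c where "c = (cos (1::real)) ^ (2 * Suc q) / (2 * pi)"
  have c: "0 < c" using cos_gt_zero[of 1] pi_gt3 by (simp add: c_def)
  define L where "L = (1 + (256 * (real (Suc q))\<^sup>2) ^ q) / c"
  have L: "0 < L" using c by (simp add: L_def add_pos_nonneg)
  show ?thesis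
  proof (intro exI[of _ "L powr (1 / p)"] conjI allI)
    show "0 < L powr (1 / p)" using L by simp
    fix n
    \<comment> \<open>The largest \<open>m\<close> for which the power \<open>q + 1\<close> of the kernel has degree at most \<open>n\<close>.\<close>
    define m where "m = n div Suc q + 1"
    have m: "0 < m" "Suc q * (m - 1) \<le> n" "n + 1 \<le> Suc q * m"
    proof -
      define d r where "d = n div Suc q" and "r = n mod Suc q"
      have "r \<le> q" by (simp add: r_def less_Suc_eq_le[symmetric])
      moreover have "n = d * Suc q + r"
        unfolding r_def d_def by (rule div_mult_mod_eq[symmetric])
      ultimately show "0 < m" "Suc q * (m - 1) \<le> n" "n + 1 \<le> Suc q * m"
        unfolding m_def d_def[symmetric] by (simp_all add: algebra_simps)
    qed
    define J where "J = (\<integral>t. fejer m t ^ Suc q \<partial>circ)"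
    have J: "c * real m ^ q \<le> J" unfolding J_def c_def by (rule integral_fejer_power_lower[OF m(1)])
    have "0 < c * real m ^ q" using c m(1) by simp
    then have J0: "0 < J" using J by linarith
    define w where "w t = fejer m t ^ Suc q / J" for t
    have [measurable]: "w \<in> borel_measurable borel" unfolding w_def by measurable
    have w0: "0 \<le> w t" for t using J0 by (simp add: w_def)
    obtain a' where a': "\<And>t. of_real (fejer m t ^ Suc q) = (\<Sum>k = - int n..int n. a' k * cis (of_int k * t))"
      using fejer_power_cis[OF m(1,2)] by blast
    define a where "a k = a' k / of_real J" for k
    have wc: "of_real (w t) = (\<Sum>k = - int n..int n. a k * cis (of_int k * t))" for t
      unfolding w_def of_real_divide a' a_def sum_divide_distrib by simp
    have int_w: "integrable circ w"
      using fejer_le[OF m(1)] J0 unfolding w_def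
      by (intro integrable_circ_bounded[where B = "real m ^ Suc q / J"])
         (auto simp del: power_Suc intro!: divide_right_mono power_mono)
    have I_w: "(\<integral>t. w t \<partial>circ) = 1" using J0 by (simp add: w_def J_def[symmetric] del: power_Suc)
    have a0: "a 0 = 1"
    proof -
      have "a 0 = (\<integral>t. of_real (w t) \<partial>circ)" unfolding wc integral_trig_poly ..
      also have "\<dots> = of_real (\<integral>t. w t \<partial>circ)" by simp
      finally show ?thesis by (simp add: I_w)
    qed
    define M where "M = density circ (\<lambda>t. ennreal (w t))"
    have M: "prob_space M"
      unfolding M_def using nn_integral_eq_integral[OF int_w] w0 I_w
      by (intro prob_spaceI) (simp add: emeasure_density)
    define A where "A k = (\<Sum>\<nu>. complex_of_real (dcoeff \<alpha> (Suc \<nu>)) * (if \<bar>int (Suc \<nu>) * k\<bar> \<le> int n then a (int (Suc \<nu>) * k) else 0))" for k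
    show "\<exists>a. \<forall>f\<in>LpB. \<forall>b. (\<forall>s. \<bar>s\<bar> \<le> pi / real (n + 1) \<longrightarrow> nrm (trans_sum (dcoeff \<alpha>) s f) \<le> b)
        \<longrightarrow> nrm (id_mult_op 1 n a f) \<le> L powr (1 / p) * b"
    proof (intro exI[of _ A] ballI allI impI)
      fix f b assume f: "f \<in> LpB" and "\<forall>s. \<bar>s\<bar> \<le> pi / real (n + 1) \<longrightarrow> nrm (trans_sum (dcoeff \<alpha>) s f) \<le> b"
      then have b: "\<And>s. \<bar>s\<bar> \<le> pi / real (n + 1) \<Longrightarrow> nrm (trans_sum (dcoeff \<alpha>) s f) \<le> b" by blast
      have b0: "0 \<le> b" using order_trans[OF nrm_nonneg b[of 0]] by simp
      define W where "W t = (1 + (256 * (real (n + 1))\<^sup>2 * (sin (t / 2))\<^sup>2) ^ q) * b powr p" for t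
      have W0: "0 \<le> W t" for t by (simp add: W_def)
      have Wm [measurable]: "W \<in> borel_measurable borel" unfolding W_def by measurable
      have [measurable]: "f \<in> borel_measurable (borel \<Otimes>\<^sub>M borel)" using f by (simp add: borel_prod LpB_meas)
      have "(\<lambda>(t, z). trans_sum (dcoeff \<alpha>) t f z) \<in> borel_measurable (borel \<Otimes>\<^sub>M (borel \<Otimes>\<^sub>M borel))"
        unfolding trans_sum_def shiftx_def split_beta by measurable
      also have "borel_measurable (borel \<Otimes>\<^sub>M (borel \<Otimes>\<^sub>M borel)) = borel_measurable (M \<Otimes>\<^sub>M torus)"
        by (intro measurable_cong_sets sets_pair_measure_cong) (simp_all add: M_def borel_prod)
      finally have jm: "(\<lambda>(t, z). trans_sum (dcoeff \<alpha>) t f z) \<in> borel_measurable (M \<Otimes>\<^sub>M torus)" .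
      \<comment> \<open>Use \<open>n + 1 \<le> (q + 1) m\<close> and the moments of the kernel.\<close>
      have wW: "w t * W t \<le> L * b powr p * fejer m t" for t
      proof -
        have "(real (n + 1))\<^sup>2 \<le> (real (Suc q) * real m)\<^sup>2"
          using m(3) by (intro power_mono) (simp_all only: of_nat_mult[symmetric] of_nat_le_iff of_nat_0_le_iff)
        then have "(256 * (real (n + 1))\<^sup>2 * (sin (t / 2))\<^sup>2) ^ q
            \<le> (256 * (real (Suc q) * real m)\<^sup>2 * (sin (t / 2))\<^sup>2) ^ q"
          by (intro power_mono mult_right_mono mult_left_mono) auto
        also have "\<dots> = (256 * (real (Suc q))\<^sup>2) ^ q * (real m ^ 2 * (sin (t / 2))\<^sup>2) ^ q"
          by (simp add: power_mult_distrib mult_ac del: of_nat_Suc)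
        finally have 1: "fejer m t ^ Suc q * (256 * (real (n + 1))\<^sup>2 * (sin (t / 2))\<^sup>2) ^ q
            \<le> fejer m t ^ Suc q * ((256 * (real (Suc q))\<^sup>2) ^ q * (real m ^ 2 * (sin (t / 2))\<^sup>2) ^ q)"
          by (intro mult_left_mono) auto
        have "fejer m t ^ Suc q * (1 + (256 * (real (n + 1))\<^sup>2 * (sin (t / 2))\<^sup>2) ^ q)
            = fejer m t ^ Suc q + fejer m t ^ Suc q * (256 * (real (n + 1))\<^sup>2 * (sin (t / 2))\<^sup>2) ^ q"
          by (simp only: distrib_left mult_1_right)
        also have "\<dots> \<le> fejer m t ^ Suc q + (256 * (real (Suc q))\<^sup>2) ^ q * (fejer m t ^ Suc q * (real m ^ 2 * (sin (t / 2))\<^sup>2) ^ q)"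
          using 1 by (simp only: mult.left_commute add_left_mono)
        also have "\<dots> \<le> real m ^ q * fejer m t + (256 * (real (Suc q))\<^sup>2) ^ q * (real m ^ q * fejer m t)"
          using fejer_power_le[OF m(1), of t q] fejer_moment[OF m(1), of t q]
          by (intro add_mono mult_left_mono) auto
        also have "\<dots> = (L * c) * (real m ^ q * fejer m t)"
        proof -
          have "L * c = 1 + (256 * (real (Suc q))\<^sup>2) ^ q" using c by (simp add: L_def)
          then show ?thesis by (simp only: distrib_right mult_1_left)
        qed
        also have "\<dots> = (L * fejer m t) * (c * real m ^ q)"
          by (simp only: mult_ac)
        also have "\<dots> \<le> (L * fejer m t) * J"
          using J L by (intro mult_left_mono) auto
        finally have "fejer m t ^ Suc q * (1 + (256 * (real (n + 1))\<^sup>2 * (sin (t / 2))\<^sup>2) ^ q) / J \<le> L * fejer m t"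
          using J0 by (simp only: pos_divide_le_eq)
        from mult_right_mono[OF this, of "b powr p"] show ?thesis
          unfolding w_def W_def by (simp add: mult_ac)
      qed
      have "pint (\<lambda>z. \<integral>t. trans_sum (dcoeff \<alpha>) t f z \<partial>M) \<le> ennreal (L * b powr p)"
      proof (rule LpB_integral(2)[OF M jm])
        fix t
        have "trans_sum (dcoeff \<alpha>) t f \<in> LpB" by (intro trans_sum_LpB summable_abs_dcoeff \<alpha> f)
        then show "pint (trans_sum (dcoeff \<alpha>) t f) \<le> ennreal (W t)"
          using trans_sum_dcoeff_growth[OF \<alpha> q f, where n = n and b = b and t = t] b unfolding W_def by (simp add: pint_eq ennreal_leI)
      next
        have "(\<integral>\<^sup>+t. ennreal (W t) \<partial>M) = (\<integral>\<^sup>+t. ennreal (w t * W t) \<partial>circ)"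
          unfolding M_def using w0 W0 by (subst nn_integral_density) (auto simp: ennreal_mult)
        also have "\<dots> \<le> (\<integral>\<^sup>+t. ennreal (L * b powr p) * ennreal (fejer m t) \<partial>circ)"
          using wW L by (intro nn_integral_mono) (auto simp: ennreal_mult[symmetric] intro!: ennreal_leI)
        also have "\<dots> = ennreal (L * b powr p)"
          by (subst nn_integral_cmult) (auto simp: nn_integral_fejer[OF m(1)])
        finally show "(\<integral>\<^sup>+t. ennreal (W t) \<partial>M) \<le> ennreal (L * b powr p)" .
      qed
      moreover have "pint (id_mult_op 1 n A f) \<le> pint (\<lambda>z. \<integral>t. trans_sum (dcoeff \<alpha>) t f z \<partial>M)"
      proof (rule pint_mono, use AE_section[OF f] in eventually_elim)
        case (elim z)
        obtain x y where z: "z = (x, y)" by (cases z)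
        have mt: "(\<lambda>t. trans_sum (dcoeff \<alpha>) t f z) \<in> borel_measurable borel"
          unfolding z trans_sum_def shiftx_def prod.case by measurable
        have "(\<integral>t. trans_sum (dcoeff \<alpha>) t f z \<partial>M) = (\<integral>t. of_real (w t) * trans_sum (dcoeff \<alpha>) t f (x, y) \<partial>circ)"
          unfolding M_def using w0 mt
          by (subst integral_density) (auto simp: scaleR_conv_of_real z)
        also have "\<dots> = id_mult_op 1 n A f (x, y)"
          unfolding A_def
        proof (rule average_differences[OF \<alpha> f _ _ _ wc a0])
          show "integrable circ (\<lambda>t. f (t, y))" using elim by (simp add: z)
          show "norm (complex_of_real (w t)) \<le> real m ^ Suc q / J" for t
          proof -
            have "norm (complex_of_real (w t)) = w t" using w0[of t] by simp
            also have "\<dots> \<le> real m ^ Suc q / J"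
              unfolding w_def using fejer_le[OF m(1), of t] J0
              by (intro divide_right_mono power_mono) auto
            finally show ?thesis .
          qed
        qed simp
        finally show ?case by (simp add: z)
      qed
      ultimately have "pint (id_mult_op 1 n A f) \<le> ennreal (L * b powr p)" by (rule order_trans[rotated])
      also have "L * b powr p = (L powr (1 / p) * b) powr p"
        using L b0 p_gt_1 by (simp add: powr_mult powr_powr)
      finally show "nrm (id_mult_op 1 n A f) \<le> L powr (1 / p) * b"
        using L b0 by (intro nrm_le) auto
    qed
  qed
qed

end

section \<open>De la Vallee Poussin means\<close>

text \<open>The multiplier of the de la Vallee Poussin mean: it is one on \<open>[-N, N]\<close> and decreases linearly to zero
  at \<open>\<plusminus>2N\<close>. For \<open>N = 0\<close> the mean is the mean value.\<close>

definition vp_coeff :: "nat \<Rightarrow> int \<Rightarrow> complex" where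
  "vp_coeff N k = (if \<bar>k\<bar> \<le> int N then 1 else if \<bar>k\<bar> \<le> 2 * int N then of_real (2 - \<bar>of_int k\<bar> / real N) else 0)"

text \<open>The degrees \<open>0, 1, 2, 4, 8, \<dots>\<close>.\<close>

definition dyad :: "nat \<Rightarrow> nat" where
  "dyad j = (if j = 0 then 0 else 2 ^ (j - 1))"

text \<open>The dyadic blocks of the decomposition of the identity with \<open>J + 1\<close> scales: differences of consecutive
  de la Vallee Poussin means for \<open>j \<le> J\<close>, and the remainder for larger \<open>j\<close>.\<close>

definition dblock :: "nat \<Rightarrow> nat \<Rightarrow> (real \<times> real \<Rightarrow> complex) \<Rightarrow> real \<times> real \<Rightarrow> complex" where
  "dblock J j = (if j \<le> J then id_mult_op 0 (2 * 2 ^ j) (\<lambda>k. vp_coeff (2 ^ j) k - vp_coeff (dyad j) k)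
     else id_mult_op 1 (2 * 2 ^ J) (\<lambda>k. - vp_coeff (2 ^ J) k))"

lemma mult_op_extend:
  assumes "n \<le> m" "\<And>k. \<bar>k\<bar> > int n \<Longrightarrow> a k = 0"
  shows "mult_op m a f = mult_op n a f"
proof
  fix z :: "real \<times> real"
  show "mult_op m a f z = mult_op n a f z"
    unfolding mult_op_def split_beta using assms
    by (intro sum.mono_neutral_right) auto
qed

lemma mult_op_cong: "(\<And>k. \<bar>k\<bar> \<le> int n \<Longrightarrow> a k = b k) \<Longrightarrow> mult_op n a f = mult_op n b f"
  by (auto simp: mult_op_def fun_eq_iff intro!: sum.cong)

lemma mult_op_diff: "mult_op n (\<lambda>k. a k - b k) f z = mult_op n a f z - mult_op n b f z"
  by (auto simp: mult_op_def split_beta sum_subtractf left_diff_distrib)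

lemma mult_op_minus: "mult_op n (\<lambda>k. - a k) f z = - mult_op n a f z"
  by (auto simp: mult_op_def split_beta sum_negf)

lemma mult_op_coeff_scale: "mult_op n (\<lambda>k. c * a k) f z = c * mult_op n a f z"
  by (auto simp: mult_op_def split_beta sum_distrib_left mult.assoc)

text \<open>The de la Vallee Poussin mean in the first variable. It reproduces the trigonometric polynomials of
  degree at most \<open>N\<close> and has degree less than \<open>2N\<close> for \<open>N > 0\<close>.\<close>

abbreviation vp :: "nat \<Rightarrow> (real \<times> real \<Rightarrow> complex) \<Rightarrow> real \<times> real \<Rightarrow> complex" where
  "vp N \<equiv> mult_op (2 * N) (vp_coeff N)"

text \<open>The Fejer mean; the end points of the sum carry the coefficient zero.\<close>

definition fejer_mean :: "nat \<Rightarrow> (real \<times> real \<Rightarrow> complex) \<Rightarrow> real \<times> real \<Rightarrow> complex" where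
  "fejer_mean m = mult_op m (\<lambda>k. of_real (1 - \<bar>of_int k\<bar> / real m))"

lemma vp_fejer:
  assumes "0 < N"
  shows "vp N f z = 2 * fejer_mean (2 * N) f z - fejer_mean N f z"
proof -
  define b where "b k = (if \<bar>k\<bar> \<le> int N then complex_of_real (1 - \<bar>of_int k\<bar> / real N) else 0)" for k
  have "fejer_mean N f = mult_op N b f" unfolding fejer_mean_def by (rule mult_op_cong) (simp add: b_def)
  also have "\<dots> = mult_op (2 * N) b f" by (rule mult_op_extend[symmetric]) (auto simp: b_def)
  finally have 1: "fejer_mean N f = mult_op (2 * N) b f" .
  have "vp N f = mult_op (2 * N) (\<lambda>k. 2 * of_real (1 - \<bar>of_int k\<bar> / real (2 * N)) - b k) f"
  proof (rule mult_op_cong)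
    fix k assume k: "\<bar>k\<bar> \<le> int (2 * N)"
    have "complex_of_real (if \<bar>k\<bar> \<le> int N then 1 else 2 - \<bar>of_int k\<bar> / real N)
        = of_real (2 * (1 - \<bar>of_int k\<bar> / real (2 * N)) - (if \<bar>k\<bar> \<le> int N then 1 - \<bar>of_int k\<bar> / real N else 0))"
      using assms by (intro arg_cong[where f = complex_of_real]) (simp add: field_simps)
    then show "vp_coeff N k = 2 * of_real (1 - \<bar>of_int k\<bar> / real (2 * N)) - b k"
      using k by (simp add: vp_coeff_def b_def split: if_splits)
  qed
  then show ?thesis unfolding 1 fejer_mean_def[of "2 * N"] by (simp only: mult_op_diff mult_op_coeff_scale)
qed

lemma vp_0: "vp 0 f = fejer_mean 1 f"
proof -
  have "vp 0 f = mult_op 1 (vp_coeff 0) f" unfolding mult_0_right by (rule mult_op_extend[symmetric]) (auto simp: vp_coeff_def)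
  also have "\<dots> = fejer_mean 1 f"
    unfolding fejer_mean_def
  proof (rule mult_op_cong)
    fix k assume "\<bar>k\<bar> \<le> int 1"
    then have "k = 0 \<or> k = 1 \<or> k = - 1" by auto
    then show "vp_coeff 0 k = of_real (1 - \<bar>of_int k\<bar> / real 1)" by (auto simp: vp_coeff_def)
  qed
  finally show ?thesis .
qed

lemma vp_0_const: "vp 0 f (x, y) = fcoeff f 0 y"
  by (simp add: mult_op_def vp_coeff_def)

lemma dyad_Suc [simp]: "dyad (Suc j) = 2 ^ j"
  by (simp add: dyad_def)

lemma dyad_0 [simp]: "dyad 0 = 0"
  by (simp add: dyad_def)

lemma dyad_le: "dyad j \<le> 2 ^ j"
  by (cases j) auto

lemma dblock_eq:
  "dblock J j f z = (if j \<le> J then vp (dyad (Suc j)) f z - vp (dyad j) f z else f z - vp (2 ^ J) f z)"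
proof -
  have "mult_op (2 * 2 ^ j) (vp_coeff (dyad j)) f = vp (dyad j) f"
    using dyad_le[of j] by (intro mult_op_extend) (auto simp: vp_coeff_def)
  then show ?thesis by (simp add: dblock_def id_mult_op_def mult_op_diff mult_op_minus)
qed

lemma dblock_telescope: "f z = vp 0 f z + (\<Sum>j\<le>Suc J. dblock J j f z)"
proof -
  have "(\<Sum>j\<le>J. dblock J j f z) = (\<Sum>j<Suc J. vp (dyad (Suc j)) f z - vp (dyad j) f z)"
    by (intro sum.cong) (auto simp: dblock_eq)
  also have "\<dots> = vp (2 ^ J) f z - vp 0 f z"
    by (subst sum_lessThan_telescope) simp
  finally show ?thesis by (simp add: dblock_eq)
qed

lemma vp_trig_poly:
  assumes "trig_poly1 m T" "m \<le> N"
  shows "vp N T z = T z"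
proof (cases z)
  case (Pair x y)
  have "vp N T (x, y) = (\<Sum>k = - int m..int m. fcoeff T k y * cis (of_int k * x))"
    unfolding mult_op_trig_poly[OF assms(1)]
    using assms(2) by (intro sum.cong) (auto simp: vp_coeff_def)
  then show ?thesis unfolding Pair trig_poly1_fcoeff(1)[OF assms(1), of x y] .
qed

lemma dblock_trig_poly:
  assumes T: "trig_poly1 m T" and "j \<le> Suc J" "m \<le> dyad j"
  shows "dblock J j T z = 0"
proof (cases "j \<le> J")
  case True
  have "dyad j \<le> dyad (Suc j)" using dyad_le by simp
  then show ?thesis using True vp_trig_poly[OF T, of "dyad (Suc j)" z] vp_trig_poly[OF T, of "dyad j" z] assms(3)
    by (simp add: dblock_eq)
next
  case False
  with assms(2) have "j = Suc J" by simp
  then show ?thesis using vp_trig_poly[OF T, of "2 ^ J" z] assms(3) by (simp add: dblock_eq)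
qed

lemma trig_poly1_dblock: "j \<le> J \<Longrightarrow> trig_poly1 (2 * 2 ^ j) (dblock J j f)"
  using trig_poly1_mult_op[of "2 * 2 ^ j" "\<lambda>k. vp_coeff (2 ^ j) k - vp_coeff (dyad j) k" f]
  by (simp add: dblock_def id_mult_op_def)

context torus_Lp
begin

lemma nrm_fejer_mean:
  assumes m: "0 < m" and f: "f \<in> LpB"
  shows "nrm (fejer_mean m f) \<le> nrm f"
proof -
  let ?a = "\<lambda>k. complex_of_real (1 - \<bar>of_int k\<bar> / real m)"
  have "AE z in torus. fejer_mean m f z = (\<integral>t. of_real (fejer m t) * (1 * f (fst z - t, snd z)) \<partial>circ)"
    using AE_section[OF f]
  proof eventually_elim
    case (elim z)
    have "(\<integral>t. (\<Sum>k = - int m..int m. ?a k * cis (of_int k * t)) * f (fst z - real 1 * t, snd z) \<partial>circ)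
        = mult_op m (\<lambda>k. if \<bar>int 1 * k\<bar> \<le> int m then ?a (int 1 * k) else 0) f (fst z, snd z)"
      by (rule convolution_mult_op[OF f elim]) simp
    also have "\<dots> = fejer_mean m f z" unfolding fejer_mean_def by (subst mult_op_cong[where b = ?a]) auto
    finally show ?case by (simp add: fejer_cis[OF m])
  qed
  then show ?thesis
    by (intro convolution_bound(2)[OF f, where u = "\<lambda>_. 1" and w = "fejer m"])
       (use f m in \<open>auto simp: nn_integral_fejer fejer_mean_def mult_op_per intro: mult_op_measurable\<close>)
qed

lemma fejer_mean_LpB: "f \<in> LpB \<Longrightarrow> fejer_mean m f \<in> LpB"
  unfolding fejer_mean_def by (rule mult_op_LpB)

lemma nrm_vp:
  assumes f: "f \<in> LpB"
  shows "nrm (vp N f) \<le> 3 * nrm f"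
proof (cases "N = 0")
  case True
  have "nrm (vp N f) \<le> nrm f" unfolding True vp_0 by (rule nrm_fejer_mean[OF _ f]) simp
  then show ?thesis using nrm_nonneg[of f] by linarith
next
  case False
  then have "vp N f = (\<lambda>z. 2 * fejer_mean (2 * N) f z - fejer_mean N f z)" by (auto simp: vp_fejer)
  then have "nrm (vp N f) \<le> nrm (\<lambda>z. 2 * fejer_mean (2 * N) f z) + nrm (fejer_mean N f)"
    using LpB_diff(2)[OF LpB_scale(1)[OF fejer_mean_LpB[OF f]] fejer_mean_LpB[OF f]] by simp
  also have "\<dots> \<le> 2 * nrm f + nrm f"
    using False f by (intro add_mono) (auto simp: LpB_scale(2)[OF fejer_mean_LpB[OF f]] nrm_fejer_mean)
  finally show ?thesis by simp
qed

lemma dblock_LpB: "f \<in> LpB \<Longrightarrow> dblock J j f \<in> LpB"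
  unfolding dblock_def by (auto intro: id_mult_op_LpB)

lemma nrm_dblock:
  assumes f: "f \<in> LpB"
  shows "nrm (dblock J j f) \<le> 6 * nrm f"
proof (cases "j \<le> J")
  case True
  then have "dblock J j f = (\<lambda>z. vp (dyad (Suc j)) f z - vp (dyad j) f z)" by (auto simp: dblock_eq)
  then have "nrm (dblock J j f) \<le> nrm (vp (dyad (Suc j)) f) + nrm (vp (dyad j) f)"
    using LpB_diff(2)[OF mult_op_LpB[OF f] mult_op_LpB[OF f]] by simp
  then show ?thesis using nrm_vp[OF f, of "dyad (Suc j)"] nrm_vp[OF f, of "dyad j"] by linarith
next
  case False
  then have "dblock J j f = (\<lambda>z. f z - vp (2 ^ J) f z)" by (auto simp: dblock_eq)
  then have "nrm (dblock J j f) \<le> nrm f + nrm (vp (2 ^ J) f)"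
    using LpB_diff(2)[OF f mult_op_LpB[OF f]] by simp
  then show ?thesis using nrm_vp[OF f, of "2 ^ J"] nrm_nonneg[of f] by linarith
qed

end

section \<open>Bernstein's inequality for fractional differences\<close>

lemma fcoeff_mod: "fcoeff (\<lambda>z. cis (of_int l * fst z) * g z) k y = fcoeff g (k - l) y"
  unfolding fcoeff_def
proof (intro Bochner_Integration.integral_cong refl)
  fix t
  have "cis (- (of_int k * t)) * cis (of_int l * t) = cis (- (of_int (k - l) * t))"
    by (simp add: cis_mult algebra_simps)
  then show "cis (- (of_int k * t)) * (cis (of_int l * fst (t, y)) * g (t, y)) = cis (- (of_int (k - l) * t)) * g (t, y)"
    by (simp only: fst_conv mult.assoc[symmetric])
qed

lemma one_minus_exp_lower: "0 \<le> x \<Longrightarrow> min 1 x / 2 \<le> 1 - exp (- x)" for x :: real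
proof -
  assume x: "0 \<le> x"
  define u where "u = min 1 x"
  have u: "0 \<le> u" "u \<le> 1" "u \<le> x" using x by (auto simp: u_def)
  have "exp (- x) \<le> exp (- u)" using u by simp
  also have "\<dots> \<le> 1 / (1 + u)"
    using exp_ge_add_one_self[of u] u(1) by (simp add: exp_minus inverse_eq_divide frac_le)
  also have "\<dots> \<le> 1 - u / 2"
  proof -
    have "u * u \<le> u" using u by (simp add: mult_left_le)
    then have "1 \<le> (1 - u / 2) * (1 + u)" by (simp add: algebra_simps)
    then show ?thesis using u(1) by (simp add: pos_divide_le_eq)
  qed
  finally show ?thesis by (simp add: u_def)
qed

lemma exp_minus_1_bound: "0 \<le> u \<Longrightarrow> u \<le> 2 \<Longrightarrow> exp u - 1 \<le> 9 * u" for u :: real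
proof -
  assume u: "0 \<le> u" "u \<le> 2"
  have "(1 - u) * exp u \<le> exp (- u) * exp u"
    using exp_ge_add_one_self[of "- u"] by (intro mult_right_mono) auto
  then have 1: "exp u - 1 \<le> u * exp u" by (simp add: exp_add[symmetric] algebra_simps)
  have "exp u \<le> exp 2" using u by simp
  also have "exp (2::real) = exp 1 * exp 1" by (simp add: exp_add[symmetric])
  also have "\<dots> \<le> 3 * 3" using exp_le by (intro mult_mono) auto
  finally have "u * exp u \<le> u * 9" using u by (intro mult_left_mono) auto
  with 1 show ?thesis by simp
qed

lemma trig_poly1_trans_sum:
  assumes c: "summable (\<lambda>n. \<bar>c n\<bar>)" and g: "trig_poly1 N g"
  shows "trig_poly1 N (trans_sum c h g)"
  unfolding trig_poly1_cis
proof (intro exI allI)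
  fix x y
  have summ: "summable (\<lambda>n. of_real (c n) * cis (- (real n * (of_int k * h))))" for k :: int
    by (rule summable_norm_cancel) (use c in \<open>simp add: norm_mult\<close>)
  have "trans_sum c h g (x, y) = (\<Sum>n. \<Sum>k = - int N..int N. (of_real (c n) * cis (- (real n * (of_int k * h)))) * (fcoeff g k y * cis (of_int k * x)))"
    unfolding trans_sum_def shiftx_apply trig_poly1_fcoeff(1)[OF g] sum_distrib_left
    by (intro suminf_cong sum.cong refl) (simp add: cis_mult algebra_simps)
  also have "\<dots> = (\<Sum>k = - int N..int N. \<Sum>n. (of_real (c n) * cis (- (real n * (of_int k * h)))) * (fcoeff g k y * cis (of_int k * x)))"
    by (intro suminf_sum summable_mult2 summ)
  also have "\<dots> = (\<Sum>k = - int N..int N. ((\<Sum>n. of_real (c n) * cis (- (real n * (of_int k * h)))) * fcoeff g k y) * cis (of_int k * x))"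
  proof (intro sum.cong refl)
    fix k :: int
    show "(\<Sum>n. (of_real (c n) * cis (- (real n * (of_int k * h)))) * (fcoeff g k y * cis (of_int k * x)))
        = ((\<Sum>n. of_real (c n) * cis (- (real n * (of_int k * h)))) * fcoeff g k y) * cis (of_int k * x)"
      using suminf_mult2[OF summ[of k], of "fcoeff g k y * cis (of_int k * x)"] by (simp only: mult.assoc)
  qed
  finally show "trans_sum c h g (x, y) = (\<Sum>k = - int N..int N. ((\<Sum>n. of_real (c n) * cis (- (real n * (of_int k * h)))) * fcoeff g k y) * cis (of_int k * x))" .
qed

context torus_Lp
begin

lemma LpB_mod:
  assumes g: "g \<in> LpB"
  shows "(\<lambda>z. cis (of_int l * fst z) * g z) \<in> LpB" and "nrm (\<lambda>z. cis (of_int l * fst z) * g z) = nrm g"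
proof -
  have eq: "pint (\<lambda>z. cis (of_int l * fst z) * g z) = pint g"
    unfolding pint_def by (simp add: norm_mult)
  then show "nrm (\<lambda>z. cis (of_int l * fst z) * g z) = nrm g" by (simp add: nrm_def)
  have [measurable]: "g \<in> borel_measurable (borel \<Otimes>\<^sub>M borel)" using g by (simp add: borel_prod LpB_meas)
  have "(\<lambda>z. cis (of_int l * fst z) * g z) \<in> borel_measurable (borel \<Otimes>\<^sub>M borel)" by measurable
  then show "(\<lambda>z. cis (of_int l * fst z) * g z) \<in> LpB"
    using g cis_2pi_int[of l] by (auto simp: LpB_def eq borel_prod)
qed

text \<open>Up to the factor \<open>\<i>\<close>, \<open>mult_op N of_int\<close> is differentiation on the polynomials of degree at most \<open>N\<close>.
  For \<open>\<bar>l\<bar> \<le> N\<close> the multiplier \<open>l\<close> is \<open>N\<close> times the difference of two translates, by \<open>N\<close> and \<open>-N\<close>, of the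
  triangular multiplier of the Fejer mean; translating a multiplier amounts to conjugation with a
  character and keeps the norm.\<close>

lemma bernstein:
  assumes g: "g \<in> LpB" "trig_poly1 N g" and N: "0 < N"
  shows "nrm (mult_op N of_int g) \<le> 2 * real N * nrm g"
proof -
  define u where "u s = (\<lambda>z. cis (of_int (- s * int N) * fst z) * g z)" for s :: int
  have u: "u s \<in> LpB" "nrm (u s) = nrm g" for s unfolding u_def using g(1) by (rule LpB_mod)+
  define v where "v s = (\<lambda>z. cis (of_int (s * int N) * fst z) * fejer_mean N (u s) z)" for s :: int
  have v: "v s \<in> LpB" "nrm (v s) \<le> nrm g" for s
    using LpB_mod[OF fejer_mean_LpB[OF u(1)], of "s * int N"] nrm_fejer_mean[OF N u(1)] by (simp_all add: v_def u(2))
  have vs: "v s (x, y) = (\<Sum>l = - int N..int N. of_real (max 0 (of_int (s * l)) / real N) * fcoeff g l y * cis (of_int l * x))"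
    if s: "s = 1 \<or> s = - 1" for s x y
  proof -
    have fcoeff: "fcoeff (u s) k y = fcoeff g (k + s * int N) y" for k
      unfolding u_def fcoeff_mod by simp
    have "v s (x, y) = (\<Sum>k = - int N..int N. of_real (1 - \<bar>of_int k\<bar> / real N) * fcoeff g (k + s * int N) y * cis (of_int (k + s * int N) * x))"
      unfolding v_def fejer_mean_def mult_op_def prod.case fcoeff sum_distrib_left fst_conv
    proof (intro sum.cong refl)
      fix k
      have e: "cis (of_int (k + s * int N) * x) = cis (of_int (s * int N) * x) * cis (of_int k * x)"
        by (simp add: cis_mult algebra_simps)
      show "cis (of_int (s * int N) * x) * (of_real (1 - \<bar>of_int k\<bar> / real N) * fcoeff g (k + s * int N) y * cis (of_int k * x))
          = of_real (1 - \<bar>of_int k\<bar> / real N) * fcoeff g (k + s * int N) y * cis (of_int (k + s * int N) * x)"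
        unfolding e by (simp only: mult_ac)
    qed
    also have "\<dots> = (\<Sum>l\<in>{s * int N - int N..s * int N + int N}. of_real (1 - \<bar>of_int (l - s * int N)\<bar> / real N) * fcoeff g l y * cis (of_int l * x))"
      by (rule sum.reindex_bij_witness[where i = "\<lambda>l. l - s * int N" and j = "\<lambda>k. k + s * int N"]) auto
    also have "\<dots> = (\<Sum>l\<in>{- 2 * int N..2 * int N}. of_real (max 0 (1 - \<bar>of_int (l - s * int N)\<bar> / real N)) * fcoeff g l y * cis (of_int l * x))"
    proof (rule sum.mono_neutral_cong_left)
      show "{s * int N - int N..s * int N + int N} \<subseteq> {- 2 * int N..2 * int N}" using s by auto
      have *: "real_of_int (l - s * int N) = of_int l - of_int s * real N" for l by simp
      show "\<forall>l\<in>{- 2 * int N..2 * int N} - {s * int N - int N..s * int N + int N}.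
          of_real (max 0 (1 - \<bar>of_int (l - s * int N)\<bar> / real N)) * fcoeff g l y * cis (of_int l * x) = 0"
      proof
        fix l assume "l \<in> {- 2 * int N..2 * int N} - {s * int N - int N..s * int N + int N}"
        then have "int N \<le> \<bar>l - s * int N\<bar>" by auto
        then have "real N \<le> \<bar>of_int (l - s * int N)\<bar>" by linarith
        then have "max 0 (1 - \<bar>of_int (l - s * int N)\<bar> / real N) = (0::real)" using N by (simp add: field_simps)
        then show "of_real (max 0 (1 - \<bar>of_int (l - s * int N)\<bar> / real N)) * fcoeff g l y * cis (of_int l * x) = 0"
          by simp
      qed
      fix l assume "l \<in> {s * int N - int N..s * int N + int N}"
      then have "\<bar>l - s * int N\<bar> \<le> int N" by auto
      then have "\<bar>of_int (l - s * int N)\<bar> \<le> real N" by linarith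
      then have "max 0 (1 - \<bar>of_int (l - s * int N)\<bar> / real N) = 1 - \<bar>of_int (l - s * int N)\<bar> / real N"
        using N by (simp add: field_simps)
      then show "of_real (1 - \<bar>of_int (l - s * int N)\<bar> / real N) * fcoeff g l y * cis (of_int l * x)
          = of_real (max 0 (1 - \<bar>of_int (l - s * int N)\<bar> / real N)) * fcoeff g l y * cis (of_int l * x)"
        by simp
    qed simp
    also have "\<dots> = (\<Sum>l = - int N..int N. of_real (max 0 (of_int (s * l)) / real N) * fcoeff g l y * cis (of_int l * x))"
    proof (rule sum.mono_neutral_cong_right)
      show "\<forall>l\<in>{- 2 * int N..2 * int N} - {- int N..int N}.
          of_real (max 0 (1 - \<bar>of_int (l - s * int N)\<bar> / real N)) * fcoeff g l y * cis (of_int l * x) = 0"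
        using trig_poly1_fcoeff(2)[OF g(2)] by auto
      fix l assume l: "l \<in> {- int N..int N}"
      then have l': "\<bar>of_int l\<bar> \<le> real N" by (auto simp: abs_le_iff)
      have "max 0 (1 - \<bar>of_int (l - s * int N)\<bar> / real N) = max 0 (of_int (s * l)) / real N"
        using s N l' by (auto simp: max_def field_simps abs_if)
      then show "of_real (max 0 (1 - \<bar>of_int (l - s * int N)\<bar> / real N)) * fcoeff g l y * cis (of_int l * x)
          = of_real (max 0 (of_int (s * l)) / real N) * fcoeff g l y * cis (of_int l * x)"
        by simp
    qed auto
    finally show ?thesis .
  qed
  have "mult_op N of_int g = (\<lambda>z. of_nat N * (v 1 z - v (- 1) z))"
  proof
    fix z :: "real \<times> real"
    obtain x y where z: "z = (x, y)" by (cases z)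
    have c: "of_nat N * (complex_of_real (max 0 (of_int (1 * l)) / real N) - of_real (max 0 (of_int (- 1 * l)) / real N)) = of_int l" for l
      using N by (auto simp: max_def)
    have "of_nat N * (v 1 z - v (- 1) z) = (\<Sum>l = - int N..int N.
        (of_nat N * (of_real (max 0 (of_int (1 * l)) / real N) - of_real (max 0 (of_int (- 1 * l)) / real N))) * fcoeff g l y * cis (of_int l * x))"
    proof -
      have d: "n * (a * F * E - b * F * E) = n * (a - b) * F * E" for n a b F E :: complex
        by (simp add: algebra_simps)
      have "v 1 (x, y) = (\<Sum>l = - int N..int N. of_real (max 0 (of_int (1 * l)) / real N) * fcoeff g l y * cis (of_int l * x))"
        "v (- 1) (x, y) = (\<Sum>l = - int N..int N. of_real (max 0 (of_int (- 1 * l)) / real N) * fcoeff g l y * cis (of_int l * x))"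
        by (rule vs, simp)+
      then show ?thesis
        unfolding z by (simp only: sum_subtractf[symmetric] sum_distrib_left d)
    qed
    then show "mult_op N of_int g z = of_nat N * (v 1 z - v (- 1) z)"
      unfolding c by (simp add: z mult_op_def)
  qed
  then have "nrm (mult_op N of_int g) = real N * nrm (\<lambda>z. v 1 z - v (- 1) z)"
    by (simp add: LpB_scale(2)[OF LpB_diff(1)[OF v(1) v(1)]])
  also have "\<dots> \<le> real N * (nrm g + nrm g)"
    using LpB_diff(2)[OF v(1)[of 1] v(1)[of "- 1"]] v(2)[of 1] v(2)[of "- 1"]
    by (intro mult_left_mono) auto
  finally show ?thesis by simp
qed

lemma bernstein_power:
  assumes g: "g \<in> LpB" "trig_poly1 N g" and N: "0 < N"
  shows "nrm (mult_op N (\<lambda>k. of_int k ^ m) g) \<le> (2 * real N) ^ m * nrm g"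
proof (induction m)
  case 0
  have "mult_op N (\<lambda>k. of_int k ^ 0) g = g"
  proof
    fix z :: "real \<times> real"
    show "mult_op N (\<lambda>k. of_int k ^ 0) g z = g z"
      by (cases z) (simp add: mult_op_def trig_poly1_fcoeff(1)[OF g(2)])
  qed
  then show ?case by simp
next
  case (Suc m)
  have "mult_op N (\<lambda>k. of_int k ^ Suc m) g = mult_op N of_int (mult_op N (\<lambda>k. of_int k ^ m) g)"
    unfolding mult_op_def[of N of_int] fcoeff_mult_op by (auto simp: mult_op_def fun_eq_iff intro!: sum.cong)
  then have "nrm (mult_op N (\<lambda>k. of_int k ^ Suc m) g) \<le> 2 * real N * nrm (mult_op N (\<lambda>k. of_int k ^ m) g)"
    using bernstein[OF mult_op_LpB[OF g(1)] trig_poly1_mult_op N] by simp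
  also have "\<dots> \<le> 2 * real N * ((2 * real N) ^ m * nrm g)"
    by (intro mult_left_mono Suc.IH) auto
  finally show ?case by (simp add: mult.assoc)
qed

text \<open>For small \<open>N \<bar>h\<bar>\<close> the translation is expanded in an exponential series of the operator in
  Bernstein's inequality.\<close>

lemma bernstein_shift:
  assumes g: "g \<in> LpB" "trig_poly1 N g" and N: "0 < N"
  shows "nrm (\<lambda>z. shiftx (- h) g z - g z) \<le> min 2 (18 * (real N * \<bar>h\<bar>)) * nrm g"
proof -
  have two: "nrm (\<lambda>z. shiftx (- h) g z - g z) \<le> 2 * nrm g"
    using LpB_diff(2)[OF LpB_shiftx[OF g(1)] g(1), of "- h"] g(1) by simp
  show ?thesis
  proof (cases "real N * \<bar>h\<bar> \<le> 1")
    case False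
    then have "min 2 (18 * (real N * \<bar>h\<bar>)) = 2" by simp
    then show ?thesis using two by simp
  next
    case True
    define c where "c m = (- (\<i> * of_real h)) ^ Suc m / fact (Suc m)" for m
    define F where "F m = (\<lambda>z. c m * mult_op N (\<lambda>k. of_int k ^ Suc m) g z)" for m
    define u where "u = 2 * real N * \<bar>h\<bar>"
    have u: "0 \<le> u" "u \<le> 2" using True by (auto simp: u_def)
    have FX: "F m \<in> LpB" for m unfolding F_def by (intro LpB_scale(1) mult_op_LpB g(1))
    have Fn: "nrm (F m) \<le> u ^ Suc m /\<^sub>R fact (Suc m) * nrm g" for m
    proof -
      have "nrm (F m) = norm (c m) * nrm (mult_op N (\<lambda>k. of_int k ^ Suc m) g)"
        unfolding F_def by (rule LpB_scale(2)[OF mult_op_LpB[OF g(1)]])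
      also have "\<dots> \<le> norm (c m) * ((2 * real N) ^ Suc m * nrm g)"
        by (intro mult_left_mono bernstein_power[OF g N]) auto
      also have "norm (c m) = \<bar>h\<bar> ^ Suc m / fact (Suc m)"
        by (simp add: c_def norm_divide norm_power norm_mult del: fact_Suc power_Suc)
      also have "\<bar>h\<bar> ^ Suc m / fact (Suc m) * ((2 * real N) ^ Suc m * nrm g) = u ^ Suc m /\<^sub>R fact (Suc m) * nrm g"
        by (simp add: u_def power_mult_distrib divide_inverse mult_ac del: fact_Suc power_Suc)
      finally show ?thesis .
    qed
    have "(\<lambda>m. u ^ m /\<^sub>R fact m) sums exp u" by (rule exp_converges)
    then have es: "(\<lambda>m. u ^ Suc m /\<^sub>R fact (Suc m)) sums (exp u - 1)"
      by (subst sums_Suc_iff[of "\<lambda>m. u ^ m /\<^sub>R fact m"]) simp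
    have es': "(\<lambda>m. u ^ Suc m /\<^sub>R fact (Suc m) * nrm g) sums ((exp u - 1) * nrm g)"
      using es by (rule sums_mult2)
    have eq: "(\<lambda>z. shiftx (- h) g z - g z) = (\<lambda>z. \<Sum>m. F m z)"
    proof
      fix z :: "real \<times> real"
      obtain x y where z: "z = (x, y)" by (cases z)
      have ce: "(\<lambda>m. c m * of_int k ^ Suc m) sums (cis (- (of_int k * h)) - 1)" for k :: int
      proof -
        let ?w = "- (\<i> * of_real h * of_int k)"
        have "(\<lambda>m. ?w ^ m /\<^sub>R fact m) sums exp ?w" by (rule exp_converges)
        then have "(\<lambda>m. ?w ^ Suc m /\<^sub>R fact (Suc m)) sums (exp ?w - 1)"
          by (subst sums_Suc_iff[of "\<lambda>m. ?w ^ m /\<^sub>R fact m"]) simp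
        moreover have "?w ^ Suc m /\<^sub>R fact (Suc m) = c m * of_int k ^ Suc m" for m
          unfolding c_def scaleR_conv_of_real
          by (simp add: power_mult_distrib[symmetric] divide_inverse mult_ac del: fact_Suc power_Suc)
        moreover have "exp ?w = cis (- (of_int k * h))" by (simp add: cis_conv_exp mult_ac)
        ultimately show ?thesis by simp
      qed
      have "(\<lambda>m. \<Sum>k = - int N..int N. (c m * of_int k ^ Suc m) * (fcoeff g k y * cis (of_int k * x))) sums
          (\<Sum>k = - int N..int N. (cis (- (of_int k * h)) - 1) * (fcoeff g k y * cis (of_int k * x)))"
        by (intro sums_sum sums_mult2 ce)
      moreover have "(\<Sum>k = - int N..int N. (c m * of_int k ^ Suc m) * (fcoeff g k y * cis (of_int k * x))) = F m z" for m
        by (simp add: F_def z mult_op_def sum_distrib_left mult.assoc del: power_Suc)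
      moreover have "(\<Sum>k = - int N..int N. (cis (- (of_int k * h)) - 1) * (fcoeff g k y * cis (of_int k * x))) = shiftx (- h) g z - g z"
        unfolding z shiftx_apply trig_poly1_fcoeff(1)[OF g(2)] sum_subtractf[symmetric]
        by (intro sum.cong refl) (simp add: algebra_simps cis_mult)
      ultimately show "shiftx (- h) g z - g z = (\<Sum>m. F m z)" by (simp add: sums_iff)
    qed
    have "nrm (\<lambda>z. shiftx (- h) g z - g z) \<le> (exp u - 1) * nrm g"
      unfolding eq using LpB_suminf(3)[OF FX Fn sums_summable[OF es']] sums_unique[OF es'] by simp
    also have "\<dots> \<le> (9 * u) * nrm g" using exp_minus_1_bound[OF u] by (intro mult_right_mono) auto
    finally have "nrm (\<lambda>z. shiftx (- h) g z - g z) \<le> 18 * (real N * \<bar>h\<bar>) * nrm g"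
      by (simp add: u_def)
    with two show ?thesis by (auto simp: min_def)
  qed
qed

text \<open>The constant 36 is 2 times 18: by \<open>one_minus_exp_lower\<close>, \<open>min 1 (\<nu> e)\<close> is at most \<open>2 (1 - (1 - e)\<^sup>\<nu>)\<close>, and the
  weighted sum of the latter terms is \<open>e\<^sup>\<beta>\<close>.\<close>

lemma bernstein_fractional_small:
  assumes g: "g \<in> LpB" "trig_poly1 N g" and N: "0 < N" and \<beta>: "0 < \<beta>" "\<beta> \<le> 1"
  shows "nrm (trans_sum (dcoeff \<beta>) h g) \<le> 36 * (real N * \<bar>h\<bar>) powr \<beta> * nrm g"
proof -
  define e where "e = real N * \<bar>h\<bar>"
  have e0: "0 \<le> e" by (simp add: e_def)
  define F where "F n = (\<lambda>z. of_real (- \<bar>dcoeff \<beta> (Suc n)\<bar>) * (shiftx (- (real (Suc n) * h)) g z - g z))" for n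
  have FX: "F n \<in> LpB" for n
    unfolding F_def by (intro LpB_scale(1) LpB_diff(1) LpB_shiftx g(1))
  have Fn: "nrm (F n) \<le> \<bar>dcoeff \<beta> (Suc n)\<bar> * min 2 (18 * (real (Suc n) * e)) * nrm g" for n
  proof -
    have "nrm (F n) = norm (complex_of_real (- \<bar>dcoeff \<beta> (Suc n)\<bar>)) * nrm (\<lambda>z. shiftx (- (real (Suc n) * h)) g z - g z)"
      unfolding F_def by (rule LpB_scale(2)[OF LpB_diff(1)[OF LpB_shiftx[OF g(1)] g(1)]])
    also have "\<dots> \<le> \<bar>dcoeff \<beta> (Suc n)\<bar> * (min 2 (18 * (real N * \<bar>real (Suc n) * h\<bar>)) * nrm g)"
      using bernstein_shift[OF g N, of "real (Suc n) * h"] by (simp only: norm_of_real abs_minus_cancel abs_idempotent mult_left_mono abs_ge_zero)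
    also have "real N * \<bar>real (Suc n) * h\<bar> = real (Suc n) * e"
      by (simp add: e_def abs_mult)
    finally show ?thesis by (simp only: mult.assoc)
  qed
  note s1 = summable_abs_dcoeff_small[OF \<beta>] and one = suminf_abs_dcoeff_small[OF \<beta>]
  have AE: "AE z in torus. trans_sum (dcoeff \<beta>) h g z = (\<Sum>n. F n z)"
    using trans_sum_AE_summable[OF summable_abs_dcoeff[OF \<beta>(1)] g(1), of h]
  proof eventually_elim
    case (elim z)
    let ?t = "\<lambda>n. of_real (dcoeff \<beta> n) * shiftx (- (real n * h)) g z"
    have t: "summable ?t" using elim by (rule summable_norm_cancel)
    then have "trans_sum (dcoeff \<beta>) h g z = (\<Sum>n. ?t (Suc n)) + ?t 0"
      unfolding trans_sum_def using suminf_split_head[OF t] by simp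
    moreover have "?t 0 = g z" by (cases z) simp
    moreover have "(\<lambda>n. \<bar>dcoeff \<beta> (Suc n)\<bar>) sums 1" using summable_sums[OF s1] one by simp
    then have "(\<lambda>n. complex_of_real \<bar>dcoeff \<beta> (Suc n)\<bar> * g z) sums (of_real 1 * g z)"
      by (intro sums_mult2 sums_of_real)
    moreover have "(\<lambda>n. ?t (Suc n)) sums (\<Sum>n. ?t (Suc n))"
      using t by (intro summable_sums) (simp only: summable_Suc_iff[of ?t])
    ultimately have "(\<lambda>n. ?t (Suc n) + of_real \<bar>dcoeff \<beta> (Suc n)\<bar> * g z) sums trans_sum (dcoeff \<beta>) h g z"
      using sums_add by fastforce
    moreover have "?t (Suc n) + of_real \<bar>dcoeff \<beta> (Suc n)\<bar> * g z = F n z" for n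
    proof -
      have "dcoeff \<beta> (Suc n) = - \<bar>dcoeff \<beta> (Suc n)\<bar>" using dcoeff_nonpos[OF \<beta>, of n] by simp
      then have "?t (Suc n) = of_real (- \<bar>dcoeff \<beta> (Suc n)\<bar>) * shiftx (- (real (Suc n) * h)) g z" by metis
      then show ?thesis unfolding F_def by (simp add: right_diff_distrib del: of_nat_Suc)
    qed
    ultimately show ?case by (simp add: sums_iff)
  qed
  have main: "\<exists>b. (\<forall>n. \<bar>dcoeff \<beta> (Suc n)\<bar> * min 2 (18 * (real (Suc n) * e)) \<le> b n) \<and> summable b \<and> (\<Sum>n. b n) \<le> 36 * e powr \<beta>"
  proof -
    consider "e = 0" | "0 < e" "e \<le> 1" | "1 < e" using e0 by linarith
    then show ?thesis
    proof cases
      case 1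
      then show ?thesis by (intro exI[of _ "\<lambda>_. 0"]) simp
    next
      case 2
      have 3: "min 2 (18 * (real (Suc n) * e)) \<le> 36 * (1 - (1 - e) ^ Suc n)" for n
      proof -
        have "(1 - e) ^ Suc n \<le> exp (- e) ^ Suc n"
          using exp_ge_add_one_self[of "- e"] 2 by (intro power_mono) auto
        also have "\<dots> = exp (- (real (Suc n) * e))"
          by (subst exp_of_nat_mult[symmetric]) (simp add: algebra_simps)
        finally have "min 1 (real (Suc n) * e) / 2 \<le> 1 - (1 - e) ^ Suc n"
          using one_minus_exp_lower[of "real (Suc n) * e"] e0 by (simp del: of_nat_Suc power_Suc)
        moreover have "min 2 (18 * x) \<le> 18 * min 1 x" for x :: real
          by (simp add: min_def)
        from this[of "real (Suc n) * e"] have "min 2 (18 * (real (Suc n) * e)) \<le> 18 * min 1 (real (Suc n) * e)" .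
        moreover have "A \<le> 18 * M \<Longrightarrow> M / 2 \<le> B \<Longrightarrow> A \<le> 36 * B" for A M B :: real by linarith
        ultimately show ?thesis by blast
      qed
      have s: "(\<lambda>n. 36 * (\<bar>dcoeff \<beta> (Suc n)\<bar> * (1 - (1 - e) ^ Suc n))) sums (36 * e powr \<beta>)"
        by (intro sums_mult abs_dcoeff_sums_weighted \<beta> 2)
      show ?thesis
        using s mult_left_mono[OF 3 abs_ge_zero[of "dcoeff \<beta> (Suc n)" for n]]
        by (intro exI[of _ "\<lambda>n. 36 * (\<bar>dcoeff \<beta> (Suc n)\<bar> * (1 - (1 - e) ^ Suc n))"])
           (auto simp: sums_iff mult.left_commute simp del: of_nat_Suc power_Suc)
    next
      case 3
      have "1 \<le> e powr \<beta>" using 3 \<beta> by (simp add: ge_one_powr_ge_zero)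
      then have "(\<Sum>n. \<bar>dcoeff \<beta> (Suc n)\<bar> * 2) \<le> 36 * e powr \<beta>"
        using suminf_mult2[OF s1, of 2] one by simp
      then show ?thesis
        using summable_mult2[OF s1, of 2]
        by (intro exI[of _ "\<lambda>n. \<bar>dcoeff \<beta> (Suc n)\<bar> * 2"]) (auto intro!: mult_left_mono)
    qed
  qed
  then obtain b where b: "\<And>n. \<bar>dcoeff \<beta> (Suc n)\<bar> * min 2 (18 * (real (Suc n) * e)) \<le> b n" "summable b"
    "(\<Sum>n. b n) \<le> 36 * e powr \<beta>" by blast
  have "nrm (F n) \<le> b n * nrm g" for n
    using Fn[of n] mult_right_mono[OF b(1)[of n] nrm_nonneg[of g]] by linarith
  from LpB_suminf(3)[OF FX this summable_mult2[OF b(2)]]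
  have "nrm (\<lambda>z. \<Sum>n. F n z) \<le> (\<Sum>n. b n) * nrm g"
    using suminf_mult2[OF b(2), of "nrm g"] by simp
  also have "\<dots> \<le> 36 * e powr \<beta> * nrm g" using b(3) by (intro mult_right_mono) auto
  finally show ?thesis unfolding nrm_cong[OF AE] e_def .
qed

lemma trans_sum_dcoeff_add_1:
  assumes \<alpha>: "0 < \<alpha>" and f: "f \<in> LpB"
  shows "AE z in torus. trans_sum (dcoeff (\<alpha> + 1)) h f z = - (shiftx (- h) (trans_sum (dcoeff \<alpha>) h f) z - trans_sum (dcoeff \<alpha>) h f z)"
proof -
  have \<alpha>1: "0 < \<alpha> + 1" using \<alpha> by simp
  show ?thesis
    using trans_sum_AE_summable[OF summable_abs_dcoeff[OF \<alpha>] f, of h]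
      trans_sum_AE_summable[OF summable_abs_dcoeff[OF \<alpha>] LpB_shiftx[OF f], of h "- h"]
      trans_sum_AE_summable[OF summable_abs_dcoeff[OF \<alpha>1] f, of h]
  proof eventually_elim
    case (elim z)
    let ?t = "\<lambda>a n. complex_of_real (dcoeff a n) * shiftx (- (real n * h)) f z"
    let ?s = "\<lambda>n. complex_of_real (dcoeff \<alpha> n) * shiftx (- (real (Suc n) * h)) f z"
    have tt: "shiftx (- (real n * h)) (shiftx (- h) f) z = shiftx (- (real (Suc n) * h)) f z" for n
      unfolding shiftx_shiftx by (simp add: algebra_simps)
    have s: "summable ?s" using summable_norm_cancel[OF elim(2)] unfolding tt .
    have t: "summable (?t \<alpha>)" "summable (?t (\<alpha> + 1))"
      using summable_norm_cancel[OF elim(1)] summable_norm_cancel[OF elim(3)] by auto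
    have S: "(\<Sum>n. ?s n) = shiftx (- h) (trans_sum (dcoeff \<alpha>) h f) z"
      by (cases z) (simp add: trans_sum_def algebra_simps)
    have "(\<Sum>n. ?t (\<alpha> + 1) (Suc n)) = (\<Sum>n. ?t \<alpha> (Suc n) - ?s n)"
      unfolding dcoeff_add_1 by (simp add: left_diff_distrib)
    also have "\<dots> = (\<Sum>n. ?t \<alpha> (Suc n)) - (\<Sum>n. ?s n)"
      using t(1) s by (intro suminf_diff[symmetric]) (simp_all only: summable_Suc_iff[of "?t \<alpha>"])
    finally show ?case
      unfolding S trans_sum_def[of "dcoeff (\<alpha> + 1)"] trans_sum_def[of "dcoeff \<alpha>" h f]
      using suminf_split_head[OF t(1)] suminf_split_head[OF t(2)] by simp
  qed
qed

lemma bernstein_fractional: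
  assumes \<alpha>: "0 < \<alpha>"
  shows "\<exists>C>0. \<forall>N>0. \<forall>h. \<forall>g\<in>LpB. trig_poly1 N g \<longrightarrow>
    nrm (trans_sum (dcoeff \<alpha>) h g) \<le> C * (real N * \<bar>h\<bar>) powr \<alpha> * nrm g"
proof -
  obtain \<beta> k where \<beta>: "0 < \<beta>" "\<beta> \<le> 1" "\<alpha> = \<beta> + real k" using pos_real_decompose[OF \<alpha>] .
  have "nrm (trans_sum (dcoeff (\<beta> + real k)) h g) \<le> (36 * 18 ^ k) * (real N * \<bar>h\<bar>) powr (\<beta> + real k) * nrm g"
    if N: "0 < N" and g: "g \<in> LpB" "trig_poly1 N g" for N h g
  proof (induction k)
    case 0
    then show ?case using bernstein_fractional_small[OF g N \<beta>(1,2)] by simp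
  next
    case (Suc k)
    define a where "a = \<beta> + real k"
    have a: "0 < a" using \<beta> by (simp add: a_def)
    have a1: "\<beta> + real (Suc k) = a + 1" by (simp add: a_def)
    define u where "u = trans_sum (dcoeff a) h g"
    have u: "u \<in> LpB" "trig_poly1 N u"
      unfolding u_def using trans_sum_LpB trig_poly1_trans_sum summable_abs_dcoeff[OF a] g by auto
    have "nrm (trans_sum (dcoeff (a + 1)) h g) = nrm (\<lambda>z. - 1 * (shiftx (- h) u z - u z))"
      unfolding u_def using nrm_cong[OF trans_sum_dcoeff_add_1[OF a g(1), of h]] by simp
    also have "\<dots> = nrm (\<lambda>z. shiftx (- h) u z - u z)"
      using LpB_scale(2)[OF LpB_diff(1)[OF LpB_shiftx[OF u(1)] u(1)], of "- 1" "- h"] by simp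
    also have "\<dots> \<le> min 2 (18 * (real N * \<bar>h\<bar>)) * nrm u" by (rule bernstein_shift[OF u N])
    also have "\<dots> \<le> (18 * (real N * \<bar>h\<bar>)) * nrm u" by (intro mult_right_mono) auto
    also have "\<dots> \<le> (18 * (real N * \<bar>h\<bar>)) * (36 * 18 ^ k * (real N * \<bar>h\<bar>) powr a * nrm g)"
      using Suc.IH unfolding u_def a_def by (intro mult_left_mono) auto
    also have "\<dots> = (36 * 18 ^ Suc k) * ((real N * \<bar>h\<bar>) powr a * (real N * \<bar>h\<bar>)) * nrm g"
      by (simp add: mult_ac)
    also have "(real N * \<bar>h\<bar>) powr a * (real N * \<bar>h\<bar>) = (real N * \<bar>h\<bar>) powr (a + 1)"
      by (cases "h = 0") (auto simp: powr_add)
    finally show ?case unfolding a1 .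
  qed
  then show ?thesis unfolding \<beta>(3) by (intro exI[of _ "36 * 18 ^ k"]) auto
qed

lemma trans_sum_dcoeff_const:
  assumes \<alpha>: "0 < \<alpha>" and g: "\<And>x y. g (x, y) = \<gamma> y"
  shows "trans_sum (dcoeff \<alpha>) h g z = 0"
proof (cases z)
  case (Pair x y)
  have "(\<lambda>n. complex_of_real (dcoeff \<alpha> n) * \<gamma> y) sums (of_real 0 * \<gamma> y)"
    by (intro sums_mult2 sums_of_real dcoeff_sums_0 \<alpha>)
  then show ?thesis unfolding Pair trans_sum_def by (simp add: g sums_iff)
qed

text \<open>The last block, for \<open>j = J + 1\<close>, is not a polynomial; the trivial bound suffices because its weight is
  at least one.\<close>

lemma inverse_one_variable:
  assumes \<alpha>: "0 < \<alpha>"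
  shows "\<exists>C>0. \<forall>n J h. 2 ^ J \<le> n + 1 \<longrightarrow> n + 1 < 2 ^ Suc J \<longrightarrow> \<bar>h\<bar> \<le> pi / real (n + 1) \<longrightarrow>
    (\<forall>G\<in>LpB. nrm (trans_sum (dcoeff \<alpha>) h G) \<le> C * (\<Sum>j\<le>Suc J. (2 ^ j / real (n + 1)) powr \<alpha> * nrm (dblock J j G)))"
proof -
  obtain C1 where C1: "0 < C1" and bern: "\<And>N h g. 0 < N \<Longrightarrow> g \<in> LpB \<Longrightarrow> trig_poly1 N g \<Longrightarrow>
    nrm (trans_sum (dcoeff \<alpha>) h g) \<le> C1 * (real N * \<bar>h\<bar>) powr \<alpha> * nrm g"
    using bernstein_fractional[OF \<alpha>] by blast
  note summ = summable_abs_dcoeff[OF \<alpha>]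
  define C where "C = C1 * (2 * pi) powr \<alpha> + dcoeff_norm \<alpha>"
  have fd0: "0 \<le> dcoeff_norm \<alpha>" using dcoeff_norm_ge_1[OF \<alpha>] by simp
  have C0: "0 < C" using C1 fd0 by (auto simp: C_def intro!: add_pos_nonneg)
  show ?thesis
  proof (intro exI[of _ C] conjI allI impI ballI C0)
    fix n J :: nat and h :: real and G
    assume J: "2 ^ J \<le> n + 1" "n + 1 < 2 ^ Suc J" and h: "\<bar>h\<bar> \<le> pi / real (n + 1)" and G: "G \<in> LpB"
    have EX: "dblock J j G \<in> LpB" for j by (rule dblock_LpB[OF G])
    have piece: "nrm (trans_sum (dcoeff \<alpha>) h (dblock J j G)) \<le> C * ((2 ^ j / real (n + 1)) powr \<alpha> * nrm (dblock J j G))"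
      if "j \<le> Suc J" for j
    proof (cases "j \<le> J")
      case True
      have "nrm (trans_sum (dcoeff \<alpha>) h (dblock J j G)) \<le> C1 * (real (2 * 2 ^ j) * \<bar>h\<bar>) powr \<alpha> * nrm (dblock J j G)"
        by (rule bern[OF _ EX trig_poly1_dblock[OF True]]) simp
      also have "\<dots> \<le> C1 * ((2 * pi) * (2 ^ j / real (n + 1))) powr \<alpha> * nrm (dblock J j G)"
      proof (intro mult_right_mono mult_left_mono powr_mono2)
        have "2 * 2 ^ j * \<bar>h\<bar> \<le> 2 * 2 ^ j * (pi / real (n + 1))" using h by (intro mult_left_mono) auto
        then show "real (2 * 2 ^ j) * \<bar>h\<bar> \<le> (2 * pi) * (2 ^ j / real (n + 1))" by (simp add: mult_ac)
      qed (use \<alpha> C1 in auto)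
      also have "\<dots> = (C1 * (2 * pi) powr \<alpha>) * ((2 ^ j / real (n + 1)) powr \<alpha> * nrm (dblock J j G))"
        by (subst powr_mult) (auto simp: mult_ac)
      also have "\<dots> \<le> C * ((2 ^ j / real (n + 1)) powr \<alpha> * nrm (dblock J j G))"
        using fd0 by (intro mult_right_mono) (auto simp: C_def)
      finally show ?thesis .
    next
      case False
      then have j: "j = Suc J" using that by simp
      have "real (n + 1) \<le> 2 ^ j" using J(2) unfolding j by (metis less_imp_le of_nat_le_iff of_nat_numeral of_nat_power)
      then have "1 \<le> 2 ^ j / real (n + 1)" by simp
      then have one: "1 \<le> (2 ^ j / real (n + 1)) powr \<alpha>" using \<alpha> by (intro ge_one_powr_ge_zero) auto
      have "nrm (trans_sum (dcoeff \<alpha>) h (dblock J j G)) \<le> dcoeff_norm \<alpha> * nrm (dblock J j G)"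
        by (rule trans_sum_nrm[OF summ EX])
      also have "\<dots> \<le> C * ((2 ^ j / real (n + 1)) powr \<alpha> * nrm (dblock J j G))"
      proof (rule mult_mono)
        show "dcoeff_norm \<alpha> \<le> C" using C1 by (simp add: C_def)
        show "nrm (dblock J j G) \<le> (2 ^ j / real (n + 1)) powr \<alpha> * nrm (dblock J j G)"
          using mult_right_mono[OF one nrm_nonneg[of "dblock J j G"]] by simp
      qed (use C0 in auto)
      finally show ?thesis .
    qed
    have tb: "bounded_op (dcoeff_norm \<alpha>) (trans_sum (dcoeff \<alpha>) h)" by (rule bounded_op_trans_sum[OF summ])
    have SX: "(\<lambda>z. \<Sum>j\<le>Suc J. dblock J j G z) \<in> LpB" by (rule LpB_sum(1)) (auto intro: EX)
    have V: "vp 0 G \<in> LpB" by (rule mult_op_LpB[OF G])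
    define G' where "G' = (\<lambda>z. vp 0 G z + (\<Sum>j\<le>Suc J. dblock J j G z))"
    have G_eq: "G' = G"
      unfolding G'_def by (rule ext) (rule dblock_telescope[symmetric])
    have 1: "AE z in torus. trans_sum (dcoeff \<alpha>) h G' z
        = trans_sum (dcoeff \<alpha>) h (vp 0 G) z + trans_sum (dcoeff \<alpha>) h (\<lambda>z. \<Sum>j\<le>Suc J. dblock J j G z) z"
      unfolding G'_def by (rule bounded_op_add[OF tb V SX])
    have 2: "AE z in torus. trans_sum (dcoeff \<alpha>) h (\<lambda>z. \<Sum>j\<le>Suc J. dblock J j G z) z = (\<Sum>j\<le>Suc J. trans_sum (dcoeff \<alpha>) h (dblock J j G) z)"
      by (rule bounded_op_sum[OF tb]) (auto intro: EX)
    have 3: "trans_sum (dcoeff \<alpha>) h (vp 0 G) z = 0" for z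
      by (rule trans_sum_dcoeff_const[OF \<alpha>]) (rule vp_0_const)
    have "AE z in torus. trans_sum (dcoeff \<alpha>) h G z = (\<Sum>j\<le>Suc J. trans_sum (dcoeff \<alpha>) h (dblock J j G) z)"
      using 1 2 unfolding G_eq by eventually_elim (simp only: 3 add_0_left)
    then have "nrm (trans_sum (dcoeff \<alpha>) h G) = nrm (\<lambda>z. \<Sum>j\<le>Suc J. trans_sum (dcoeff \<alpha>) h (dblock J j G) z)"
      by (rule nrm_cong)
    also have "\<dots> \<le> (\<Sum>j\<le>Suc J. nrm (trans_sum (dcoeff \<alpha>) h (dblock J j G)))"
      by (rule LpB_sum(2)) (auto intro: trans_sum_LpB summ EX)
    also have "\<dots> \<le> (\<Sum>j\<le>Suc J. C * ((2 ^ j / real (n + 1)) powr \<alpha> * nrm (dblock J j G)))"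
      by (intro sum_mono piece) auto
    finally show "nrm (trans_sum (dcoeff \<alpha>) h G) \<le> C * (\<Sum>j\<le>Suc J. (2 ^ j / real (n + 1)) powr \<alpha> * nrm (dblock J j G))"
      by (simp only: sum_distrib_left)
  qed
qed

end

section \<open>Borel representatives\<close>

lemma nn_integral_closed_period:
  assumes [measurable]: "h \<in> borel_measurable borel"
  shows "(\<integral>\<^sup>+x. h x * indicator {0..2 * pi} x \<partial>lborel) = ennreal (2 * pi) * (\<integral>\<^sup>+x. h x \<partial>circ)"
proof -
  have "AE x in lborel. x \<noteq> 2 * pi" by (rule AE_lborel_singleton)
  then have "(\<integral>\<^sup>+x. h x * indicator {0..2 * pi} x \<partial>lborel) = (\<integral>\<^sup>+x. h x * indicator {0..<2 * pi} x \<partial>lborel)"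
    by (intro nn_integral_cong_AE) (auto elim!: eventually_mono simp: indicator_def)
  also have "\<dots> = ennreal (2 * pi) * (ennreal (1 / (2 * pi)) * (\<integral>\<^sup>+x. h x * indicator {0..<2 * pi} x \<partial>lborel))"
    by (subst mult.assoc[symmetric], subst ennreal_mult[symmetric]) auto
  finally show ?thesis by (simp add: nn_integral_circ)
qed

lemma nn_integral_cell:
  fixes g :: "real \<times> real \<Rightarrow> ennreal"
  assumes "g \<in> borel_measurable borel"
  shows "(\<integral>\<^sup>+z. g z * indicator torus_cell z \<partial>lborel) = ennreal ((2 * pi)\<^sup>2) * (\<integral>\<^sup>+z. g z \<partial>torus)"
proof -
  have g [measurable]: "g \<in> borel_measurable (borel \<Otimes>\<^sub>M borel)" using assms by (simp add: borel_prod)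
  have [measurable]: "(\<lambda>x. \<integral>\<^sup>+y. g (x, y) \<partial>circ) \<in> borel_measurable borel"
  proof -
    have "g \<in> borel_measurable (borel \<Otimes>\<^sub>M circ)"
      using g by (simp cong: measurable_cong_sets sets_pair_measure_cong)
    then show ?thesis by (rule circ.borel_measurable_nn_integral_fst)
  qed
  have [measurable]: "(\<lambda>z. g z * indicator torus_cell z) \<in> borel_measurable (lborel \<Otimes>\<^sub>M lborel)"
    unfolding torus_cell_def by measurable
  have "(\<integral>\<^sup>+z. g z * indicator torus_cell z \<partial>lborel)
      = (\<integral>\<^sup>+x. \<integral>\<^sup>+y. g (x, y) * indicator torus_cell (x, y) \<partial>lborel \<partial>lborel)"
    unfolding lborel_prod[symmetric] by (rule lborel.nn_integral_fst[symmetric]) measurable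
  also have "\<dots> = (\<integral>\<^sup>+x. (\<integral>\<^sup>+y. g (x, y) * indicator {0..2 * pi} y \<partial>lborel) * indicator {0..2 * pi} x \<partial>lborel)"
    by (subst nn_integral_multc[symmetric])
       (auto simp: torus_cell_def indicator_def intro!: nn_integral_cong)
  also have "\<dots> = (\<integral>\<^sup>+x. (ennreal (2 * pi) * (\<integral>\<^sup>+y. g (x, y) \<partial>circ)) * indicator {0..2 * pi} x \<partial>lborel)"
    by (subst nn_integral_closed_period) auto
  also have "\<dots> = ennreal (2 * pi) * (\<integral>\<^sup>+x. ennreal (2 * pi) * (\<integral>\<^sup>+y. g (x, y) \<partial>circ) \<partial>circ)"
    by (subst nn_integral_closed_period) auto
  also have "\<dots> = ennreal (2 * pi) * (ennreal (2 * pi) * (\<integral>\<^sup>+x. \<integral>\<^sup>+y. g (x, y) \<partial>circ \<partial>circ))"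
    by (subst nn_integral_cmult) auto
  also have "\<dots> = ennreal ((2 * pi)\<^sup>2) * (\<integral>\<^sup>+x. \<integral>\<^sup>+y. g (x, y) \<partial>circ \<partial>circ)"
    unfolding power2_eq_square by (subst ennreal_mult) (auto simp: mult.assoc)
  also have "(\<integral>\<^sup>+x. \<integral>\<^sup>+y. g (x, y) \<partial>circ \<partial>circ) = (\<integral>\<^sup>+z. g z \<partial>torus)"
    using assms by (intro circ.nn_integral_fst) simp
  finally show ?thesis .
qed

lemma AE_lborel_torus:
  assumes "AE z in lborel. P z"
  shows "AE z in torus. P z"
proof -
  obtain N where N: "N \<in> sets lborel" "emeasure lborel N = 0" "{z \<in> space lborel. \<not> P z} \<subseteq> N"
    using assms by (auto elim!: AE_E)
  have NB: "N \<in> sets borel" using N(1) by simp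
  have "ennreal ((2 * pi)\<^sup>2) * (\<integral>\<^sup>+z. indicator N z \<partial>torus) = (\<integral>\<^sup>+z. indicator N z * indicator torus_cell z \<partial>lborel)"
    using NB by (intro nn_integral_cell[symmetric]) simp
  also have "\<dots> \<le> (\<integral>\<^sup>+z. indicator N z \<partial>lborel)"
    by (intro nn_integral_mono) (auto simp: indicator_def)
  also have "\<dots> = 0" using N by simp
  finally have e: "emeasure torus N = 0" using NB unfolding sets_torus[symmetric] by simp
  show ?thesis
    by (rule AE_I[OF _ e]) (use N(3) NB in \<open>simp_all add: sets_torus[symmetric] del: sets_torus\<close>)
qed

lemma AE_lborel_shift:
  fixes P :: "real \<times> real \<Rightarrow> bool"
  assumes "AE z in lborel. P z"
  shows "AE z in lborel. P (a + z)"
proof -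
  have "AE z in distr lborel borel ((+) a). P z" unfolding lborel_distr_plus by (rule assms)
  then show ?thesis by (rule AE_distrD[rotated]) simp
qed

lemma trig_poly2_swapxy: "trig_poly2 m T \<longleftrightarrow> trig_poly1 m (swapxy T)"
  by (auto simp: trig_poly1_def trig_poly2_def)

lemma frac_diff1_trans_sum: "frac_diff1 \<alpha> h f = shiftx (\<alpha> * h) (trans_sum (dcoeff \<alpha>) h f)"
proof
  fix z :: "real \<times> real"
  show "frac_diff1 \<alpha> h f z = shiftx (\<alpha> * h) (trans_sum (dcoeff \<alpha>) h f) z"
    by (cases z) (simp add: frac_diff1_def trans_sum_def dcoeff_def algebra_simps)
qed

lemma frac_diff2_swapxy: "frac_diff2 \<alpha> h f = swapxy (frac_diff1 \<alpha> h (swapxy f))"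
  by (auto simp: frac_diff2_def frac_diff1_def)

lemma trans_sum_shift2: "trans_sum c h (swapxy (shiftx a (swapxy g))) = swapxy (shiftx a (swapxy (trans_sum c h g)))"
proof
  fix z :: "real \<times> real"
  show "trans_sum c h (swapxy (shiftx a (swapxy g))) z = swapxy (shiftx a (swapxy (trans_sum c h g))) z"
    by (cases z) (simp add: trans_sum_def)
qed

text \<open>The pointwise defined differences respect equality almost everywhere, as they involve only
  countably many translates.\<close>

lemma frac_diff_cong_AE:
  assumes "AE z in lborel. f z = g z"
  shows "AE z in lborel. frac_diff1 \<alpha>1 h1 (frac_diff2 \<alpha>2 h2 f) z = frac_diff1 \<alpha>1 h1 (frac_diff2 \<alpha>2 h2 g) z"
proof -
  have "AE z in lborel. \<forall>n m. f (((\<alpha>1 - real n) * h1, (\<alpha>2 - real m) * h2) + z) = g (((\<alpha>1 - real n) * h1, (\<alpha>2 - real m) * h2) + z)"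
    unfolding AE_all_countable using AE_lborel_shift[OF assms] by blast
  then show ?thesis
  proof eventually_elim
    case (elim z)
    obtain x y where z: "z = (x, y)" by (cases z)
    have "f (x + (\<alpha>1 - real n) * h1, y + (\<alpha>2 - real m) * h2) = g (x + (\<alpha>1 - real n) * h1, y + (\<alpha>2 - real m) * h2)" for n m
      using elim[rule_format, of n m] by (simp add: z add.commute)
    then show ?case unfolding z frac_diff1_def frac_diff2_def by simp
  qed
qed

context torus_Lp
begin

text \<open>The ratio between the norm of the statement and the seminorm \<open>nrm\<close>.\<close>

definition norm_ratio :: real where
  "norm_ratio = ((2 * pi)\<^sup>2) powr (1 / p)"

lemma norm_ratio_pos: "0 < norm_ratio"
  by (simp add: norm_ratio_def)

lemma Lp_norm_nrm:
  assumes g: "g \<in> LpB" and eq: "AE z in lborel. F z = g z"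
  shows "Lp_norm p F = norm_ratio * nrm g"
proof -
  have [measurable]: "g \<in> borel_measurable borel" using g by (rule LpB_meas)
  have cell [measurable]: "torus_cell \<in> sets borel"
    unfolding torus_cell_def by (intro borel_closed closed_Times) auto
  have gm: "g \<in> borel_measurable lebesgue" by (intro measurable_completion) simp
  have Fm: "F \<in> borel_measurable lebesgue"
    using eq by (intro borel_measurable_AE[OF gm]) (auto simp: AE_completion_iff elim!: eventually_mono)
  have cell': "torus_cell \<in> sets lebesgue" by simp
  define H where "H z = indicat_real torus_cell z * norm (g z) powr p" for z
  have Hm: "H \<in> borel_measurable borel" unfolding H_def by measurable
  have "(LINT z:torus_cell|lebesgue. norm (F z) powr p) = (\<integral>z. H z \<partial>lebesgue)"
    unfolding set_lebesgue_integral_def H_def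
  proof (rule integral_cong_AE)
    show "AE z in lebesgue. indicat_real torus_cell z *\<^sub>R norm (F z) powr p = indicat_real torus_cell z * norm (g z) powr p"
      unfolding AE_completion_iff using eq by eventually_elim simp
  qed (use Fm gm cell' in measurable)
  also have "\<dots> = (\<integral>z. H z \<partial>lborel)" using Hm by (intro integral_completion) simp
  also have "\<dots> = enn2real (\<integral>\<^sup>+z. ennreal (H z) \<partial>lborel)"
    using Hm by (intro integral_eq_nn_integral) (auto simp: H_def)
  also have "(\<integral>\<^sup>+z. ennreal (H z) \<partial>lborel) = (\<integral>\<^sup>+z. ennreal (norm (g z) powr p) * indicator torus_cell z \<partial>lborel)"
    by (intro nn_integral_cong) (auto simp: H_def indicator_def)
  also have "\<dots> = ennreal ((2 * pi)\<^sup>2) * pint g"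
    unfolding pint_def by (rule nn_integral_cell) measurable
  finally have "(LINT z:torus_cell|lebesgue. norm (F z) powr p) = (2 * pi)\<^sup>2 * enn2real (pint g)"
    by (simp add: enn2real_mult)
  then show ?thesis
    unfolding Lp_norm_def nrm_def norm_ratio_def by (simp add: powr_mult)
qed

lemma LpB_Lp_torus:
  assumes g: "g \<in> LpB"
  shows "g \<in> Lp_torus p"
proof -
  have [measurable]: "g \<in> borel_measurable borel" using g by (rule LpB_meas)
  have cell [measurable]: "torus_cell \<in> sets borel"
    unfolding torus_cell_def by (intro borel_closed closed_Times) auto
  have gm: "g \<in> borel_measurable lebesgue" by (intro measurable_completion) simp
  have "set_integrable lborel torus_cell (\<lambda>z. norm (g z) powr p)"
    unfolding set_integrable_def
  proof (rule integrableI_bounded)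
    have "(\<integral>\<^sup>+z. ennreal (norm (indicat_real torus_cell z *\<^sub>R norm (g z) powr p)) \<partial>lborel)
        = (\<integral>\<^sup>+z. ennreal (norm (g z) powr p) * indicator torus_cell z \<partial>lborel)"
      by (intro nn_integral_cong) (auto simp: indicator_def)
    also have "\<dots> = ennreal ((2 * pi)\<^sup>2) * pint g"
      unfolding pint_def by (rule nn_integral_cell) measurable
    also have "\<dots> < \<infinity>" using LpB_fin[OF g] by (simp add: ennreal_mult_less_top)
    finally show "(\<integral>\<^sup>+z. ennreal (norm (indicat_real torus_cell z *\<^sub>R norm (g z) powr p)) \<partial>lborel) < \<infinity>" .
  qed measurable
  then have "set_integrable lebesgue torus_cell (\<lambda>z. norm (g z) powr p)"
    unfolding set_integrable_def by (subst integrable_completion) auto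
  then show ?thesis
    using gm LpB_per1[OF g] LpB_per2[OF g] by (simp add: Lp_torus_def)
qed

lemma Lp_torus_rep:
  assumes f: "f \<in> Lp_torus p"
  shows "\<exists>g\<in>LpB. AE z in lborel. f z = g z"
proof -
  have fm: "f \<in> borel_measurable lebesgue"
    and per1: "\<And>x y. f (x + 2 * pi, y) = f (x, y)" and per2: "\<And>x y. f (x, y + 2 * pi) = f (x, y)"
    and fi: "set_integrable lebesgue torus_cell (\<lambda>z. norm (f z) powr p)"
    using f by (auto simp: Lp_torus_def)
  obtain r where r: "r \<in> borel_measurable lborel" "AE z in lborel. Re (f z) = r z"
    using completion_ex_borel_measurable_real[of "\<lambda>z. Re (f z)" lborel] fm by auto
  obtain s where s: "s \<in> borel_measurable lborel" "AE z in lborel. Im (f z) = s z"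
    using completion_ex_borel_measurable_real[of "\<lambda>z. Im (f z)" lborel] fm by auto
  define f0 where "f0 z = Complex (r z) (s z)" for z
  have f0m: "f0 \<in> borel_measurable borel"
    using r(1) s(1) unfolding f0_def by (simp add: borel_measurable_complex_iff)
  have f0: "AE z in lborel. f z = f0 z"
    using r(2) s(2) by eventually_elim (simp add: f0_def complex_eq_iff)
  define g where "g = (\<lambda>(x, y). f0 (wrap x, wrap y))"
  have [measurable]: "f0 \<in> borel_measurable (borel \<Otimes>\<^sub>M borel)" using f0m by (simp add: borel_prod)
  have "g \<in> borel_measurable (borel \<Otimes>\<^sub>M borel)" unfolding g_def by measurable
  then have gm [measurable]: "g \<in> borel_measurable borel" by (simp add: borel_prod)
  have eq: "AE z in lborel. f z = g z"
  proof -
    have "AE z in lborel. \<forall>i j. f ((2 * pi * of_int i, 2 * pi * of_int j) + z) = f0 ((2 * pi * of_int i, 2 * pi * of_int j) + z)"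
      unfolding AE_all_countable using AE_lborel_shift[OF f0] by blast
    then show ?thesis
    proof eventually_elim
      case (elim z)
      obtain x y where z: "z = (x, y)" by (cases z)
      define i where "i = - \<lfloor>x / (2 * pi)\<rfloor>"
      define j where "j = - \<lfloor>y / (2 * pi)\<rfloor>"
      have w: "wrap x = x + 2 * pi * of_int i" "wrap y = y + 2 * pi * of_int j"
        by (simp_all add: wrap_def i_def j_def)
      have "f (x, y) = f (x + 2 * pi * of_int i, y)"
        using periodic_int[of "\<lambda>x. f (x, y)", OF per1] by simp
      also have "\<dots> = f (x + 2 * pi * of_int i, y + 2 * pi * of_int j)"
        using periodic_int[of "\<lambda>y. f (x + 2 * pi * of_int i, y)", OF per2] by simp
      also have "\<dots> = f0 (wrap x, wrap y)"
        using elim[rule_format, of i j] by (simp add: z w add.commute)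
      finally show ?case by (simp add: z g_def)
    qed
  qed
  have "ennreal ((2 * pi)\<^sup>2) * pint g = (\<integral>\<^sup>+z. ennreal (norm (g z) powr p) * indicator torus_cell z \<partial>lborel)"
    unfolding pint_def by (rule nn_integral_cell[symmetric]) measurable
  also have "\<dots> = (\<integral>\<^sup>+z. ennreal (norm (indicat_real torus_cell z *\<^sub>R norm (f z) powr p)) \<partial>lborel)"
    using eq by (intro nn_integral_cong_AE) (auto elim!: eventually_mono simp: indicator_def)
  also have "\<dots> = (\<integral>\<^sup>+z. ennreal (norm (indicat_real torus_cell z *\<^sub>R norm (f z) powr p)) \<partial>lebesgue)"
    by (rule nn_integral_completion[symmetric])
  also have "\<dots> < \<infinity>" using fi unfolding set_integrable_def integrable_iff_bounded by blast
  finally have "pint g < \<infinity>" by (auto simp: ennreal_mult_less_top)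
  then have "g \<in> LpB"
    using gm by (auto simp: LpB_def g_def wrap_periodic)
  with eq show ?thesis by blast
qed

text \<open>The seminorm of a mixed difference; the centering translations are omitted, as they do not change
  the norm.\<close>

definition mixed_diff_norm :: "real \<Rightarrow> real \<Rightarrow> real \<Rightarrow> real \<Rightarrow> (real \<times> real \<Rightarrow> complex) \<Rightarrow> real" where
  "mixed_diff_norm \<alpha>1 \<alpha>2 h1 h2 g = nrm (trans_sum (dcoeff \<alpha>1) h1 (swapxy (trans_sum (dcoeff \<alpha>2) h2 (swapxy g))))"

lemma Lp_norm_frac_diff:
  assumes \<alpha>: "0 < \<alpha>1" "0 < \<alpha>2" and g: "g \<in> LpB" and eq: "AE z in lborel. f z = g z"
  shows "Lp_norm p (frac_diff1 \<alpha>1 h1 (frac_diff2 \<alpha>2 h2 f)) = norm_ratio * mixed_diff_norm \<alpha>1 \<alpha>2 h1 h2 g"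
proof -
  define D where "D = trans_sum (dcoeff \<alpha>1) h1 (swapxy (trans_sum (dcoeff \<alpha>2) h2 (swapxy g)))"
  have D: "D \<in> LpB" unfolding D_def by (intro trans_sum_LpB LpB_swapxy summable_abs_dcoeff \<alpha> g)
  have id: "frac_diff1 \<alpha>1 h1 (frac_diff2 \<alpha>2 h2 g) = shiftx (\<alpha>1 * h1) (swapxy (shiftx (\<alpha>2 * h2) (swapxy D)))"
    unfolding frac_diff2_swapxy frac_diff1_trans_sum D_def
    using trans_sum_shift2[of "dcoeff \<alpha>1" h1 "\<alpha>2 * h2" "swapxy (trans_sum (dcoeff \<alpha>2) h2 (swapxy g))"] by simp
  have "Lp_norm p (frac_diff1 \<alpha>1 h1 (frac_diff2 \<alpha>2 h2 f)) = norm_ratio * nrm (frac_diff1 \<alpha>1 h1 (frac_diff2 \<alpha>2 h2 g))"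
    by (rule Lp_norm_nrm[OF _ frac_diff_cong_AE[OF eq]]) (use D in \<open>simp add: id\<close>)
  also have "nrm (frac_diff1 \<alpha>1 h1 (frac_diff2 \<alpha>2 h2 g)) = nrm D" unfolding id using D by simp
  finally show ?thesis by (simp add: mixed_diff_norm_def D_def)
qed

lemma mixed_diff_norm_bound:
  assumes \<alpha>: "0 < \<alpha>1" "0 < \<alpha>2" and g: "g \<in> LpB"
  shows "mixed_diff_norm \<alpha>1 \<alpha>2 h1 h2 g \<le> dcoeff_norm \<alpha>1 * (dcoeff_norm \<alpha>2 * nrm g)"
proof -
  have X2: "trans_sum (dcoeff \<alpha>2) h2 (swapxy g) \<in> LpB" by (intro trans_sum_LpB LpB_swapxy summable_abs_dcoeff \<alpha> g)
  have "mixed_diff_norm \<alpha>1 \<alpha>2 h1 h2 g \<le> dcoeff_norm \<alpha>1 * nrm (swapxy (trans_sum (dcoeff \<alpha>2) h2 (swapxy g)))"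
    unfolding mixed_diff_norm_def by (intro trans_sum_nrm summable_abs_dcoeff \<alpha> LpB_swapxy X2)
  also have "nrm (swapxy (trans_sum (dcoeff \<alpha>2) h2 (swapxy g))) = nrm (trans_sum (dcoeff \<alpha>2) h2 (swapxy g))" using X2 by simp
  also have "\<dots> \<le> dcoeff_norm \<alpha>2 * nrm (swapxy g)" by (intro trans_sum_nrm summable_abs_dcoeff \<alpha> LpB_swapxy g)
  finally show ?thesis using dcoeff_norm_ge_1[OF \<alpha>(1)] g by (simp add: mult_left_mono)
qed

lemma mixed_diff_norm_le_modulus:
  assumes \<alpha>: "0 < \<alpha>1" "0 < \<alpha>2" and g: "g \<in> LpB" and eq: "AE z in lborel. f z = g z"
    and h: "\<bar>h1\<bar> \<le> \<delta>1" "\<bar>h2\<bar> \<le> \<delta>2"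
  shows "norm_ratio * mixed_diff_norm \<alpha>1 \<alpha>2 h1 h2 g \<le> mixed_modulus p \<alpha>1 \<alpha>2 f \<delta>1 \<delta>2"
proof -
  have "norm_ratio * mixed_diff_norm \<alpha>1 \<alpha>2 h1 h2 g = (\<lambda>(h1, h2). Lp_norm p (frac_diff1 \<alpha>1 h1 (frac_diff2 \<alpha>2 h2 f))) (h1, h2)"
    by (simp add: Lp_norm_frac_diff[OF \<alpha> g eq])
  also have "\<dots> \<le> mixed_modulus p \<alpha>1 \<alpha>2 f \<delta>1 \<delta>2"
    unfolding mixed_modulus_def
  proof (rule cSUP_upper)
    show "bdd_above ((\<lambda>(h1, h2). Lp_norm p (frac_diff1 \<alpha>1 h1 (frac_diff2 \<alpha>2 h2 f))) ` {(h1, h2). \<bar>h1\<bar> \<le> \<delta>1 \<and> \<bar>h2\<bar> \<le> \<delta>2})"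
      using mixed_diff_norm_bound[OF \<alpha> g] norm_ratio_pos
      by (intro bdd_aboveI[of _ "norm_ratio * (dcoeff_norm \<alpha>1 * (dcoeff_norm \<alpha>2 * nrm g))"])
         (auto simp: Lp_norm_frac_diff[OF \<alpha> g eq])
  qed (use h in auto)
  finally show ?thesis .
qed

lemma modulus_le:
  assumes \<alpha>: "0 < \<alpha>1" "0 < \<alpha>2" and g: "g \<in> LpB" and eq: "AE z in lborel. f z = g z"
    and \<delta>: "0 \<le> \<delta>1" "0 \<le> \<delta>2"
    and le: "\<And>h1 h2. \<bar>h1\<bar> \<le> \<delta>1 \<Longrightarrow> \<bar>h2\<bar> \<le> \<delta>2 \<Longrightarrow> norm_ratio * mixed_diff_norm \<alpha>1 \<alpha>2 h1 h2 g \<le> B"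
  shows "mixed_modulus p \<alpha>1 \<alpha>2 f \<delta>1 \<delta>2 \<le> B"
  unfolding mixed_modulus_def
proof (rule cSUP_least)
  show "{(h1, h2). \<bar>h1\<bar> \<le> \<delta>1 \<and> \<bar>h2\<bar> \<le> \<delta>2} \<noteq> {}"
    using \<delta> by (auto intro!: exI[of _ 0])
qed (auto simp: Lp_norm_frac_diff[OF \<alpha> g eq] intro: le)

lemma Lp_norm_nonneg: "0 \<le> Lp_norm p f"
  by (simp add: Lp_norm_def)

lemma best_le:
  assumes "T1 \<in> Lp_torus p" "trig_poly1 m1 T1" "T2 \<in> Lp_torus p" "trig_poly2 m2 T2"
  shows "best_angular_approx p m1 m2 f \<le> Lp_norm p (\<lambda>z. f z - T1 z - T2 z)"
  unfolding best_angular_approx_def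
  using assms by (intro cInf_lower bdd_belowI[of _ 0]) (auto simp: Lp_norm_nonneg)

lemma le_best:
  assumes "\<And>T1 T2. T1 \<in> Lp_torus p \<Longrightarrow> trig_poly1 m1 T1 \<Longrightarrow> T2 \<in> Lp_torus p \<Longrightarrow> trig_poly2 m2 T2 \<Longrightarrow>
    B \<le> Lp_norm p (\<lambda>z. f z - T1 z - T2 z)"
  shows "B \<le> best_angular_approx p m1 m2 f"
  unfolding best_angular_approx_def
proof (rule cInf_greatest)
  have "(\<lambda>_. 0) \<in> Lp_torus p" "trig_poly1 m1 (\<lambda>_. 0)" "trig_poly2 m2 (\<lambda>_. 0)"
    using LpB_Lp_torus[OF LpB_zero] by (auto simp: trig_poly1_def trig_poly2_def intro!: exI[of _ "\<lambda>_ _. 0"])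
  then show "{Lp_norm p (\<lambda>z. f z - T1 z - T2 z) | T1 T2.
            T1 \<in> Lp_torus p \<and> trig_poly1 m1 T1 \<and> T2 \<in> Lp_torus p \<and> trig_poly2 m2 T2} \<noteq> {}"
    by blast
qed (use assms in auto)

lemma best_nonneg: "0 \<le> best_angular_approx p m1 m2 f"
  by (rule le_best) (rule Lp_norm_nonneg)

lemma best_antimono:
  assumes "m1 \<le> n1" "m2 \<le> n2"
  shows "best_angular_approx p n1 n2 f \<le> best_angular_approx p m1 m2 f"
  using assms by (intro le_best best_le) (auto simp: trig_poly2_swapxy intro: trig_poly1_mono)

section \<open>The direct inequality\<close>

text \<open>With \<open>g\<close> a Borel representative of \<open>f\<close>, the approximants are \<open>T1 = V1 g\<close> and \<open>T2 = V2 (g - V1 g)\<close>, and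
  the Jackson inequality in the second variable is applied to \<open>u = g - V1 g\<close>.\<close>

lemma direct_inequality:
  assumes \<alpha>: "0 < \<alpha>1" "0 < \<alpha>2"
  shows "\<exists>C>0. \<forall>f\<in>Lp_torus p. \<forall>n1 n2.
    best_angular_approx p n1 n2 f \<le> C * mixed_modulus p \<alpha>1 \<alpha>2 f (pi / real (n1 + 1)) (pi / real (n2 + 1))"
proof -
  obtain C1 where C1: "0 < C1" "\<forall>n. \<exists>a. \<forall>f\<in>LpB. \<forall>b.
    (\<forall>s. \<bar>s\<bar> \<le> pi / real (n + 1) \<longrightarrow> nrm (trans_sum (dcoeff \<alpha>1) s f) \<le> b) \<longrightarrow> nrm (id_mult_op 1 n a f) \<le> C1 * b"
    using jackson_one_variable[OF \<alpha>(1)] by blast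
  obtain C2 where C2: "0 < C2" "\<forall>n. \<exists>a. \<forall>f\<in>LpB. \<forall>b.
    (\<forall>s. \<bar>s\<bar> \<le> pi / real (n + 1) \<longrightarrow> nrm (trans_sum (dcoeff \<alpha>2) s f) \<le> b) \<longrightarrow> nrm (id_mult_op 1 n a f) \<le> C2 * b"
    using jackson_one_variable[OF \<alpha>(2)] by blast
  show ?thesis
  proof (intro exI[of _ "C2 * C1"] conjI ballI allI)
    show "0 < C2 * C1" using C1 C2 by simp
    fix f n1 n2 assume f: "f \<in> Lp_torus p"
    obtain g where g: "g \<in> LpB" and eq: "AE z in lborel. f z = g z" using Lp_torus_rep[OF f] by blast
    obtain a where a: "\<And>f b. f \<in> LpB \<Longrightarrow> (\<forall>s. \<bar>s\<bar> \<le> pi / real (n1 + 1) \<longrightarrow> nrm (trans_sum (dcoeff \<alpha>1) s f) \<le> b) \<Longrightarrow> nrm (id_mult_op 1 n1 a f) \<le> C1 * b"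
      using C1(2)[rule_format, of n1] by blast
    obtain b where b: "\<And>f c. f \<in> LpB \<Longrightarrow> (\<forall>s. \<bar>s\<bar> \<le> pi / real (n2 + 1) \<longrightarrow> nrm (trans_sum (dcoeff \<alpha>2) s f) \<le> c) \<Longrightarrow> nrm (id_mult_op 1 n2 b f) \<le> C2 * c"
      using C2(2)[rule_format, of n2] by blast
    define \<omega> where "\<omega> = mixed_modulus p \<alpha>1 \<alpha>2 f (pi / real (n1 + 1)) (pi / real (n2 + 1))"
    define w where "w = \<omega> / norm_ratio"
    have md: "mixed_diff_norm \<alpha>1 \<alpha>2 h1 h2 g \<le> w" if "\<bar>h1\<bar> \<le> pi / real (n1 + 1)" "\<bar>h2\<bar> \<le> pi / real (n2 + 1)" for h1 h2
      using mixed_diff_norm_le_modulus[OF \<alpha> g eq that] norm_ratio_pos unfolding w_def \<omega>_def[symmetric]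
      by (simp add: pos_le_divide_eq mult.commute)
    define u where "u = id_mult_op 1 n1 a g"
    have u: "u \<in> LpB" unfolding u_def by (rule id_mult_op_LpB[OF g])
    have step: "nrm (trans_sum (dcoeff \<alpha>2) s (swapxy u)) \<le> C1 * w" if s: "\<bar>s\<bar> \<le> pi / real (n2 + 1)" for s
    proof -
      define v where "v = swapxy (trans_sum (dcoeff \<alpha>2) s (swapxy g))"
      have v: "v \<in> LpB" unfolding v_def by (intro LpB_swapxy trans_sum_LpB summable_abs_dcoeff \<alpha> g)
      have "nrm (trans_sum (dcoeff \<alpha>2) s (swapxy u)) = nrm (swapxy (trans_sum (dcoeff \<alpha>2) s (swapxy u)))"
        by (rule nrm_swapxy[symmetric]) (intro LpB_swapxy trans_sum_LpB summable_abs_dcoeff \<alpha> u)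
      also have "\<dots> = nrm (id_mult_op 1 n1 a v)"
        unfolding u_def v_def by (rule nrm_cong[symmetric]) (rule id_mult_op_commute_trans_sum[OF summable_abs_dcoeff[OF \<alpha>(2)] g])
      also have "\<dots> \<le> C1 * w"
        using md[OF _ s] by (intro a v) (simp add: mixed_diff_norm_def v_def)
      finally show ?thesis .
    qed
    define T1 where "T1 = mult_op n1 (\<lambda>k. - a k) g"
    define T2 where "T2 = swapxy (mult_op n2 (\<lambda>k. - b k) (swapxy u))"
    have TX: "T1 \<in> LpB" "T2 \<in> LpB" unfolding T1_def T2_def by (intro LpB_swapxy mult_op_LpB g u)+
    have "best_angular_approx p n1 n2 f \<le> Lp_norm p (\<lambda>z. f z - T1 z - T2 z)"
      using TX by (intro best_le LpB_Lp_torus) (auto simp: T1_def T2_def trig_poly2_swapxy trig_poly1_mult_op)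
    also have "\<dots> = norm_ratio * nrm (\<lambda>z. g z - T1 z - T2 z)"
      by (rule Lp_norm_nrm, intro LpB_diff(1) g TX, use eq in eventually_elim) simp
    also have "(\<lambda>z. g z - T1 z - T2 z) = swapxy (id_mult_op 1 n2 b (swapxy u))"
    proof
      fix z :: "real \<times> real"
      have "g z - T1 z = u z" by (simp add: T1_def u_def id_mult_op_def mult_op_minus)
      then show "g z - T1 z - T2 z = swapxy (id_mult_op 1 n2 b (swapxy u)) z"
        by (cases z) (simp add: T2_def id_mult_op_def mult_op_minus)
    qed
    also have "nrm (swapxy (id_mult_op 1 n2 b (swapxy u))) = nrm (id_mult_op 1 n2 b (swapxy u))"
      by (intro nrm_swapxy id_mult_op_LpB LpB_swapxy u)
    also have "\<dots> \<le> C2 * (C1 * w)" using step by (intro b LpB_swapxy u) auto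
    finally have "best_angular_approx p n1 n2 f \<le> norm_ratio * (C2 * (C1 * w))" using norm_ratio_pos by simp
    also have "\<dots> = C2 * C1 * \<omega>" using norm_ratio_pos by (simp add: w_def)
    finally show "best_angular_approx p n1 n2 f
      \<le> C2 * C1 * mixed_modulus p \<alpha>1 \<alpha>2 f (pi / real (n1 + 1)) (pi / real (n2 + 1))"
      unfolding \<omega>_def .
  qed
qed

end

section \<open>The inverse inequality\<close>

text \<open>The terms with \<open>2 ^ J < \<nu> \<le> 2 ^ (J + 1)\<close> of the full sum dominate the dyadic term with index \<open>J + 2\<close>, at which
  \<open>Z\<close> is evaluated at \<open>2 ^ (J + 1)\<close>.\<close>

lemma dyadic_sum_le:
  fixes Z :: "nat \<Rightarrow> real"
  assumes \<alpha>: "0 < \<alpha>"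
  shows "\<exists>C>0. \<forall>Z n J. antimono Z \<longrightarrow> (\<forall>m. 0 \<le> Z m) \<longrightarrow> 2 ^ J \<le> n + 1 \<longrightarrow>
    (\<Sum>j\<le>Suc J. (2 ^ j) powr \<alpha> * Z (dyad j)) \<le> C * (\<Sum>\<nu> = 1..n + 1. real \<nu> powr (\<alpha> - 1) * Z (\<nu> - 1))"
proof -
  define c where "c = (1 / 4 :: real) powr \<bar>\<alpha> - 1\<bar> / 4"
  have c: "0 < c" by (simp add: c_def)
  define C where "C = 1 + 2 powr \<alpha> + 1 / c"
  have C: "0 < C" "1 / c \<le> C" using c by (auto simp: C_def add_pos_pos intro: add_pos_nonneg)
  have main: "(\<Sum>j\<le>Suc J. (2 ^ j) powr \<alpha> * Z (dyad j)) \<le> C * (\<Sum>\<nu> = 1..2 ^ J. real \<nu> powr (\<alpha> - 1) * Z (\<nu> - 1))"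
    if Z: "antimono Z" "\<And>m. 0 \<le> Z m" for Z :: "nat \<Rightarrow> real" and J
  proof (induction J)
    case 0
    have "Z 1 \<le> Z 0" using Z(1) by (auto dest: antimonoD)
    then have "Z 0 + 2 powr \<alpha> * Z 1 \<le> Z 0 + 2 powr \<alpha> * Z 0" by (simp add: mult_left_mono)
    also have "\<dots> \<le> C * Z 0" using c Z(2)[of 0] by (simp add: C_def algebra_simps)
    finally show ?case by (simp add: dyad_def)
  next
    case (Suc J)
    have half: "c * ((2 ^ (J + 2)) powr \<alpha> * Z (2 ^ (J + 1))) \<le> (\<Sum>\<nu> = 2 ^ J + 1..2 ^ (J + 1). real \<nu> powr (\<alpha> - 1) * Z (\<nu> - 1))"
    proof -
      define M :: real where "M = 2 ^ (J + 2)"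
      have M: "0 < M" by (simp add: M_def)
      have "(\<Sum>\<nu>\<in>{2 ^ J + 1..2 ^ (J + 1) :: nat}. (M powr (\<alpha> - 1) * (1 / 4) powr \<bar>\<alpha> - 1\<bar>) * Z (2 ^ (J + 1)))
          \<le> (\<Sum>\<nu> = 2 ^ J + 1..2 ^ (J + 1). real \<nu> powr (\<alpha> - 1) * Z (\<nu> - 1))"
      proof (intro sum_mono mult_mono)
        fix \<nu> :: nat assume \<nu>: "\<nu> \<in> {2 ^ J + 1..2 ^ (J + 1)}"
        then have "\<nu> - 1 \<le> 2 ^ (J + 1)" by auto
        then show "Z (2 ^ (J + 1)) \<le> Z (\<nu> - 1)" using Z(1) by (auto dest: antimonoD)
        have "2 ^ J \<le> \<nu>" "\<nu> \<le> 2 ^ (J + 1)" using \<nu> by auto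
        then have "2 ^ J \<le> real \<nu>" "real \<nu> \<le> 2 ^ (J + 1)"
          by (metis of_nat_le_iff of_nat_numeral of_nat_power)+
        then have u: "1 / 4 \<le> real \<nu> / M" "real \<nu> / M \<le> 1" by (auto simp: M_def)
        have "(1 / 4) powr \<bar>\<alpha> - 1\<bar> \<le> (real \<nu> / M) powr (\<alpha> - 1)"
        proof (cases "1 \<le> \<alpha>")
          case True
          then show ?thesis using u by (auto intro!: powr_mono2)
        next
          case False
          have "(1 / 4 :: real) powr \<bar>\<alpha> - 1\<bar> \<le> 1" by (intro powr_le1) auto
          also have "1 \<le> (real \<nu> / M) powr (\<alpha> - 1)"
          proof -
            have "0 < real \<nu> / M" using u by linarith
            then show ?thesis using powr_mono'[of "\<alpha> - 1" 0 "real \<nu> / M"] u False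
              by (auto split: if_splits)
          qed
          finally show ?thesis .
        qed
        then have "M powr (\<alpha> - 1) * (1 / 4) powr \<bar>\<alpha> - 1\<bar> \<le> M powr (\<alpha> - 1) * (real \<nu> / M) powr (\<alpha> - 1)"
          by (intro mult_left_mono) auto
        also have "\<dots> = real \<nu> powr (\<alpha> - 1)" using M by (simp add: powr_mult[symmetric])
        finally show "M powr (\<alpha> - 1) * (1 / 4) powr \<bar>\<alpha> - 1\<bar> \<le> real \<nu> powr (\<alpha> - 1)" .
      qed (use Z(2) in auto)
      also have "(\<Sum>\<nu>\<in>{2 ^ J + 1..2 ^ (J + 1) :: nat}. (M powr (\<alpha> - 1) * (1 / 4) powr \<bar>\<alpha> - 1\<bar>) * Z (2 ^ (J + 1)))
          = (M / 4) * ((M powr (\<alpha> - 1) * (1 / 4) powr \<bar>\<alpha> - 1\<bar>) * Z (2 ^ (J + 1)))"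
        by (simp add: M_def)
      also have "\<dots> = c * (M powr \<alpha> * Z (2 ^ (J + 1)))"
        using M by (simp add: c_def powr_diff)
      finally show ?thesis by (simp add: M_def)
    qed
    have "(2 ^ (J + 2)) powr \<alpha> * Z (2 ^ (J + 1)) = (1 / c) * (c * ((2 ^ (J + 2)) powr \<alpha> * Z (2 ^ (J + 1))))"
      using c by simp
    also have "\<dots> \<le> C * (\<Sum>\<nu> = 2 ^ J + 1..2 ^ (J + 1). real \<nu> powr (\<alpha> - 1) * Z (\<nu> - 1))"
      using half C c Z(2) by (intro mult_mono) auto
    finally have new: "(2 ^ (J + 2)) powr \<alpha> * Z (2 ^ (J + 1))
      \<le> C * (\<Sum>\<nu> = 2 ^ J + 1..2 ^ (J + 1). real \<nu> powr (\<alpha> - 1) * Z (\<nu> - 1))" .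
    have split: "(\<Sum>\<nu> = 1..2 ^ Suc J. g \<nu>) = (\<Sum>\<nu> = 1..2 ^ J. g \<nu>) + (\<Sum>\<nu> = 2 ^ J + 1..2 ^ (J + 1). g \<nu>)" for g :: "nat \<Rightarrow> real"
      using sum.ub_add_nat[of 1 "2 ^ J" g "2 ^ J"] by (simp add: mult_2)
    have "(\<Sum>j\<le>Suc (Suc J). (2 ^ j) powr \<alpha> * Z (dyad j))
        = (\<Sum>j\<le>Suc J. (2 ^ j) powr \<alpha> * Z (dyad j)) + (2 ^ (J + 2)) powr \<alpha> * Z (2 ^ (J + 1))"
      by (simp add: dyad_def)
    also have "\<dots> \<le> C * (\<Sum>\<nu> = 1..2 ^ J. real \<nu> powr (\<alpha> - 1) * Z (\<nu> - 1))
        + C * (\<Sum>\<nu> = 2 ^ J + 1..2 ^ (J + 1). real \<nu> powr (\<alpha> - 1) * Z (\<nu> - 1))"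
      using Suc.IH new by (rule add_mono)
    finally show ?case unfolding split by (simp only: distrib_left)
  qed
  show ?thesis
  proof (intro exI[of _ C] conjI allI impI C(1))
    fix Z :: "nat \<Rightarrow> real" and n J :: nat
    assume Z: "antimono Z" "\<forall>m. 0 \<le> Z m" and J: "2 ^ J \<le> n + 1"
    have "(\<Sum>j\<le>Suc J. (2 ^ j) powr \<alpha> * Z (dyad j)) \<le> C * (\<Sum>\<nu> = 1..2 ^ J. real \<nu> powr (\<alpha> - 1) * Z (\<nu> - 1))"
      using Z by (intro main) auto
    also have "\<dots> \<le> C * (\<Sum>\<nu> = 1..n + 1. real \<nu> powr (\<alpha> - 1) * Z (\<nu> - 1))"
      using Z J C by (intro mult_left_mono sum_mono2) auto
    finally show "(\<Sum>j\<le>Suc J. (2 ^ j) powr \<alpha> * Z (dyad j)) \<le> C * (\<Sum>\<nu> = 1..n + 1. real \<nu> powr (\<alpha> - 1) * Z (\<nu> - 1))" .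
  qed
qed

text \<open>An operator that annihilates a trigonometric polynomial \<open>T\<close> with arbitrary coefficient functions
  annihilates every Borel representative \<open>T'\<close> of \<open>T\<close>.\<close>

lemma id_mult_op_AE_zero:
  assumes "AE z in torus. T z = T' z" and T: "trig_poly1 m T" and T': "T' \<in> borel_measurable borel"
    and zero: "\<And>z. id_mult_op e n a T z = 0"
  shows "AE z in torus. id_mult_op e n a T' z = 0"
proof -
  have "AE z in torus. T (snd z, fst z) = T' (snd z, fst z)"
    using AE_swapxy[OF assms(1)] by (simp add: split_beta)
  then have "AE y in circ. AE t in circ. T (t, y) = T' (t, y)"
    using circ2.AE_pair by fastforce
  then have "AE y in circ. \<forall>k. fcoeff T k y = fcoeff T' k y"
  proof eventually_elim
    case (elim y)
    have [measurable]: "T' \<in> borel_measurable (borel \<Otimes>\<^sub>M borel)" using T' by (simp add: borel_prod)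
    have "(\<lambda>t. T (t, y)) \<in> borel_measurable borel"
      unfolding trig_poly1_fcoeff(1)[OF T] by measurable
    then have [measurable]: "(\<lambda>t. T (t, y)) \<in> borel_measurable circ" by simp
    have [measurable]: "(\<lambda>t. cis (- (of_int k * t))) \<in> borel_measurable borel" for k :: int
      using cis_measurable[of "- of_int k"] by simp
    show ?case
      unfolding fcoeff_def using elim by (auto intro!: integral_cong_AE elim!: eventually_mono)
  qed
  then have "AE z in torus. \<forall>k. fcoeff T k (snd z) = fcoeff T' k (snd z)" by (rule AE_torus_snd)
  with assms(1) show ?thesis
  proof eventually_elim
    case (elim z)
    have "id_mult_op e n a T' z = id_mult_op e n a T z"
      using elim by (simp add: id_mult_op_def mult_op_def split_beta)
    then show ?case by (simp add: zero)
  qed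
qed

context torus_Lp
begin

lemma dblock_as_id_mult_op: "\<exists>e n a. dblock J j = id_mult_op e n a"
  unfolding dblock_def by auto

lemma dblock_AE_zero:
  assumes "AE z in lborel. T z = T' z" and "trig_poly1 m T" "T' \<in> LpB" "j \<le> Suc J" "m \<le> dyad j"
  shows "AE z in torus. dblock J j T' z = 0"
proof -
  obtain e n a where E: "dblock J j = id_mult_op e n a" using dblock_as_id_mult_op by blast
  show ?thesis
    unfolding E using dblock_trig_poly[OF assms(2,4,5)] assms(3) unfolding E
    by (intro id_mult_op_AE_zero[OF AE_lborel_torus[OF assms(1)] assms(2)]) auto
qed

text \<open>The product of a block \<open>A\<close> in the first variable and a block \<open>B\<close> in the second one. It annihilates
  both approximants: \<open>A T1 = 0\<close> and, by commutation, \<open>B A T2 = A B T2 = 0\<close>.\<close>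

lemma nrm_dblock_dblock:
  assumes g: "g \<in> LpB" and eq: "AE z in lborel. f z = g z" and j: "j \<le> Suc J" and k: "k \<le> Suc K"
  shows "norm_ratio * nrm (dblock K k (swapxy (dblock J j g))) \<le> 36 * best_angular_approx p (dyad j) (dyad k) f"
proof -
  obtain e n a where E: "dblock J j = id_mult_op e n a" using dblock_as_id_mult_op by blast
  obtain e' n' a' where E': "dblock K k = id_mult_op e' n' a'" using dblock_as_id_mult_op by blast
  define B where "B = (\<lambda>f. swapxy (dblock K k (swapxy f)))"
  obtain CA where A: "bounded_op CA (dblock J j)" unfolding E using bounded_op_id_mult_op by blast
  obtain CB where "bounded_op CB (dblock K k)" unfolding E' using bounded_op_id_mult_op by blast
  then have B: "bounded_op CB B" unfolding B_def by (rule bounded_op_conj_swapxy)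
  have "norm_ratio * nrm (dblock K k (swapxy (dblock J j g))) / 36 \<le> best_angular_approx p (dyad j) (dyad k) f"
  proof (rule le_best)
    fix T1 T2 assume T: "T1 \<in> Lp_torus p" "trig_poly1 (dyad j) T1" "T2 \<in> Lp_torus p" "trig_poly2 (dyad k) T2"
    obtain U1 where U1: "U1 \<in> LpB" "AE z in lborel. T1 z = U1 z" using Lp_torus_rep[OF T(1)] by blast
    obtain U2 where U2: "U2 \<in> LpB" "AE z in lborel. T2 z = U2 z" using Lp_torus_rep[OF T(3)] by blast
    define u where "u = (\<lambda>z. g z - U1 z - U2 z)"
    have g1: "(\<lambda>z. g z - U1 z) \<in> LpB" by (intro LpB_diff(1) g U1)
    have u: "u \<in> LpB" unfolding u_def by (intro LpB_diff(1) g1 U2)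
    have A1: "AE z in torus. dblock J j U1 z = 0"
      by (rule dblock_AE_zero[OF U1(2) T(2) U1(1) j]) simp
    \<comment> \<open>The exchange of variables preserves the Lebesgue measure.\<close>
    have swAE: "AE z in lborel. swapxy T2 z = swapxy U2 z"
    proof -
      have "AE z in lborel \<Otimes>\<^sub>M lborel. T2 z = U2 z" unfolding lborel_prod by (rule U2(2))
      then have "AE z in distr (lborel \<Otimes>\<^sub>M lborel) (lborel \<Otimes>\<^sub>M lborel) (\<lambda>(x, y). (y, x)). T2 z = U2 z"
        by (simp only: lborel_pair.distr_pair_swap[symmetric])
      then have "AE z in lborel \<Otimes>\<^sub>M lborel. T2 (case z of (x, y) \<Rightarrow> (y, x)) = U2 (case z of (x, y) \<Rightarrow> (y, x))"
        by (rule AE_distrD[rotated]) measurable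
      then show ?thesis unfolding lborel_prod by eventually_elim (simp add: swapxy_def split_beta)
    qed
    have "AE z in torus. dblock K k (swapxy U2) z = 0"
      using T(4) by (intro dblock_AE_zero[OF swAE _ _ k]) (auto simp: trig_poly2_swapxy U2)
    from AE_swapxy[OF this] have B2: "AE z in torus. B U2 z = 0" by (simp add: B_def swapxy_def split_beta)
    have "AE z in torus. dblock J j (B U2) z = 0"
      by (rule bounded_op_zero[OF A bounded_op_LpB[OF B U2(1)] B2])
    moreover have "AE z in torus. dblock J j (B U2) z = B (dblock J j U2) z"
      unfolding B_def E E' by (rule id_mult_op_id_mult_op_commute[OF U2(1)])
    ultimately have BA2: "AE z in torus. B (dblock J j U2) z = 0" by eventually_elim simp
    have BA1: "AE z in torus. B (dblock J j U1) z = 0"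
      by (rule bounded_op_zero[OF B bounded_op_LpB[OF A U1(1)] A1])
    have BA: "bounded_op (CB * CA) (\<lambda>f. B (dblock J j f))" by (rule bounded_op_comp[OF B A])
    have "AE z in torus. B (dblock J j u) z = B (dblock J j g) z"
      using bounded_op_diff[OF BA g1 U2(1)] bounded_op_diff[OF BA g U1(1)] BA1 BA2
      unfolding u_def by eventually_elim simp
    then have "nrm (B (dblock J j g)) = nrm (B (dblock J j u))" by (rule nrm_cong[symmetric])
    also have "\<dots> = nrm (dblock K k (swapxy (dblock J j u)))"
      unfolding B_def by (intro nrm_swapxy dblock_LpB LpB_swapxy u)
    also have "\<dots> \<le> 6 * nrm (swapxy (dblock J j u))" by (intro nrm_dblock LpB_swapxy dblock_LpB u)
    also have "\<dots> = 6 * nrm (dblock J j u)" using dblock_LpB[OF u] by simp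
    also have "\<dots> \<le> 6 * (6 * nrm u)" using nrm_dblock[OF u] by simp
    finally have "nrm (B (dblock J j g)) \<le> 36 * nrm u" by simp
    moreover have "nrm (B (dblock J j g)) = nrm (dblock K k (swapxy (dblock J j g)))"
      unfolding B_def by (intro nrm_swapxy dblock_LpB LpB_swapxy g)
    moreover have "Lp_norm p (\<lambda>z. f z - T1 z - T2 z) = norm_ratio * nrm u"
      by (rule Lp_norm_nrm[OF u]) (use eq U1(2) U2(2) in eventually_elim, simp add: u_def)
    ultimately show "norm_ratio * nrm (dblock K k (swapxy (dblock J j g))) / 36 \<le> Lp_norm p (\<lambda>z. f z - T1 z - T2 z)"
      using norm_ratio_pos by simp
  qed
  then show ?thesis by simp
qed

lemma inverse_inequality:
  assumes \<alpha>: "0 < \<alpha>1" "0 < \<alpha>2"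
  shows "\<exists>C>0. \<forall>f\<in>Lp_torus p. \<forall>n1 n2.
    mixed_modulus p \<alpha>1 \<alpha>2 f (pi / real (n1 + 1)) (pi / real (n2 + 1))
      \<le> C * (1 / (real (n1 + 1) powr \<alpha>1 * real (n2 + 1) powr \<alpha>2) *
          (\<Sum>\<nu>1 = 1..n1 + 1. \<Sum>\<nu>2 = 1..n2 + 1.
             real \<nu>1 powr (\<alpha>1 - 1) * real \<nu>2 powr (\<alpha>2 - 1) * best_angular_approx p (\<nu>1 - 1) (\<nu>2 - 1) f))"
proof -
  obtain C1 where C1: "0 < C1" "\<And>n J h G. 2 ^ J \<le> n + 1 \<Longrightarrow> n + 1 < 2 ^ Suc J \<Longrightarrow> \<bar>h\<bar> \<le> pi / real (n + 1) \<Longrightarrow> G \<in> LpB \<Longrightarrow>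
    nrm (trans_sum (dcoeff \<alpha>1) h G) \<le> C1 * (\<Sum>j\<le>Suc J. (2 ^ j / real (n + 1)) powr \<alpha>1 * nrm (dblock J j G))"
    using inverse_one_variable[OF \<alpha>(1)] by blast
  obtain C2 where C2: "0 < C2" "\<And>n J h G. 2 ^ J \<le> n + 1 \<Longrightarrow> n + 1 < 2 ^ Suc J \<Longrightarrow> \<bar>h\<bar> \<le> pi / real (n + 1) \<Longrightarrow> G \<in> LpB \<Longrightarrow>
    nrm (trans_sum (dcoeff \<alpha>2) h G) \<le> C2 * (\<Sum>j\<le>Suc J. (2 ^ j / real (n + 1)) powr \<alpha>2 * nrm (dblock J j G))"
    using inverse_one_variable[OF \<alpha>(2)] by blast
  obtain D1 where D1: "0 < D1" "\<And>Z n J. antimono Z \<Longrightarrow> (\<forall>m. 0 \<le> Z m) \<Longrightarrow> 2 ^ J \<le> n + 1 \<Longrightarrow>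
    (\<Sum>j\<le>Suc J. (2 ^ j) powr \<alpha>1 * Z (dyad j)) \<le> D1 * (\<Sum>\<nu> = 1..n + 1. real \<nu> powr (\<alpha>1 - 1) * Z (\<nu> - 1))"
    using dyadic_sum_le[OF \<alpha>(1)] by blast
  obtain D2 where D2: "0 < D2" "\<And>Z n J. antimono Z \<Longrightarrow> (\<forall>m. 0 \<le> Z m) \<Longrightarrow> 2 ^ J \<le> n + 1 \<Longrightarrow>
    (\<Sum>j\<le>Suc J. (2 ^ j) powr \<alpha>2 * Z (dyad j)) \<le> D2 * (\<Sum>\<nu> = 1..n + 1. real \<nu> powr (\<alpha>2 - 1) * Z (\<nu> - 1))"
    using dyadic_sum_le[OF \<alpha>(2)] by blast
  define C where "C = C1 * C2 * 36 * D2 * D1"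
  have C: "0 < C" using C1(1) C2(1) D1(1) D2(1) by (simp add: C_def)
  show ?thesis
  proof (intro exI[of _ C] conjI ballI allI C)
    fix f and n1 n2 :: nat assume f: "f \<in> Lp_torus p"
    obtain g where g: "g \<in> LpB" and eq: "AE z in lborel. f z = g z" using Lp_torus_rep[OF f] by blast
    obtain J where J: "2 ^ J \<le> n1 + 1" "n1 + 1 < 2 ^ Suc J" using ex_power_ivl1[of 2 "n1 + 1"] by auto
    obtain K where K: "2 ^ K \<le> n2 + 1" "n2 + 1 < 2 ^ Suc K" using ex_power_ivl1[of 2 "n2 + 1"] by auto
    define Y where "Y m1 m2 = best_angular_approx p m1 m2 f" for m1 m2
    have Y0: "0 \<le> Y m1 m2" for m1 m2 unfolding Y_def by (rule best_nonneg)
    have Yanti: "Y n n' \<le> Y m m'" if "m \<le> n" "m' \<le> n'" for m n m' n' unfolding Y_def using that by (rule best_antimono)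
    define N1 where "N1 = real (n1 + 1)"
    define N2 where "N2 = real (n2 + 1)"
    have N: "0 < N1" "0 < N2" by (auto simp: N1_def N2_def)
    define S where "S = (\<Sum>\<nu>1 = 1..n1 + 1. \<Sum>\<nu>2 = 1..n2 + 1.
      real \<nu>1 powr (\<alpha>1 - 1) * real \<nu>2 powr (\<alpha>2 - 1) * Y (\<nu>1 - 1) (\<nu>2 - 1))"
    have sums: "(\<Sum>j\<le>Suc J. (2 ^ j) powr \<alpha>1 * (\<Sum>k\<le>Suc K. (2 ^ k) powr \<alpha>2 * Y (dyad j) (dyad k))) \<le> D2 * (D1 * S)"
    proof -
      define Z where "Z m = (\<Sum>\<nu> = 1..n2 + 1. real \<nu> powr (\<alpha>2 - 1) * Y m (\<nu> - 1))" for m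
      have "(\<Sum>j\<le>Suc J. (2 ^ j) powr \<alpha>1 * (\<Sum>k\<le>Suc K. (2 ^ k) powr \<alpha>2 * Y (dyad j) (dyad k)))
          \<le> (\<Sum>j\<le>Suc J. (2 ^ j) powr \<alpha>1 * (D2 * Z (dyad j)))"
        unfolding Z_def using Y0 Yanti K(1)
        by (intro sum_mono mult_left_mono D2(2)) (auto intro!: antimonoI)
      also have "\<dots> = D2 * (\<Sum>j\<le>Suc J. (2 ^ j) powr \<alpha>1 * Z (dyad j))"
        by (simp only: sum_distrib_left mult.left_commute)
      also have "\<dots> \<le> D2 * (D1 * (\<Sum>\<nu> = 1..n1 + 1. real \<nu> powr (\<alpha>1 - 1) * Z (\<nu> - 1)))"
      proof (rule mult_left_mono[OF D1(2)])
        show "antimono Z"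
        proof (rule antimonoI)
          fix x y :: nat assume "x \<le> y"
          then show "Z y \<le> Z x" unfolding Z_def by (intro sum_mono mult_left_mono Yanti) auto
        qed
        show "\<forall>m. 0 \<le> Z m" unfolding Z_def by (intro allI sum_nonneg mult_nonneg_nonneg Y0) auto
      qed (use J(1) D2(1) in auto)
      also have "(\<Sum>\<nu> = 1..n1 + 1. real \<nu> powr (\<alpha>1 - 1) * Z (\<nu> - 1)) = S"
        unfolding S_def Z_def by (simp only: sum_distrib_left mult.assoc)
      finally show ?thesis .
    qed
    show "mixed_modulus p \<alpha>1 \<alpha>2 f (pi / real (n1 + 1)) (pi / real (n2 + 1))
      \<le> C * (1 / (real (n1 + 1) powr \<alpha>1 * real (n2 + 1) powr \<alpha>2) *
          (\<Sum>\<nu>1 = 1..n1 + 1. \<Sum>\<nu>2 = 1..n2 + 1.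
             real \<nu>1 powr (\<alpha>1 - 1) * real \<nu>2 powr (\<alpha>2 - 1) * best_angular_approx p (\<nu>1 - 1) (\<nu>2 - 1) f))"
      unfolding Y_def[symmetric] S_def[symmetric] N1_def[symmetric] N2_def[symmetric]
    proof (rule modulus_le[OF \<alpha> g eq])
      fix h1 h2 assume h: "\<bar>h1\<bar> \<le> pi / N1" "\<bar>h2\<bar> \<le> pi / N2"
      define v where "v = swapxy (trans_sum (dcoeff \<alpha>2) h2 (swapxy g))"
      have v: "v \<in> LpB" unfolding v_def by (intro LpB_swapxy trans_sum_LpB summable_abs_dcoeff \<alpha> g)
      have EX: "dblock J j g \<in> LpB" for j by (rule dblock_LpB[OF g])
      have row: "nrm (dblock J j v) \<le> C2 * (\<Sum>k\<le>Suc K. (2 ^ k / N2) powr \<alpha>2 * nrm (dblock K k (swapxy (dblock J j g))))" for j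
      proof -
        obtain e n a where E: "dblock J j = id_mult_op e n a" using dblock_as_id_mult_op by blast
        have "nrm (dblock J j v) = nrm (swapxy (trans_sum (dcoeff \<alpha>2) h2 (swapxy (dblock J j g))))"
          unfolding v_def E by (rule nrm_cong) (rule id_mult_op_commute_trans_sum[OF summable_abs_dcoeff[OF \<alpha>(2)] g])
        also have "\<dots> = nrm (trans_sum (dcoeff \<alpha>2) h2 (swapxy (dblock J j g)))"
          by (intro nrm_swapxy trans_sum_LpB LpB_swapxy summable_abs_dcoeff \<alpha> EX)
        also have "\<dots> \<le> C2 * (\<Sum>k\<le>Suc K. (2 ^ k / N2) powr \<alpha>2 * nrm (dblock K k (swapxy (dblock J j g))))"
          using h(2) unfolding N2_def by (intro C2(2) K LpB_swapxy EX)
        finally show ?thesis .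
      qed
      have "norm_ratio * mixed_diff_norm \<alpha>1 \<alpha>2 h1 h2 g \<le> norm_ratio * (C1 * (\<Sum>j\<le>Suc J. (2 ^ j / N1) powr \<alpha>1 * nrm (dblock J j v)))"
        unfolding mixed_diff_norm_def v_def[symmetric] using h(1) norm_ratio_pos unfolding N1_def
        by (intro mult_left_mono C1(2) J v) auto
      also have "\<dots> \<le> norm_ratio * (C1 * (\<Sum>j\<le>Suc J. (2 ^ j / N1) powr \<alpha>1
          * (C2 * (\<Sum>k\<le>Suc K. (2 ^ k / N2) powr \<alpha>2 * nrm (dblock K k (swapxy (dblock J j g)))))))"
        using norm_ratio_pos C1(1) by (intro mult_left_mono sum_mono row) auto
      also have "\<dots> = C1 * C2 * (\<Sum>j\<le>Suc J. (2 ^ j / N1) powr \<alpha>1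
          * (\<Sum>k\<le>Suc K. (2 ^ k / N2) powr \<alpha>2 * (norm_ratio * nrm (dblock K k (swapxy (dblock J j g))))))"
        by (simp only: sum_distrib_left mult_ac)
      also have "\<dots> \<le> C1 * C2 * (\<Sum>j\<le>Suc J. (2 ^ j / N1) powr \<alpha>1
          * (\<Sum>k\<le>Suc K. (2 ^ k / N2) powr \<alpha>2 * (36 * Y (dyad j) (dyad k))))"
        unfolding Y_def using C1(1) C2(1) by (intro mult_left_mono sum_mono nrm_dblock_dblock g eq) auto
      also have "\<dots> = C1 * C2 * 36 * (1 / (N1 powr \<alpha>1 * N2 powr \<alpha>2))
          * (\<Sum>j\<le>Suc J. (2 ^ j) powr \<alpha>1 * (\<Sum>k\<le>Suc K. (2 ^ k) powr \<alpha>2 * Y (dyad j) (dyad k)))"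
      proof -
        have d: "(2 ^ j / M) powr \<alpha> = (2 ^ j) powr \<alpha> * (1 / M powr \<alpha>)" if "0 < M" for j and M \<alpha> :: real
          using that by (simp add: powr_divide)
        show ?thesis
          unfolding d[OF N(1)] d[OF N(2)] sum_distrib_left
          by (intro sum.cong refl) (simp add: mult_ac)
      qed
      also have "\<dots> \<le> C1 * C2 * 36 * (1 / (N1 powr \<alpha>1 * N2 powr \<alpha>2)) * (D2 * (D1 * S))"
        using C1(1) C2(1) by (intro mult_left_mono sums) auto
      also have "\<dots> = C * (1 / (N1 powr \<alpha>1 * N2 powr \<alpha>2) * S)"
        by (simp only: C_def mult_ac)
      finally show "norm_ratio * mixed_diff_norm \<alpha>1 \<alpha>2 h1 h2 g \<le> C * (1 / (N1 powr \<alpha>1 * N2 powr \<alpha>2) * S)" .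
    qed (use N in auto)
  qed
qed

end

section \<open>Angular approximation and the mixed modulus of smoothness\<close>

theorem theorem4p2:
  fixes p \<alpha>\<^sub>1 \<alpha>\<^sub>2 :: real
  assumes "1 < p" and "0 < \<alpha>\<^sub>1" and "0 < \<alpha>\<^sub>2"
  shows "(\<exists>C>0. \<forall>f\<in>Lp0_torus p. \<forall>n\<^sub>1 n\<^sub>2 :: nat.
            best_angular_approx p n\<^sub>1 n\<^sub>2 f
              \<le> C * mixed_modulus p \<alpha>\<^sub>1 \<alpha>\<^sub>2 f (pi / real (n\<^sub>1 + 1)) (pi / real (n\<^sub>2 + 1)))
       \<and> (\<exists>C>0. \<forall>f\<in>Lp0_torus p. \<forall>n\<^sub>1 n\<^sub>2 :: nat.
            mixed_modulus p \<alpha>\<^sub>1 \<alpha>\<^sub>2 f (pi / real (n\<^sub>1 + 1)) (pi / real (n\<^sub>2 + 1))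
              \<le> C * (1 / (real (n\<^sub>1 + 1) powr \<alpha>\<^sub>1 * real (n\<^sub>2 + 1) powr \<alpha>\<^sub>2) *
                  (\<Sum>\<nu>\<^sub>1 = 1..n\<^sub>1 + 1. \<Sum>\<nu>\<^sub>2 = 1..n\<^sub>2 + 1.
                     real \<nu>\<^sub>1 powr (\<alpha>\<^sub>1 - 1) * real \<nu>\<^sub>2 powr (\<alpha>\<^sub>2 - 1) *
                     best_angular_approx p (\<nu>\<^sub>1 - 1) (\<nu>\<^sub>2 - 1) f)))"
proof -
  interpret torus_Lp p by unfold_locales fact
  have "Lp0_torus p \<subseteq> Lp_torus p" by (auto simp: Lp0_torus_def)
  then show ?thesis
    using direct_inequality[OF assms(2,3)] inverse_inequality[OF assms(2,3)]
    by (meson subsetD)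
qed

end
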